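(* Let $a,b,\sigma>0$, $\alpha\in(0,1)$, $\mathcal O=\mathbb R$, and let $(r_t)$ be given by the Vasicek model $dr_t=(a-br_t)dt+\sigma dW_t$, $r_0=r$. Let $$E=\{\varphi\in C(\mathbb R):\lim_{|r|\to\infty}|\varphi(r)|e^{-\frac\alpha b|r|}=0\},\qquad\|\varphi\|_E=\sup_{r\in\mathbb R}|\varphi(r)|e^{-\frac\alpha b|r|}.$$ Suppose that $\gamma>\max\{\gamma_1,\gamma_2\}$, where $$\gamma_1=\frac{\alpha a}b+\frac{\alpha^2\sigma^2}{(1-\alpha)b^2},\qquad\gamma_2=\frac{\alpha a}b+\frac{3\alpha^2\sigma^2}{2\sqrt{1-\alpha}\,b^2}+\alpha\sigma\frac{b+1}b.$$ Then: (1) For any fixed $t\ge0$, $r\in\mathbb R$, $\varphi\in E$ and any sequence $\{T_n\}$ of stopping times, the sequences $$\Big\{\varphi(r_{t\wedge T_n})e^{\alpha\int_0^{t\wedge T_n}r_sds}\Big\}_{n\in\mathbb N},\qquad\Big\{\int_0^{t\wedge T_n}\varphi(r_s)e^{\alpha\int_0^sr_udu}ds\Big\}_{n\in\mathbb N}$$ are uniformly integrable with respect to $\mathbb P^r$. (2) For any Lipschitz continuous bounded $f:[0,\infty)\to[0,\infty)$ and any non-negative $\phi\in E$, one has $f(\phi)\in E$. (3) The family $(P_t,t\ge0)$, $P_t\varphi(r)=\mathbb E^r\varphi(r_t)e^{\alpha\int_0^tr_sds}$, $r\in\mathbb R$, forms a $C_0$-semigroup on $E$. (4) For any $r\in\mathbb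 R$, $\lim_{t\to\infty}\mathbb E^re^{-\gamma t+\alpha\int_0^tr_sds}N^{1-\alpha}(r_t)=0$; for any stopping time $\tau_A^{(C;r,v)}$ (with $C\in\mathcal U$, $r\in\mathbb R$, $v>0$) the family $$\Big\{e^{-\gamma\tau_n+\alpha\int_0^{\tau_n}r_sds}N^{1-\alpha}(r_{\tau_n})\chi_{\{\tau_A^{(C;r,v)}<\infty\}}\Big\}_{n\in\mathbb N},\qquad\tau_n=n\wedge\tau_A^{(C;r,v)},$$ is uniformly integrable; and $N^{1-\alpha}\in C^2(\mathbb R)\cap E$ and $AN^{1-\alpha}\in E$.
   Context: $(W_t)$ is a one-dimensional Brownian motion on a filtered probability space $(\Omega,\mathcal F,(\mathcal F_t),\mathbb P)$. $\mathbb P^r=\mathbb P(\cdot\,|\,r_0=r)$, $\mathbb E^r$ is the corresponding expectation; $\chi$ denotes an indicator function. $\mathcal U$ is the set of all non-negative progressively measurable processes $C=(C_t)_{t\ge0}$. For $C\in\mathcal U$, $v>0$ the wealth $V=V^{(C;r,v)}$ satisfies $dV_t=(r_tV_t-C_t)dt$, $V_0=v$; $\tau_A^{(C;r,v)}=\inf\{t\ge0:V_t=0\}$. The function $N$ is $$N(r)=\mathbb E^r\int_0^\infty e^{\frac1{1-\alpha}(-\gamma t+\alpha\int_0^tr_sds)}dt,$$ and $A\varphi(r)=\tfrac12\sigma^2\varphi''(r)+(a-br)\varphi'(r)+\alpha r\varphi(r)$. *)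

theory Defs
  imports "HOL-Probability.Probability"
begin

section \<open>Stochastic setting\<close>

text \<open>Filtrations are indexed by \<^typ>\<open>ennreal\<close>, so that \<^const>\<open>stopping_time\<close> covers stopping
  times with values in the closed half-line. Only the members with a finite index matter for
  adaptedness. Processes are indexed by real times, of which only the non-negative ones matter.
  No completeness or right-continuity of the filtration is assumed; instead, continuous processes
  have all their paths continuous.\<close>

locale filtered_prob_space = prob_space M + filtration "space M" F
  for M :: "'a measure" and F :: "ennreal \<Rightarrow> 'a measure" +
  assumes sets_F_subset: "\<And>t. sets (F t) \<subseteq> sets M"

definition adapted :: "(ennreal \<Rightarrow> 'a measure) \<Rightarrow> (real \<Rightarrow> 'a \<Rightarrow> real) \<Rightarrow> bool" where
  "adapted F X \<longleftrightarrow> (\<forall>t\<ge>0. X t \<in> borel_measurable (F (ennreal t)))"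

definition continuous_paths :: "'a measure \<Rightarrow> (real \<Rightarrow> 'a \<Rightarrow> real) \<Rightarrow> bool" where
  "continuous_paths M X \<longleftrightarrow> (\<forall>\<omega>\<in>space M. continuous_on {0..} (\<lambda>t. X t \<omega>))"

definition progressively_measurable ::
    "(ennreal \<Rightarrow> 'a measure) \<Rightarrow> (real \<Rightarrow> 'a \<Rightarrow> real) \<Rightarrow> bool" where
  "progressively_measurable F X \<longleftrightarrow>
    (\<forall>t\<ge>0. (\<lambda>(s, \<omega>). X s \<omega>)
      \<in> borel_measurable (restrict_space borel {0..t} \<Otimes>\<^sub>M F (ennreal t)))"

definition brownian_motion ::
    "'a measure \<Rightarrow> (ennreal \<Rightarrow> 'a measure) \<Rightarrow> (real \<Rightarrow> 'a \<Rightarrow> real) \<Rightarrow> bool" where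
  "brownian_motion M F W \<longleftrightarrow>
    adapted F W \<and> continuous_paths M W \<and> (AE \<omega> in M. W 0 \<omega> = 0) \<and>
    (\<forall>s t. 0 \<le> s \<longrightarrow> s < t \<longrightarrow>
      distributed M lborel (\<lambda>\<omega>. W t \<omega> - W s \<omega>) (normal_density 0 (sqrt (t - s))) \<and>
      prob_space.indep_set M (sets (F (ennreal s)))
        {(\<lambda>\<omega>. W t \<omega> - W s \<omega>) -` A \<inter> space M |A. A \<in> sets borel})"

definition uniformly_integrable ::
    "'a measure \<Rightarrow> (nat \<Rightarrow> 'a \<Rightarrow> real) \<Rightarrow> bool" where
  "uniformly_integrable M X \<longleftrightarrow>
    (\<forall>n. X n \<in> borel_measurable M) \<and>
    ((\<lambda>K::real. SUP n. \<integral>\<^sup>+\<omega>\<in>{\<omega>. K \<le> \<bar>X n \<omega>\<bar>}. ennreal \<bar>X n \<omega>\<bar> \<partial>M) \<longlongrightarrow> 0) at_top"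

section \<open>The Vasicek model\<close>

text \<open>The diffusion coefficient is constant, so the stochastic integral in the integrated form
  of the equation is a multiple of the Brownian motion.\<close>

definition vasicek_solution ::
    "'a measure \<Rightarrow> (ennreal \<Rightarrow> 'a measure) \<Rightarrow> (real \<Rightarrow> 'a \<Rightarrow> real) \<Rightarrow>
      real \<Rightarrow> real \<Rightarrow> real \<Rightarrow> real \<Rightarrow> (real \<Rightarrow> 'a \<Rightarrow> real) \<Rightarrow> bool" where
  "vasicek_solution M F W a b \<sigma> r X \<longleftrightarrow>
    adapted F X \<and> continuous_paths M X \<and>
    (AE \<omega> in M. \<forall>t\<ge>0. X t \<omega> = r + (LBINT s:{0..t}. a - b * X s \<omega>) + \<sigma> * W t \<omega>)"

text \<open>Below, \<open>\<rho> r\<close> is the rate process started at \<open>r\<close>. Expectations and uniform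
  integrability under the conditional law given that the rate starts at \<open>r\<close> are those of the
  corresponding functionals of \<open>\<rho> r\<close> under \<open>M\<close>.\<close>

definition consumption_plans ::
    "'a measure \<Rightarrow> (ennreal \<Rightarrow> 'a measure) \<Rightarrow> (real \<Rightarrow> 'a \<Rightarrow> real) set" where
  "consumption_plans M F =
    {C. progressively_measurable F C \<and> (\<forall>t\<ge>0. \<forall>\<omega>\<in>space M. 0 \<le> C t \<omega>)}"

definition wealth_process ::
    "'a measure \<Rightarrow> (ennreal \<Rightarrow> 'a measure) \<Rightarrow> (real \<Rightarrow> 'a \<Rightarrow> real) \<Rightarrow> (real \<Rightarrow> 'a \<Rightarrow> real) \<Rightarrow>
      real \<Rightarrow> (real \<Rightarrow> 'a \<Rightarrow> real) \<Rightarrow> bool" where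
  "wealth_process M F X C v V \<longleftrightarrow>
    adapted F V \<and> continuous_paths M V \<and>
    (AE \<omega> in M. \<forall>t\<ge>0.
      set_integrable lborel {0..t} (\<lambda>s. X s \<omega> * V s \<omega> - C s \<omega>) \<and>
      V t \<omega> = v + (LBINT s:{0..t}. X s \<omega> * V s \<omega> - C s \<omega>))"

definition ruin_time :: "(real \<Rightarrow> 'a \<Rightarrow> real) \<Rightarrow> 'a \<Rightarrow> ennreal" where
  "ruin_time V \<omega> = Inf (ennreal ` {t. 0 \<le> t \<and> V t \<omega> = 0})"

definition value_N ::
    "'a measure \<Rightarrow> real \<Rightarrow> real \<Rightarrow> (real \<Rightarrow> real \<Rightarrow> 'a \<Rightarrow> real) \<Rightarrow> real \<Rightarrow> ennreal" where
  "value_N M \<alpha> \<gamma> \<rho> r =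
    (\<integral>\<^sup>+\<omega>. (\<integral>\<^sup>+t\<in>{0..}. ennreal (exp (1 / (1 - \<alpha>) *
      (- \<gamma> * t + \<alpha> * (LBINT s:{0..t}. \<rho> r s \<omega>)))) \<partial>lborel) \<partial>M)"

definition N_pow ::
    "'a measure \<Rightarrow> real \<Rightarrow> real \<Rightarrow> (real \<Rightarrow> real \<Rightarrow> 'a \<Rightarrow> real) \<Rightarrow> real \<Rightarrow> real" where
  "N_pow M \<alpha> \<gamma> \<rho> r = enn2real (value_N M \<alpha> \<gamma> \<rho> r) powr (1 - \<alpha>)"

definition vasicek_generator ::
    "real \<Rightarrow> real \<Rightarrow> real \<Rightarrow> real \<Rightarrow> (real \<Rightarrow> real) \<Rightarrow> real \<Rightarrow> real" where
  "vasicek_generator a b \<sigma> \<alpha> \<phi> r =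
    1 / 2 * \<sigma>\<^sup>2 * deriv (deriv \<phi>) r + (a - b * r) * deriv \<phi> r + \<alpha> * r * \<phi> r"

definition feynman_kac ::
    "'a measure \<Rightarrow> real \<Rightarrow> (real \<Rightarrow> real \<Rightarrow> 'a \<Rightarrow> real) \<Rightarrow>
      real \<Rightarrow> (real \<Rightarrow> real) \<Rightarrow> real \<Rightarrow> real" where
  "feynman_kac M \<alpha> \<rho> t \<phi> r =
    (\<integral>\<omega>. \<phi> (\<rho> r t \<omega>) * exp (\<alpha> * (LBINT s:{0..t}. \<rho> r s \<omega>)) \<partial>M)"

section \<open>Function spaces and semigroups\<close>

definition weighted_space :: "real \<Rightarrow> (real \<Rightarrow> real) set" where
  "weighted_space c =
    {\<phi>. continuous_on UNIV \<phi> \<and> ((\<lambda>r. \<bar>\<phi> r\<bar> * exp (- c * \<bar>r\<bar>)) \<longlongrightarrow> 0) at_infinity}"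

definition weighted_norm :: "real \<Rightarrow> (real \<Rightarrow> real) \<Rightarrow> real" where
  "weighted_norm c \<phi> = (SUP r. \<bar>\<phi> r\<bar> * exp (- c * \<bar>r\<bar>))"

definition C2_fun :: "(real \<Rightarrow> real) \<Rightarrow> bool" where
  "C2_fun \<phi> \<longleftrightarrow> \<phi> differentiable_on UNIV \<and> deriv \<phi> differentiable_on UNIV \<and>
    continuous_on UNIV (deriv (deriv \<phi>))"

definition C0_semigroup_on ::
    "(real \<Rightarrow> real) set \<Rightarrow> ((real \<Rightarrow> real) \<Rightarrow> real) \<Rightarrow>
      (real \<Rightarrow> (real \<Rightarrow> real) \<Rightarrow> real \<Rightarrow> real) \<Rightarrow> bool" where
  "C0_semigroup_on E nrm P \<longleftrightarrow>
    (\<forall>t\<ge>0. \<forall>\<phi>\<in>E. P t \<phi> \<in> E) \<and>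
    (\<forall>t\<ge>0. \<forall>\<phi>\<in>E. \<forall>\<psi>\<in>E. P t (\<lambda>x. \<phi> x + \<psi> x) = (\<lambda>x. P t \<phi> x + P t \<psi> x)) \<and>
    (\<forall>t\<ge>0. \<forall>\<phi>\<in>E. \<forall>c. P t (\<lambda>x. c * \<phi> x) = (\<lambda>x. c * P t \<phi> x)) \<and>
    (\<forall>t\<ge>0. \<exists>K. \<forall>\<phi>\<in>E. nrm (P t \<phi>) \<le> K * nrm \<phi>) \<and>
    (\<forall>\<phi>\<in>E. P 0 \<phi> = \<phi>) \<and>
    (\<forall>s\<ge>0. \<forall>t\<ge>0. \<forall>\<phi>\<in>E. P (s + t) \<phi> = P s (P t \<phi>)) \<and>
    (\<forall>\<phi>\<in>E. ((\<lambda>t. nrm (\<lambda>x. P t \<phi> x - \<phi> x)) \<longlongrightarrow> 0) (at_right 0))"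

end

theory Submission
  imports Defs "HOL-Real_Asymp.Real_Asymp"
begin

text \<open>The drift of the Vasicek equation is linear, so everything rests on one Gaussian computation.
  Integrating the equation gives \<open>\<alpha> \<integral>r = (\<alpha> / b) (r + a t + \<sigma> W\<^sub>t - r\<^sub>t)\<close>, and solving it
  gives \<open>r\<^sub>t = e\<^sup>-\<^sup>b\<^sup>t r + (a / b) (1 - e\<^sup>-\<^sup>b\<^sup>t) + \<sigma> Y\<^sub>t\<close>, where \<open>Y\<^sub>t\<close> is the Wiener integral
  of \<open>e\<^sup>-\<^sup>b\<^sup>(\<^sup>t\<^sup>-\<^sup>s\<^sup>)\<close>. The integral is a limit of Riemann sums of independent increments, which
  yields \<open>E exp (A W\<^sub>t + B Y\<^sub>t)\<close> for real \<open>A\<close> and complex \<open>B\<close>. Read with \<open>B = B\<^sub>0 + \<i> u\<close>, this is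
  the characteristic function of \<open>Y\<^sub>t\<close> under the law with density proportional to
  \<open>exp (A W\<^sub>t + B\<^sub>0 Y\<^sub>t)\<close>, and it is Gaussian. Hence \<open>P\<^sub>t \<phi>\<close> is an explicit exponential factor
  times the integral of \<open>\<phi>\<close> against an explicit normal law (\<open>integral_kernel\<close>).

  \<^emph>\<open>Semigroup.\<close> The factor \<open>exp (\<alpha> r (1 - e\<^sup>-\<^sup>b\<^sup>t) / b)\<close> is what the weight \<open>e\<^sup>-\<^sup>(\<^sup>\<alpha>\<^sup>/\<^sup>b\<^sup>)\<^sup>|\<^sup>r\<^sup>|\<close> loses when
  \<open>r\<close> is contracted to \<open>e\<^sup>-\<^sup>b\<^sup>t r\<close>. So the weighted integrands have a bound that does not depend on
  \<open>r\<close> (\<open>weighted_kernel_bound\<close>), and dominated convergence along sequences of starting points, either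
  convergent or escaping to infinity, gives invariance of the space and strong continuity at once.
  The semigroup law is a Gaussian tilt followed by a Gaussian convolution.

  \<^emph>\<open>Uniform integrability.\<close> Each family is dominated by one integrable variable. Along a path,
  \<open>\<alpha> \<integral>r + (\<alpha> / b) |r|\<close> increases over a time interval by at most a multiple of the oscillation of
  the Brownian motion there (\<open>vasicek_path_restart\<close>), and this oscillation has exponential moments by
  a maximal inequality. One interval is enough for a finite horizon. For unbounded stopping times the
  bounds over the unit intervals are added: the arithmetic-geometric mean inequality separates the
  value at the left end of an interval from the oscillation inside it, and the expected square of the
  former decays geometrically because \<open>\<gamma> > \<alpha> a / b + \<alpha>\<^sup>2 \<sigma>\<^sup>2 / b\<^sup>2\<close>.

  \<^emph>\<open>The function \<open>N\<close>.\<close> By the kernel formula, \<open>N\<close> is a moment generating function: it integrates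
  \<open>exp (C r u)\<close>, with \<open>u = 1 - e\<^sup>-\<^sup>b\<^sup>t\<close> and \<open>C = \<alpha> / ((1 - \<alpha>) b)\<close>, against a finite measure in \<open>t\<close>.
  It is therefore smooth, and \<open>u < 1\<close> makes it \<open>o (exp (C r))\<close>, so that \<open>N\<^sup>1\<^sup>-\<^sup>\<alpha>\<close> is in the space.
  In \<open>A N\<^sup>1\<^sup>-\<^sup>\<alpha>\<close> the terms with the unbounded coefficient \<open>r\<close> combine into
  \<open>\<alpha> N\<^sup>-\<^sup>\<alpha>\<close> times \<open>r \<integral> (1 - u) exp (C r u)\<close>; an integration by parts in \<open>t\<close> absorbs the
  factor \<open>r\<close> (\<open>N_drift_integration_by_parts\<close>).\<close>

section \<open>Gaussian integrals\<close>

abbreviation gauss :: "real measure" where "gauss \<equiv> std_normal_distribution"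

lemma std_normal_density_shift:
  "exp (l * (y + l)) * std_normal_density (y + l) = exp (l\<^sup>2 / 2) * std_normal_density y"
proof -
  have "l * (y + l) + (- (y + l)\<^sup>2 / 2) = l\<^sup>2 / 2 + (- y\<^sup>2 / 2)"
    by (simp add: power2_eq_square field_simps)
  then have "exp (l * (y + l)) * exp (- (y + l)\<^sup>2 / 2) = exp (l\<^sup>2 / 2) * exp (- y\<^sup>2 / 2)"
    by (metis exp_add)
  then show ?thesis
    unfolding std_normal_density_def by (simp add: field_simps)
qed

lemma nn_integral_gaussian_tilt:
  assumes [measurable]: "f \<in> borel_measurable borel"
  shows "(\<integral>\<^sup>+x. ennreal (exp (l * x)) * f x \<partial>gauss)
    = ennreal (exp (l\<^sup>2 / 2)) * (\<integral>\<^sup>+x. f (x + l) \<partial>gauss)"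
proof -
  have "(\<integral>\<^sup>+x. ennreal (exp (l * x)) * f x \<partial>gauss)
      = (\<integral>\<^sup>+x. ennreal (exp (l * x) * std_normal_density x) * f x \<partial>lborel)"
    by (subst nn_integral_density) (auto simp: ennreal_mult mult_ac intro!: nn_integral_cong)
  also have "\<dots> = (\<integral>\<^sup>+x. ennreal (exp (l * (l + 1 * x)) * std_normal_density (l + 1 * x)) * f (l + 1 * x) \<partial>lborel)"
    by (subst nn_integral_real_affine[where c=1 and t=l]) auto
  also have "\<dots> = (\<integral>\<^sup>+x. ennreal (exp (l\<^sup>2 / 2)) * (std_normal_density x * f (x + l)) \<partial>lborel)"
    using std_normal_density_shift[of l]
    by (intro nn_integral_cong) (simp add: add.commute ennreal_mult mult_ac)
  also have "\<dots> = ennreal (exp (l\<^sup>2 / 2)) * (\<integral>\<^sup>+x. f (x + l) \<partial>gauss)"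
    by (subst nn_integral_cmult) (auto simp: nn_integral_density)
  finally show ?thesis .
qed

lemma prob_space_std_normal: "prob_space gauss"
  by (intro prob_space_normal_density) auto

text \<open>Completing the square: multiplying the standard normal law by \<open>e\<^sup>l\<^sup>x\<close> translates it by \<open>l\<close> and
  multiplies its mass by \<open>exp (l\<^sup>2 / 2)\<close>.\<close>

lemma gaussian_tilt_measure:
  "density gauss (\<lambda>x. ennreal (exp (l * x - l\<^sup>2 / 2)))
    = distr gauss borel (\<lambda>x. x + l)"
proof (rule measure_eqI)
  fix A assume "A \<in> sets (density gauss (\<lambda>x. ennreal (exp (l * x - l\<^sup>2 / 2))))"
  then have A[measurable]: "A \<in> sets borel" by simp
  have "emeasure (density gauss (\<lambda>x. ennreal (exp (l * x - l\<^sup>2 / 2)))) A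
     = (\<integral>\<^sup>+x. ennreal (exp (l * x)) * (ennreal (exp (- (l\<^sup>2 / 2))) * indicator A x) \<partial>gauss)"
    by (subst emeasure_density)
      (auto simp: ennreal_mult[symmetric] mult_exp_exp intro!: nn_integral_cong split: split_indicator)
  also have "\<dots> = ennreal (exp (l\<^sup>2 / 2)) * (\<integral>\<^sup>+x. ennreal (exp (- (l\<^sup>2 / 2))) * indicator A (x + l) \<partial>gauss)"
    by (rule nn_integral_gaussian_tilt) auto
  also have "\<dots> = (\<integral>\<^sup>+x. indicator A (x + l) \<partial>gauss)"
    by (subst nn_integral_cmult)
      (auto simp: mult.assoc[symmetric] ennreal_mult[symmetric] mult_exp_exp)
  also have "\<dots> = emeasure (distr gauss borel (\<lambda>x. x + l)) A"
    by (subst nn_integral_indicator[symmetric], simp, subst nn_integral_distr) auto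
  finally show "emeasure (density gauss (\<lambda>x. ennreal (exp (l * x - l\<^sup>2 / 2)))) A
      = emeasure (distr gauss borel (\<lambda>x. x + l)) A" .
qed simp

lemma
  fixes f :: "real \<Rightarrow> 'b :: {banach, second_countable_topology}"
  assumes [measurable]: "f \<in> borel_measurable borel"
  shows integrable_gaussian_tilt:
      "integrable gauss (\<lambda>x. exp (l * x) *\<^sub>R f x)
        \<longleftrightarrow> integrable gauss (\<lambda>x. f (x + l))" (is ?int)
    and integral_gaussian_tilt:
      "(\<integral>x. exp (l * x) *\<^sub>R f x \<partial>gauss)
        = exp (l\<^sup>2 / 2) *\<^sub>R (\<integral>x. f (x + l) \<partial>gauss)" (is ?eq)
proof -
  let ?g = "\<lambda>x. exp (l * x - l\<^sup>2 / 2)"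
  have e: "exp (l * x) *\<^sub>R f x = exp (l\<^sup>2 / 2) *\<^sub>R (?g x *\<^sub>R f x)" for x
    by (simp add: exp_add[symmetric])
  have "integrable gauss (\<lambda>x. exp (l * x) *\<^sub>R f x)
      \<longleftrightarrow> integrable gauss (\<lambda>x. ?g x *\<^sub>R f x)"
  proof
    assume "integrable gauss (\<lambda>x. exp (l * x) *\<^sub>R f x)"
    from integrable_scaleR_right[OF this, of "exp (- (l\<^sup>2 / 2))"]
    show "integrable gauss (\<lambda>x. ?g x *\<^sub>R f x)"
      by (simp add: mult_exp_exp)
  next
    assume "integrable gauss (\<lambda>x. ?g x *\<^sub>R f x)"
    from integrable_scaleR_right[OF this, of "exp (l\<^sup>2 / 2)"]
    show "integrable gauss (\<lambda>x. exp (l * x) *\<^sub>R f x)"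
      unfolding e .
  qed
  also have "\<dots> \<longleftrightarrow> integrable (density gauss (\<lambda>x. ennreal (?g x))) f"
    by (subst integrable_density) auto
  also have "\<dots> \<longleftrightarrow> integrable gauss (\<lambda>x. f (x + l))"
    unfolding gaussian_tilt_measure by (subst integrable_distr_eq) auto
  finally show ?int .
  have "(\<integral>x. exp (l * x) *\<^sub>R f x \<partial>gauss)
      = exp (l\<^sup>2 / 2) *\<^sub>R (\<integral>x. ?g x *\<^sub>R f x \<partial>gauss)"
    unfolding e integral_scaleR_right ..
  also have "(\<integral>x. ?g x *\<^sub>R f x \<partial>gauss)
      = (\<integral>x. f x \<partial>density gauss (\<lambda>x. ennreal (?g x)))"
    by (subst integral_density) auto
  also have "\<dots> = (\<integral>x. f (x + l) \<partial>gauss)"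
    unfolding gaussian_tilt_measure by (subst integral_distr) auto
  finally show ?eq .
qed

text \<open>The tilt removes the real part of \<open>z\<close> and leaves a value of the characteristic function.\<close>

lemma
  fixes z :: complex
  shows integrable_gaussian_cexp: "integrable gauss (\<lambda>x. exp (z * of_real x))" (is ?int)
    and integral_gaussian_cexp: "(\<integral>x. exp (z * of_real x) \<partial>gauss) = exp (z\<^sup>2 / 2)" (is ?eq)
proof -
  interpret prob_space gauss by (rule prob_space_std_normal)
  let ?f = "\<lambda>x::real. exp (\<i> * of_real (Im z * x)) :: complex"
  have e: "exp (z * of_real x) = exp (Re z * x) *\<^sub>R ?f x" for x
    by (subst complex_eq[of z]) (simp add: scaleR_conv_of_real exp_of_real[symmetric] exp_add[symmetric] algebra_simps)
  have [measurable]: "?f \<in> borel_measurable borel"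
    by measurable
  have f: "integrable gauss (\<lambda>x. ?f (x + l))" for l
    by (rule integrable_const_bound[of _ 1]) auto
  show ?int
    unfolding e by (subst integrable_gaussian_tilt) (use f in auto)
  have "(\<integral>x. exp (z * of_real x) \<partial>gauss)
      = exp ((Re z)\<^sup>2 / 2) *\<^sub>R (\<integral>x. ?f (x + Re z) \<partial>gauss)"
    unfolding e by (rule integral_gaussian_tilt) auto
  also have "(\<integral>x. ?f (x + Re z) \<partial>gauss)
      = exp (\<i> * of_real (Im z * Re z)) * (\<integral>x. ?f x \<partial>gauss)"
    by (simp flip: integral_mult_right_zero exp_add add: algebra_simps)
  also have "(\<integral>x. ?f x \<partial>gauss) = exp (- (of_real (Im z))\<^sup>2 / 2)"
    using fun_cong[OF char_std_normal_distribution, of "Im z"] by (simp add: char_def exp_of_real[symmetric])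
  also have "exp ((Re z)\<^sup>2 / 2) *\<^sub>R (exp (\<i> * of_real (Im z * Re z)) * exp (- (of_real (Im z))\<^sup>2 / 2))
     = exp (z\<^sup>2 / 2)"
  proof -
    have "of_real ((Re z)\<^sup>2 / 2) + (\<i> * of_real (Im z * Re z) + (- (of_real (Im z))\<^sup>2 / 2)) = z\<^sup>2 / 2"
      by (simp add: complex_eq_iff power2_eq_square)
    then show ?thesis
      by (metis exp_add exp_of_real scaleR_conv_of_real)
  qed
  finally show ?eq .
qed

lemma
  fixes c :: real
  shows integrable_gaussian_exp: "integrable gauss (\<lambda>x. exp (c * x))"
    and integral_gaussian_exp: "(\<integral>x. exp (c * x) \<partial>gauss) = exp (c\<^sup>2 / 2)"
proof -
  interpret prob_space gauss by (rule prob_space_std_normal)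
  show "integrable gauss (\<lambda>x. exp (c * x))"
    using integrable_gaussian_tilt[of "\<lambda>_. 1::real" c] by simp
  show "(\<integral>x. exp (c * x) \<partial>gauss) = exp (c\<^sup>2 / 2)"
    using integral_gaussian_tilt[of "\<lambda>_. 1::real" c] prob_space by simp
qed

lemma mult_unit_interval: "0 \<le> A * x" "A * x \<le> A" if "0 \<le> A" "0 \<le> x" "x \<le> 1" for A x :: real
  using that by (auto intro: mult_left_le)

lemma exp_abs_le: "exp \<bar>x\<bar> \<le> exp x + exp (- x :: real)"
  by (cases "x \<ge> 0") (auto simp: add_increasing add_increasing2)

lemma integrable_gaussian_exp_abs:
  "integrable gauss (\<lambda>x. exp (c * \<bar>x\<bar>))" if "c \<ge> 0" for c :: real
proof (rule Bochner_Integration.integrable_bound)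
  show "integrable gauss (\<lambda>x. exp (c * x) + exp ((-c) * x))"
    by (intro Bochner_Integration.integrable_add integrable_gaussian_exp)
  show "AE x in gauss. norm (exp (c * \<bar>x\<bar>)) \<le> norm (exp (c * x) + exp ((-c) * x))"
  proof (intro AE_I2)
    fix x :: real
    have "exp (c * \<bar>x\<bar>) = exp \<bar>c * x\<bar>" using that by (simp add: abs_mult)
    also have "\<dots> \<le> exp (c * x) + exp (-(c * x))" by (rule exp_abs_le)
    finally show "norm (exp (c * \<bar>x\<bar>)) \<le> norm (exp (c * x) + exp ((-c) * x))" by simp
  qed
qed simp

text \<open>Levy's uniqueness theorem. Taking \<open>s = 0\<close> is allowed, so degenerate laws need no separate
  treatment.\<close>

lemma gaussian_law_of_char:
  assumes "real_distribution P"
    and "\<And>u. char P u = exp (\<i> * of_real (u * m) - of_real (u\<^sup>2 * s\<^sup>2 / 2))"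
  shows "P = distr gauss borel (\<lambda>x. m + s * x)"
proof (rule Levy_uniqueness)
  interpret prob_space gauss by (rule prob_space_std_normal)
  show "real_distribution (distr gauss borel (\<lambda>x. m + s * x))"
    by (intro real_distribution_distr) simp
  show "char P = char (distr gauss borel (\<lambda>x. m + s * x))"
  proof
    fix u
    have "char (distr gauss borel (\<lambda>x. m + s * x)) u
       = (\<integral>x. exp (\<i> * of_real (u * m)) * exp ((\<i> * of_real (u * s)) * of_real x) \<partial>gauss)"
      unfolding char_def by (subst integral_distr) (auto simp: exp_add[symmetric] algebra_simps)
    also have "\<dots> = exp (\<i> * of_real (u * m)) * exp ((\<i> * of_real (u * s))\<^sup>2 / 2)"
      by (simp only: integral_mult_right_zero integral_gaussian_cexp)
    also have "\<dots> = char P u"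
      by (simp add: assms(2) exp_add[symmetric] power_mult_distrib)
    finally show "char P u = char (distr gauss borel (\<lambda>x. m + s * x)) u" ..
  qed
qed (fact assms(1))

lemma gaussian_convolution:
  "distr (gauss \<Otimes>\<^sub>M gauss) borel (\<lambda>(x, y). p * x + q * y)
    = distr gauss borel (\<lambda>x. sqrt (p\<^sup>2 + q\<^sup>2) * x)"
proof -
  interpret prob_space gauss by (rule prob_space_std_normal)
  interpret PP: pair_prob_space gauss gauss ..
  have rd: "real_distribution (distr (gauss \<Otimes>\<^sub>M gauss) borel (\<lambda>(x, y). p * x + q * y))"
    by (intro PP.real_distribution_distr) simp
  have "char (distr (gauss \<Otimes>\<^sub>M gauss) borel (\<lambda>(x, y). p * x + q * y)) u
     = exp (\<i> * of_real (u * 0) - of_real (u\<^sup>2 * (sqrt (p\<^sup>2 + q\<^sup>2))\<^sup>2 / 2))" for u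
  proof -
    let ?e = "\<lambda>z x. exp (\<i> * of_real (u * z) * of_real x) :: complex"
    have int: "integrable (gauss \<Otimes>\<^sub>M gauss) (\<lambda>(x, y). ?e p x * ?e q y)"
      by (rule PP.integrable_const_bound[of _ 1]) (auto simp: norm_mult)
    have "char (distr (gauss \<Otimes>\<^sub>M gauss) borel (\<lambda>(x, y). p * x + q * y)) u
      = (\<integral>(x,y). ?e p x * ?e q y \<partial>(gauss \<Otimes>\<^sub>M gauss))"
      unfolding char_def by (subst integral_distr) (auto simp: exp_add[symmetric] algebra_simps intro!: Bochner_Integration.integral_cong)
    also have "\<dots> = (\<integral>x. (\<integral>y. ?e p x * ?e q y \<partial>gauss) \<partial>gauss)"
      using PP.integral_fst'[OF int] by simp
    also have "\<dots> = exp ((\<i> * of_real (u * p))\<^sup>2 / 2) * exp ((\<i> * of_real (u * q))\<^sup>2 / 2)"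
      by (simp add: integral_gaussian_cexp integrable_gaussian_cexp del: of_real_mult)
    finally show ?thesis
      by (simp add: exp_add[symmetric] power_mult_distrib algebra_simps add_divide_distrib)
  qed
  from gaussian_law_of_char[OF rd this] show ?thesis by simp
qed

section \<open>Uniform integrability by domination\<close>

text \<open>The dominating variable takes values in the extended half-line, because the ones used below are
  suprema and series; it is finite almost surely, so its tail integrals vanish by dominated
  convergence.\<close>

lemma uniformly_integrable_dominated:
  assumes X: "\<And>n. X n \<in> borel_measurable M" and Y[measurable]: "Y \<in> borel_measurable M"
    and fin: "(\<integral>\<^sup>+\<omega>. Y \<omega> \<partial>M) < \<infinity>"
    and dom: "\<And>n. AE \<omega> in M. ennreal \<bar>X n \<omega>\<bar> \<le> Y \<omega>"
  shows "uniformly_integrable M X"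
  unfolding uniformly_integrable_def
proof (intro conjI allI X)
  let ?g = "\<lambda>K::real. \<integral>\<^sup>+\<omega>. Y \<omega> * indicator {\<omega>. ennreal K \<le> Y \<omega>} \<omega> \<partial>M"
  have ae: "AE \<omega> in M. Y \<omega> \<noteq> \<infinity>"
    using fin by (intro nn_integral_PInf_AE) auto
  have lim: "(?g \<longlongrightarrow> (\<integral>\<^sup>+\<omega>. 0 \<partial>M)) at_top"
  proof (rule tendsto_at_topI_sequentially)
    fix S :: "nat \<Rightarrow> real" assume S: "filterlim S at_top sequentially"
    show "(\<lambda>n. ?g (S n)) \<longlonglongrightarrow> (\<integral>\<^sup>+\<omega>. 0 \<partial>M)"
    proof (rule nn_integral_dominated_convergence[where w = Y])
      show "AE \<omega> in M. (\<lambda>n. Y \<omega> * indicator {\<omega>. ennreal (S n) \<le> Y \<omega>} \<omega>) \<longlonglongrightarrow> 0"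
        using ae
      proof eventually_elim
        case (elim \<omega>)
        then obtain y where y: "Y \<omega> = ennreal y" "0 \<le> y" by (cases "Y \<omega>") auto
        have "eventually (\<lambda>n. y < S n) sequentially"
          using S by (simp add: filterlim_at_top_dense)
        then have "eventually (\<lambda>n. Y \<omega> * indicator {\<omega>. ennreal (S n) \<le> Y \<omega>} \<omega> = 0) sequentially"
          by eventually_elim (use y in \<open>auto split: split_indicator\<close>)
        then show ?case by (simp add: tendsto_eventually)
      qed
    qed (use fin in \<open>auto split: split_indicator\<close>)
  qed
  show "((\<lambda>K. SUP n. \<integral>\<^sup>+\<omega>\<in>{\<omega>. K \<le> \<bar>X n \<omega>\<bar>}. ennreal \<bar>X n \<omega>\<bar> \<partial>M) \<longlongrightarrow> 0) at_top"
  proof (rule tendsto_sandwich[OF _ _ tendsto_const])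
    have "(SUP n. \<integral>\<^sup>+\<omega>\<in>{\<omega>. K \<le> \<bar>X n \<omega>\<bar>}. ennreal \<bar>X n \<omega>\<bar> \<partial>M) \<le> ?g K" for K
    proof (intro SUP_least nn_integral_mono_AE)
      fix n
      show "AE \<omega> in M. ennreal \<bar>X n \<omega>\<bar> * indicator {\<omega>. K \<le> \<bar>X n \<omega>\<bar>} \<omega>
          \<le> Y \<omega> * indicator {\<omega>. ennreal K \<le> Y \<omega>} \<omega>"
        using dom[of n]
        by eventually_elim (auto split: split_indicator intro: order_trans ennreal_leI dest: ennreal_leI)
    qed
    then show "\<forall>\<^sub>F K in at_top. (SUP n. \<integral>\<^sup>+\<omega>\<in>{\<omega>. K \<le> \<bar>X n \<omega>\<bar>}. ennreal \<bar>X n \<omega>\<bar> \<partial>M) \<le> ?g K"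
      by (intro always_eventually allI)
  qed (use lim in auto)
qed

section \<open>Increments of Brownian motion\<close>

lemma centred_normal_law:
  assumes "s > 0"
  shows "density lborel (normal_density 0 s) = distr gauss borel (\<lambda>x. s * x)"
proof -
  interpret prob_space gauss by (rule prob_space_std_normal)
  have "distributed gauss lborel (\<lambda>x. x) (normal_density 0 1)"
    by (auto simp: distributed_def distr_id2)
  from normal_density_affine[OF this, of s 0] assms
  have "distributed gauss lborel (\<lambda>x. s * x) (normal_density 0 s)"
    by simp
  then show ?thesis
    using distributed_distr_eq_density[of gauss lborel "\<lambda>x. s * x" "normal_density 0 s"]
    by (simp cong: distr_cong)
qed

locale brownian = filtered_prob_space M F
  for M :: "'a measure" and F :: "ennreal \<Rightarrow> 'a measure" +
  fixes W :: "real \<Rightarrow> 'a \<Rightarrow> real"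
  assumes brownian: "brownian_motion M F W"
begin

lemma measurable_from_F:
  assumes "f \<in> F t \<rightarrow>\<^sub>M N" shows "f \<in> M \<rightarrow>\<^sub>M N"
  by (rule measurable_mono[THEN subsetD, OF _ _ _ _ assms]) (auto simp: space_F sets_F_subset)

lemma measurable_F_mono:
  assumes "f \<in> F s \<rightarrow>\<^sub>M N" "s \<le> t" shows "f \<in> F t \<rightarrow>\<^sub>M N"
  by (rule measurable_mono[THEN subsetD, OF _ _ _ _ assms(1)]) (use assms(2) in \<open>auto simp: space_F sets_F_mono\<close>)

lemma W_adapted: "0 \<le> s \<Longrightarrow> s \<le> t \<Longrightarrow> W s \<in> borel_measurable (F (ennreal t))"
  using brownian unfolding brownian_motion_def adapted_def
  by (auto intro: measurable_F_mono ennreal_leI)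

lemma W_measurable: "0 \<le> t \<Longrightarrow> W t \<in> borel_measurable M"
  using W_adapted[of t t] by (auto intro: measurable_from_F)

lemma W_continuous: "\<omega> \<in> space M \<Longrightarrow> continuous_on {0..} (\<lambda>t. W t \<omega>)"
  using brownian unfolding brownian_motion_def continuous_paths_def by auto

lemma W_zero: "AE \<omega> in M. W 0 \<omega> = 0"
  using brownian unfolding brownian_motion_def by auto

lemma increment_law:
  assumes "0 \<le> s" "s \<le> t"
  shows "distr M borel (\<lambda>\<omega>. W t \<omega> - W s \<omega>) = distr gauss borel (\<lambda>x. sqrt (t - s) * x)"
proof (cases "s = t")
  case True
  have a: "distr gauss borel (\<lambda>x. 0::real) = return borel 0"
    by (rule prob_space.distr_const[OF prob_space_std_normal]) simp
  have b: "distr M borel (\<lambda>\<omega>. 0::real) = return borel 0"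
    by (rule distr_const) simp
  have c: "(\<lambda>\<omega>. W t \<omega> - W s \<omega>) = (\<lambda>\<omega>. 0)" "(\<lambda>x. sqrt (t - s) * x) = (\<lambda>x. 0)"
    unfolding True by simp_all
  show ?thesis
    unfolding c a b ..
next
  case False
  then have "s < t" using assms by simp
  then have "distributed M lborel (\<lambda>\<omega>. W t \<omega> - W s \<omega>) (normal_density 0 (sqrt (t - s)))"
    using brownian assms unfolding brownian_motion_def by auto
  then have "distr M lborel (\<lambda>\<omega>. W t \<omega> - W s \<omega>) = density lborel (normal_density 0 (sqrt (t - s)))"
    by (rule distributed_distr_eq_density)
  moreover have "distr M lborel (\<lambda>\<omega>. W t \<omega> - W s \<omega>) = distr M borel (\<lambda>\<omega>. W t \<omega> - W s \<omega>)"
    by (intro distr_cong) auto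
  moreover have "density lborel (normal_density 0 (sqrt (t - s)))
      = distr gauss borel (\<lambda>x. sqrt (t - s) * x)"
    by (rule centred_normal_law) (use \<open>s < t\<close> in simp)
  ultimately show ?thesis by metis
qed

text \<open>The filtration is independent of preimages under the increment; the generated
  \<open>\<sigma>\<close>-algebras inherit this, because both systems are stable under intersection.\<close>

lemma increment_indep:
  fixes U :: "'a \<Rightarrow> 'b :: {second_countable_topology, real_normed_field}"
    and g :: "real \<Rightarrow> 'b"
  assumes "0 \<le> s" "s < t" and U: "U \<in> borel_measurable (F (ennreal s))"
    and g[measurable]: "g \<in> borel_measurable borel"
  shows "indep_var borel U borel (\<lambda>\<omega>. g (W t \<omega> - W s \<omega>))"
proof -
  have [measurable]: "W t \<in> borel_measurable M" "W s \<in> borel_measurable M"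
    using assms by (auto intro: W_measurable)
  let ?S = "{(\<lambda>\<omega>. W t \<omega> - W s \<omega>) -` A \<inter> space M |A. A \<in> sets borel}"
  have "indep_set (sets (F (ennreal s))) ?S"
    using brownian assms unfolding brownian_motion_def by auto
  moreover have "Int_stable ?S"
  proof (rule Int_stableI)
    fix a b assume "a \<in> ?S" "b \<in> ?S"
    then obtain A B where "A \<in> sets borel" "a = (\<lambda>\<omega>. W t \<omega> - W s \<omega>) -` A \<inter> space M"
      "B \<in> sets borel" "b = (\<lambda>\<omega>. W t \<omega> - W s \<omega>) -` B \<inter> space M" by auto
    then show "a \<inter> b \<in> ?S" by (intro CollectI exI[of _ "A \<inter> B"]) auto
  qed
  ultimately have ind: "indep_set (sigma_sets (space M) (sets (F (ennreal s)))) (sigma_sets (space M) ?S)"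
    by (intro indep_set_sigma_sets) (auto simp: Int_stable_def)
  have 1: "sigma_sets (space M) {U -` A \<inter> space M | A. A \<in> sets borel} \<subseteq> sigma_sets (space M) (sets (F (ennreal s)))"
    using measurable_sets[OF U] by (intro sigma_sets_mono') (auto simp: space_F)
  have 2: "sigma_sets (space M) {(\<lambda>\<omega>. g (W t \<omega> - W s \<omega>)) -` A \<inter> space M | A. A \<in> sets borel} \<subseteq> sigma_sets (space M) ?S"
  proof (intro sigma_sets_mono', safe)
    fix A :: "'b set" assume "A \<in> sets borel"
    then have "g -` A \<in> sets borel" using measurable_sets[OF g] by simp
    then show "\<exists>B. (\<lambda>\<omega>. g (W t \<omega> - W s \<omega>)) -` A \<inter> space M = (\<lambda>\<omega>. W t \<omega> - W s \<omega>) -` B \<inter> space M \<and> B \<in> sets borel"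
      by (intro exI[of _ "g -` A"]) auto
  qed
  show ?thesis
    unfolding indep_var_eq
  proof (intro conjI)
    show "indep_set (sigma_sets (space M) {U -` A \<inter> space M |A. A \<in> sets borel})
        (sigma_sets (space M) {(\<lambda>\<omega>. g (W t \<omega> - W s \<omega>)) -` A \<inter> space M |A. A \<in> sets borel})"
    proof (rule indep_setI)
      show "sigma_sets (space M) {U -` A \<inter> space M |A. A \<in> sets borel} \<subseteq> events"
        using 1 indep_setD_ev1[OF ind] by (rule subset_trans)
      show "sigma_sets (space M) {(\<lambda>\<omega>. g (W t \<omega> - W s \<omega>)) -` A \<inter> space M |A. A \<in> sets borel} \<subseteq> events"
        using 2 indep_setD_ev2[OF ind] by (rule subset_trans)
    qed (rule indep_setD[OF ind subsetD[OF 1] subsetD[OF 2]])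
  next
    show "U \<in> borel_measurable M" by (rule measurable_from_F[OF U])
    show "(\<lambda>\<omega>. g (W t \<omega> - W s \<omega>)) \<in> borel_measurable M" by measurable
  qed
qed

lemma
  fixes U :: "'a \<Rightarrow> 'b :: {second_countable_topology, real_normed_field, banach}"
    and g :: "real \<Rightarrow> 'b"
  assumes "0 \<le> s" "s \<le> t" and U: "U \<in> borel_measurable (F (ennreal s))" "integrable M U"
    and g[measurable]: "g \<in> borel_measurable borel"
    and ig: "integrable gauss (\<lambda>x. g (sqrt (t - s) * x))"
  shows integrable_indep_increment: "integrable M (\<lambda>\<omega>. U \<omega> * g (W t \<omega> - W s \<omega>))" (is ?int)
    and integral_indep_increment: "(\<integral>\<omega>. U \<omega> * g (W t \<omega> - W s \<omega>) \<partial>M)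
      = (\<integral>\<omega>. U \<omega> \<partial>M) * (\<integral>x. g (sqrt (t - s) * x) \<partial>gauss)" (is ?eq)
proof -
  interpret G: prob_space gauss by (rule prob_space_std_normal)
  have [measurable]: "W t \<in> borel_measurable M" "W s \<in> borel_measurable M"
    using assms by (auto intro: W_measurable)
  have g2: "integrable M (\<lambda>\<omega>. g (W t \<omega> - W s \<omega>))"
    using ig integrable_distr_eq[of "\<lambda>x. sqrt (t - s) * x" gauss borel g]
      integrable_distr_eq[of "\<lambda>\<omega>. W t \<omega> - W s \<omega>" M borel g]
    by (simp add: increment_law[OF assms(1,2)])
  have e2: "(\<integral>\<omega>. g (W t \<omega> - W s \<omega>) \<partial>M) = (\<integral>x. g (sqrt (t - s) * x) \<partial>gauss)"
    using integral_distr[of "\<lambda>x. sqrt (t - s) * x" gauss borel g]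
      integral_distr[of "\<lambda>\<omega>. W t \<omega> - W s \<omega>" M borel g]
    by (simp add: increment_law[OF assms(1,2)])
  have "?int \<and> ?eq"
  proof (cases "s = t")
    case True
    then show ?thesis using U by (simp add: G.prob_space[simplified])
  next
    case False
    then have ind: "indep_var borel U borel (\<lambda>\<omega>. g (W t \<omega> - W s \<omega>))"
      using assms by (intro increment_indep) auto
    show ?thesis
      using indep_var_integrable[OF ind U(2) g2] indep_var_lebesgue_integral[OF ind U(2) g2] e2 by simp
  qed
  then show ?int ?eq by auto
qed

text \<open>The exponential moments of a discrete Wiener integral: condition on the past and split off
  the last increment.\<close>

lemma discrete_wiener_cexp:
  fixes z :: "nat \<Rightarrow> complex"
  assumes \<tau>: "incseq \<tau>" "0 \<le> \<tau> 0"
  shows "(\<lambda>\<omega>. exp (\<Sum>k<n. z k * of_real (W (\<tau> (Suc k)) \<omega> - W (\<tau> k) \<omega>))) \<in> borel_measurable (F (ennreal (\<tau> n)))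
    \<and> integrable M (\<lambda>\<omega>. exp (\<Sum>k<n. z k * of_real (W (\<tau> (Suc k)) \<omega> - W (\<tau> k) \<omega>)))
    \<and> (\<integral>\<omega>. exp (\<Sum>k<n. z k * of_real (W (\<tau> (Suc k)) \<omega> - W (\<tau> k) \<omega>)) \<partial>M)
      = exp (\<Sum>k<n. (z k)\<^sup>2 * of_real (\<tau> (Suc k) - \<tau> k) / 2)"
proof (induction n)
  case 0
  then show ?case by (simp add: prob_space)
next
  case (Suc n)
  let ?U = "\<lambda>n \<omega>. exp (\<Sum>k<n. z k * of_real (W (\<tau> (Suc k)) \<omega> - W (\<tau> k) \<omega>)) :: complex"
  have nn: "0 \<le> \<tau> k" for k using \<tau> incseqD[OF \<tau>(1), of 0 k] by simp
  have le: "\<tau> n \<le> \<tau> (Suc n)" using incseqD[OF \<tau>(1)] by simp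
  have Wm: "W (\<tau> k) \<in> borel_measurable (F (ennreal (\<tau> (Suc n))))" if "k \<le> Suc n" for k
    using nn[of k] incseqD[OF \<tau>(1) that] by (rule W_adapted)
  let ?g = "\<lambda>x. exp (z n * of_real x)"
  have gm: "?g \<in> borel_measurable borel" by measurable
  have e: "?U (Suc n) = (\<lambda>\<omega>. ?U n \<omega> * ?g (W (\<tau> (Suc n)) \<omega> - W (\<tau> n) \<omega>))"
    by (simp add: fun_eq_iff exp_add)
  have gs: "(\<lambda>x. ?g (sqrt (\<tau> (Suc n) - \<tau> n) * x)) = (\<lambda>x. exp ((z n * of_real (sqrt (\<tau> (Suc n) - \<tau> n))) * of_real x))"
    by (simp add: mult.assoc)
  have sq: "(of_real (sqrt (\<tau> (Suc n) - \<tau> n)))\<^sup>2 = (of_real (\<tau> (Suc n) - \<tau> n) :: complex)"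
    using le by (metis diff_ge_0_iff_ge of_real_power real_sqrt_pow2)
  have ig: "integrable gauss (\<lambda>x. ?g (sqrt (\<tau> (Suc n) - \<tau> n) * x))"
    unfolding gs by (rule integrable_gaussian_cexp)
  have Ig: "(\<integral>x. ?g (sqrt (\<tau> (Suc n) - \<tau> n) * x) \<partial>gauss) = exp ((z n)\<^sup>2 * of_real (\<tau> (Suc n) - \<tau> n) / 2)"
    unfolding gs by (subst integral_gaussian_cexp) (simp only: power_mult_distrib sq)
  have sm: "(\<lambda>\<omega>. \<Sum>k<Suc n. z k * of_real (W (\<tau> (Suc k)) \<omega> - W (\<tau> k) \<omega>)) \<in> borel_measurable (F (ennreal (\<tau> (Suc n))))"
  proof (rule borel_measurable_sum)
    fix k assume "k \<in> {..<Suc n}"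
    then have k: "Suc k \<le> Suc n" "k \<le> Suc n" by auto
    show "(\<lambda>\<omega>. z k * of_real (W (\<tau> (Suc k)) \<omega> - W (\<tau> k) \<omega>)) \<in> borel_measurable (F (ennreal (\<tau> (Suc n))))"
      by (rule borel_measurable_times[OF borel_measurable_const
        measurable_compose[OF borel_measurable_diff[OF Wm[OF k(1)] Wm[OF k(2)]] borel_measurable_of_real]])
  qed
  have "(exp :: complex \<Rightarrow> complex) \<in> borel_measurable borel"
    by (intro borel_measurable_continuous_onI continuous_intros)
  from measurable_compose[OF sm this]
  have m: "?U (Suc n) \<in> borel_measurable (F (ennreal (\<tau> (Suc n))))" .
  have Um: "?U n \<in> borel_measurable (F (ennreal (\<tau> n)))" "integrable M (?U n)"
    using Suc.IH by auto
  have "integrable M (?U (Suc n))"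
    unfolding e by (rule integrable_indep_increment[OF nn le Um gm ig])
  moreover have "(\<integral>\<omega>. ?U (Suc n) \<omega> \<partial>M) = (\<integral>\<omega>. ?U n \<omega> \<partial>M) * exp ((z n)\<^sup>2 * of_real (\<tau> (Suc n) - \<tau> n) / 2)"
    unfolding e Ig[symmetric] by (rule integral_indep_increment[OF nn le Um gm ig])
  ultimately show ?case
    using m Suc.IH by (simp add: exp_add)
qed

section \<open>A maximal inequality\<close>

lemma
  fixes c :: real
  assumes "0 \<le> s" "s \<le> t"
  shows integrable_exp_increment: "integrable M (\<lambda>\<omega>. exp (c * (W t \<omega> - W s \<omega>)))"
    and integral_exp_increment: "(\<integral>\<omega>. exp (c * (W t \<omega> - W s \<omega>)) \<partial>M) = exp (c\<^sup>2 * (t - s) / 2)"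
proof -
  have g: "(\<lambda>x. exp (c * (sqrt (t - s) * x))) = (\<lambda>x. exp ((c * sqrt (t - s)) * x))"
    by (simp add: mult.assoc)
  have i: "integrable gauss (\<lambda>x. exp (c * (sqrt (t - s) * x)))"
    unfolding g by (rule integrable_gaussian_exp)
  have I: "(\<integral>x. exp (c * (sqrt (t - s) * x)) \<partial>gauss) = exp (c\<^sup>2 * (t - s) / 2)"
    unfolding g integral_gaussian_exp using assms by (simp add: power_mult_distrib)
  have "integrable M (\<lambda>\<omega>. 1 * exp (c * (W t \<omega> - W s \<omega>)))"
    by (rule integrable_indep_increment[OF assms _ _ _ i]) auto
  then show "integrable M (\<lambda>\<omega>. exp (c * (W t \<omega> - W s \<omega>)))"
    by simp
  have "(\<integral>\<omega>. 1 * exp (c * (W t \<omega> - W s \<omega>)) \<partial>M)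
      = (\<integral>\<omega>. 1 \<partial>M) * (\<integral>x. exp (c * (sqrt (t - s) * x)) \<partial>gauss)"
    by (rule integral_indep_increment[OF assms _ _ _ i]) auto
  then show "(\<integral>\<omega>. exp (c * (W t \<omega> - W s \<omega>)) \<partial>M) = exp (c\<^sup>2 * (t - s) / 2)"
    by (simp add: prob_space I)
qed

text \<open>Doob's \<open>L\<^sup>2\<close> inequality for the submartingale \<open>Y\<close>, in the one-line form \<open>E (2 S Y - S\<^sup>2) \<ge> 0\<close> for
  its running maximum \<open>S\<close>. This is preserved from one step to the next: when \<open>Y\<close> moves with \<open>S\<close> kept,
  the expectation of \<open>S Y\<close> cannot decrease, and replacing \<open>S\<close> by \<open>max Y S\<close> only increases
  \<open>2 S Y - S\<^sup>2\<close>. The bound follows from \<open>2 S Y \<le> 2 Y\<^sup>2 + S\<^sup>2 / 2\<close>.\<close>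

lemma discrete_maximal_inequality:
  fixes c :: real and \<tau> :: "nat \<Rightarrow> real"
  defines "Y \<equiv> \<lambda>j \<omega>. exp (c * (W (\<tau> j) \<omega> - W (\<tau> 0) \<omega>))"
  defines "S \<equiv> \<lambda>n \<omega>. Max ((\<lambda>j. Y j \<omega>) ` {..n})"
  assumes \<tau>: "incseq \<tau>" "0 \<le> \<tau> 0"
  shows "integrable M (\<lambda>\<omega>. (S n \<omega>)\<^sup>2)"
    and "(\<integral>\<omega>. (S n \<omega>)\<^sup>2 \<partial>M) \<le> 4 * exp (2 * c\<^sup>2 * (\<tau> n - \<tau> 0))"
proof -
  have nn: "0 \<le> \<tau> k" for k using \<tau> incseqD[OF \<tau>(1), of 0 k] by simp
  have mono: "\<tau> j \<le> \<tau> k" if "j \<le> k" for j k using incseqD[OF \<tau>(1) that] .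
  have Wm: "W (\<tau> j) \<in> borel_measurable (F (ennreal (\<tau> k)))" if "j \<le> k" for j k
    using nn mono that by (intro W_adapted) auto
  have Ym: "Y j \<in> borel_measurable (F (ennreal (\<tau> k)))" if "j \<le> k" for j k
    unfolding Y_def by (rule measurable_compose[OF borel_measurable_times[OF borel_measurable_const
      borel_measurable_diff[OF Wm[OF that] Wm[OF le0]]] borel_measurable_exp])
  have Sm: "S k \<in> borel_measurable (F (ennreal (\<tau> k)))" for k
    unfolding S_def by (intro borel_measurable_Max) (auto intro: Ym)
  have YM[measurable]: "Y j \<in> borel_measurable M" for j
    by (rule measurable_from_F[OF Ym[OF order_refl]])
  have SM[measurable]: "S j \<in> borel_measurable M" for j
    by (rule measurable_from_F[OF Sm])
  have S_Suc: "S (Suc k) \<omega> = max (Y (Suc k) \<omega>) (S k \<omega>)" for k \<omega>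
    unfolding S_def by (simp add: atMost_Suc Max_insert)
  have Y0: "Y j \<omega> > 0" for j \<omega> unfolding Y_def by simp
  have Y_le_S: "Y k \<omega> \<le> S k \<omega>" for k \<omega>
    unfolding S_def by simp
  have S_pos: "S k \<omega> > 0" for k \<omega>
    using Y_le_S[of k \<omega>] Y0[of k \<omega>] by simp
  have Y2: "(Y j \<omega>)\<^sup>2 = exp ((2 * c) * (W (\<tau> j) \<omega> - W (\<tau> 0) \<omega>))" for j \<omega>
    unfolding Y_def by (simp add: power2_eq_square mult_exp_exp algebra_simps)
  have iY2: "integrable M (\<lambda>\<omega>. (Y j \<omega>)\<^sup>2)" for j
    unfolding Y2 using \<tau> mono[of 0 j] by (intro integrable_exp_increment) auto
  have EY2: "(\<integral>\<omega>. (Y j \<omega>)\<^sup>2 \<partial>M) = exp (2 * c\<^sup>2 * (\<tau> j - \<tau> 0))" for j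
    unfolding Y2 using \<tau> mono[of 0 j] by (subst integral_exp_increment) (auto simp: power_mult_distrib)
  have iS2: "integrable M (\<lambda>\<omega>. (S k \<omega>)\<^sup>2)" for k
  proof (induction k)
    case 0 then show ?case using iY2[of 0] by (simp add: S_def)
  next
    case (Suc k)
    show ?case
    proof (rule Bochner_Integration.integrable_bound)
      show "integrable M (\<lambda>\<omega>. (Y (Suc k) \<omega>)\<^sup>2 + (S k \<omega>)\<^sup>2)"
        using Suc iY2 by auto
      show "AE \<omega> in M. norm ((S (Suc k) \<omega>)\<^sup>2) \<le> norm ((Y (Suc k) \<omega>)\<^sup>2 + (S k \<omega>)\<^sup>2)"
        unfolding S_Suc by (auto simp: max_def)
    qed measurable
  qed
  have prod_le: "\<bar>x * y\<bar> \<le> x\<^sup>2 + y\<^sup>2" for x y :: real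
  proof -
    have "2 * (\<bar>x\<bar> * \<bar>y\<bar>) \<le> x\<^sup>2 + y\<^sup>2"
      using sum_squares_bound[of "\<bar>x\<bar>" "\<bar>y\<bar>"] by (simp add: mult.assoc)
    moreover have "0 \<le> \<bar>x\<bar> * \<bar>y\<bar>" by simp
    ultimately show ?thesis unfolding abs_mult by linarith
  qed
  have iSY: "integrable M (\<lambda>\<omega>. S k \<omega> * Y j \<omega>)" for k j
  proof (rule Bochner_Integration.integrable_bound)
    show "integrable M (\<lambda>\<omega>. (S k \<omega>)\<^sup>2 + (Y j \<omega>)\<^sup>2)"
      using iS2 iY2 by auto
    show "AE \<omega> in M. norm (S k \<omega> * Y j \<omega>) \<le> norm ((S k \<omega>)\<^sup>2 + (Y j \<omega>)\<^sup>2)"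
      using prod_le by auto
  qed measurable
  have key: "(\<integral>\<omega>. 2 * (S k \<omega> * Y k \<omega>) - (S k \<omega>)\<^sup>2 \<partial>M) \<ge> 0" for k
  proof (induction k)
    case 0
    have "2 * (S 0 \<omega> * Y 0 \<omega>) - (S 0 \<omega>)\<^sup>2 = (Y 0 \<omega>)\<^sup>2" for \<omega>
      by (simp add: S_def power2_eq_square)
    then show ?case by simp
  next
    case (Suc k)
    let ?g = "\<lambda>x. exp (c * x)" and ?d = "\<tau> (Suc k) - \<tau> k"
    have d: "0 \<le> ?d" using mono[of k "Suc k"] by simp
    have g: "(\<lambda>x. exp (c * (sqrt ?d * x))) = (\<lambda>x. exp ((c * sqrt ?d) * x))"
      by (simp add: mult.assoc)
    have ig: "integrable gauss (\<lambda>x. ?g (sqrt ?d * x))"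
      unfolding g by (rule integrable_gaussian_exp)
    have Ig: "(\<integral>x. ?g (sqrt ?d * x) \<partial>gauss) \<ge> 1"
      unfolding g integral_gaussian_exp by simp
    have e: "S k \<omega> * Y (Suc k) \<omega> = (S k \<omega> * Y k \<omega>) * ?g (W (\<tau> (Suc k)) \<omega> - W (\<tau> k) \<omega>)" for \<omega>
      unfolding Y_def by (simp add: mult_exp_exp algebra_simps)
    have "(\<integral>\<omega>. S k \<omega> * Y (Suc k) \<omega> \<partial>M)
        = (\<integral>\<omega>. S k \<omega> * Y k \<omega> \<partial>M) * (\<integral>x. ?g (sqrt ?d * x) \<partial>gauss)"
      unfolding e using ig mono[of k "Suc k"] nn
      by (intro integral_indep_increment iSY) (auto intro!: borel_measurable_times Sm Ym)
    moreover have "(\<integral>\<omega>. S k \<omega> * Y k \<omega> \<partial>M) \<ge> 0"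
      using S_pos Y0 by (intro integral_nonneg_AE) (auto simp: less_imp_le)
    ultimately have step: "(\<integral>\<omega>. S k \<omega> * Y k \<omega> \<partial>M) \<le> (\<integral>\<omega>. S k \<omega> * Y (Suc k) \<omega> \<partial>M)"
      using Ig mult_left_mono[of 1 _ "\<integral>\<omega>. S k \<omega> * Y k \<omega> \<partial>M"] by simp
    have "0 \<le> 2 * (\<integral>\<omega>. S k \<omega> * Y k \<omega> \<partial>M) - (\<integral>\<omega>. (S k \<omega>)\<^sup>2 \<partial>M)"
      using Suc iSY iS2 by simp
    also have "\<dots> \<le> 2 * (\<integral>\<omega>. S k \<omega> * Y (Suc k) \<omega> \<partial>M) - (\<integral>\<omega>. (S k \<omega>)\<^sup>2 \<partial>M)"
      using step by simp
    also have "\<dots> = (\<integral>\<omega>. 2 * (S k \<omega> * Y (Suc k) \<omega>) - (S k \<omega>)\<^sup>2 \<partial>M)"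
      using iSY iS2 by simp
    also have "\<dots> \<le> (\<integral>\<omega>. 2 * (S (Suc k) \<omega> * Y (Suc k) \<omega>) - (S (Suc k) \<omega>)\<^sup>2 \<partial>M)"
    proof (intro integral_mono Bochner_Integration.integrable_diff integrable_mult_right iSY iS2)
      fix \<omega>
      show "2 * (S k \<omega> * Y (Suc k) \<omega>) - (S k \<omega>)\<^sup>2 \<le> 2 * (S (Suc k) \<omega> * Y (Suc k) \<omega>) - (S (Suc k) \<omega>)\<^sup>2"
      proof (cases "Y (Suc k) \<omega> \<le> S k \<omega>")
        case False
        \<comment> \<open>A new maximum \<open>S' = Y'\<close> turns the left-hand side into \<open>Y'\<^sup>2\<close>.\<close>
        have "0 \<le> (S k \<omega> - Y (Suc k) \<omega>)\<^sup>2" by simp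
        then show ?thesis
          using False unfolding S_Suc by (simp add: max_def power2_eq_square algebra_simps)
      qed (simp add: S_Suc max_def)
    qed
    finally show ?case .
  qed
  show "integrable M (\<lambda>\<omega>. (S n \<omega>)\<^sup>2)" by (rule iS2)
  have "0 \<le> (\<integral>\<omega>. 2 * (S n \<omega> * Y n \<omega>) - (S n \<omega>)\<^sup>2 \<partial>M)" by (rule key)
  also have "\<dots> \<le> (\<integral>\<omega>. 2 * (Y n \<omega>)\<^sup>2 - (S n \<omega>)\<^sup>2 / 2 \<partial>M)"
  proof (intro integral_mono Bochner_Integration.integrable_diff integrable_mult_right iSY iS2 iY2 integrable_divide)
    fix \<omega>
    have "0 \<le> (2 * Y n \<omega> - S n \<omega>)\<^sup>2" by simp
    then show "2 * (S n \<omega> * Y n \<omega>) - (S n \<omega>)\<^sup>2 \<le> 2 * (Y n \<omega>)\<^sup>2 - (S n \<omega>)\<^sup>2 / 2"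
      by (simp add: power2_eq_square algebra_simps)
  qed
  also have "\<dots> = 2 * exp (2 * c\<^sup>2 * (\<tau> n - \<tau> 0)) - (\<integral>\<omega>. (S n \<omega>)\<^sup>2 \<partial>M) / 2"
    using iS2 iY2 EY2 by simp
  finally show "(\<integral>\<omega>. (S n \<omega>)\<^sup>2 \<partial>M) \<le> 4 * exp (2 * c\<^sup>2 * (\<tau> n - \<tau> 0))"
    by simp
qed

text \<open>A supremum over all times of an interval need not be measurable as it stands. The dyadic points
  give a measurable substitute that increases with the level, so that its expectation is the limit of
  the expectations of finite maxima, and by continuity of paths it bounds all other times.\<close>

definition dyadic_sup :: "real \<Rightarrow> real \<Rightarrow> real \<Rightarrow> nat \<Rightarrow> 'a \<Rightarrow> ennreal" where
  "dyadic_sup c s L n \<omega> = (SUP i\<in>{..2 ^ n}. ennreal (exp (c * (W (s + real i * L / 2 ^ n) \<omega> - W s \<omega>))))"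

definition running_sup :: "real \<Rightarrow> real \<Rightarrow> real \<Rightarrow> 'a \<Rightarrow> ennreal" where
  "running_sup c s L \<omega> = (SUP n. dyadic_sup c s L n \<omega>)"

lemma dyadic_sup_measurable:
  "0 \<le> s \<Longrightarrow> 0 \<le> L \<Longrightarrow> dyadic_sup c s L n \<in> borel_measurable M"
  unfolding dyadic_sup_def
  by (intro borel_measurable_SUP measurable_compose[OF _ measurable_ennreal] measurable_compose[OF _ borel_measurable_exp]
    borel_measurable_times borel_measurable_diff borel_measurable_const W_measurable) auto

lemma running_sup_measurable:
  "0 \<le> s \<Longrightarrow> 0 \<le> L \<Longrightarrow> running_sup c s L \<in> borel_measurable M"
  unfolding running_sup_def by (intro borel_measurable_SUP dyadic_sup_measurable) auto

lemma dyadic_sup_mono: "dyadic_sup c s L n \<omega> \<le> dyadic_sup c s L (Suc n) \<omega>"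
  unfolding dyadic_sup_def
proof (rule SUP_mono)
  fix i :: nat assume "i \<in> {..2 ^ n}"
  then show "\<exists>j\<in>{..2 ^ Suc n}. ennreal (exp (c * (W (s + real i * L / 2 ^ n) \<omega> - W s \<omega>)))
      \<le> ennreal (exp (c * (W (s + real j * L / 2 ^ Suc n) \<omega> - W s \<omega>)))"
    by (intro bexI[of _ "2 * i"]) auto
qed

lemma nn_integral_dyadic_sup:
  assumes "0 \<le> s" "0 \<le> L"
  shows "(\<integral>\<^sup>+\<omega>. dyadic_sup c s L n \<omega> \<partial>M) \<le> ennreal (4 * exp (c\<^sup>2 * L / 2))"
proof -
  define \<tau> where "\<tau> j = s + real j * L / 2 ^ n" for j
  have \<tau>: "incseq \<tau>" "0 \<le> \<tau> 0"
    using assms by (auto simp: \<tau>_def incseq_def divide_right_mono mult_right_mono)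
  \<comment> \<open>The maximal inequality controls second moments, hence the exponent \<open>c / 2\<close>.\<close>
  let ?S = "\<lambda>\<omega>. Max ((\<lambda>j. exp (c / 2 * (W (\<tau> j) \<omega> - W (\<tau> 0) \<omega>))) ` {..2 ^ n})"
  note m = discrete_maximal_inequality[OF \<tau>, of "c / 2" "2 ^ n"]
  have "(\<integral>\<^sup>+\<omega>. dyadic_sup c s L n \<omega> \<partial>M) \<le> (\<integral>\<^sup>+\<omega>. ennreal ((?S \<omega>)\<^sup>2) \<partial>M)"
  proof (intro nn_integral_mono)
    fix \<omega>
    show "dyadic_sup c s L n \<omega> \<le> ennreal ((?S \<omega>)\<^sup>2)"
      unfolding dyadic_sup_def
    proof (intro SUP_least ennreal_leI)
      fix i :: nat assume i: "i \<in> {..2 ^ n}"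
      have "exp (c * (W (s + real i * L / 2 ^ n) \<omega> - W s \<omega>)) = (exp (c / 2 * (W (\<tau> i) \<omega> - W (\<tau> 0) \<omega>)))\<^sup>2"
        by (simp add: \<tau>_def power2_eq_square mult_exp_exp)
      also have "\<dots> \<le> (?S \<omega>)\<^sup>2"
        using i by (intro power_mono Max_ge) auto
      finally show "exp (c * (W (s + real i * L / 2 ^ n) \<omega> - W s \<omega>)) \<le> (?S \<omega>)\<^sup>2" .
    qed
  qed
  also have "\<dots> = ennreal (\<integral>\<omega>. (?S \<omega>)\<^sup>2 \<partial>M)"
    using m(1) by (intro nn_integral_eq_integral) auto
  also have "\<dots> \<le> ennreal (4 * exp (2 * (c / 2)\<^sup>2 * (\<tau> (2 ^ n) - \<tau> 0)))"
    using m(2) by (rule ennreal_leI)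
  also have "2 * (c / 2)\<^sup>2 * (\<tau> (2 ^ n) - \<tau> 0) = c\<^sup>2 * L / 2"
    by (simp add: \<tau>_def power2_eq_square)
  finally show ?thesis .
qed

lemma nn_integral_running_sup:
  assumes "0 \<le> s" "0 \<le> L"
  shows "(\<integral>\<^sup>+\<omega>. running_sup c s L \<omega> \<partial>M) \<le> ennreal (4 * exp (c\<^sup>2 * L / 2))"
proof -
  have "(\<integral>\<^sup>+\<omega>. running_sup c s L \<omega> \<partial>M) = (SUP n. \<integral>\<^sup>+\<omega>. dyadic_sup c s L n \<omega> \<partial>M)"
    unfolding running_sup_def
    using assms by (intro nn_integral_monotone_convergence_SUP)
      (auto simp: incseq_Suc_iff le_fun_def dyadic_sup_mono dyadic_sup_measurable)
  also have "\<dots> \<le> ennreal (4 * exp (c\<^sup>2 * L / 2))"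
    using assms by (intro SUP_least nn_integral_dyadic_sup)
  finally show ?thesis .
qed

lemma exp_le_running_sup:
  assumes \<omega>: "\<omega> \<in> space M" and s: "0 \<le> s" "s \<le> t" "t \<le> s + L" and L: "0 < L"
  shows "ennreal (exp (c * (W t \<omega> - W s \<omega>))) \<le> running_sup c s L \<omega>"
proof -
  define u where "u = (t - s) / L"
  have u: "0 \<le> u" "u \<le> 1" "t = s + u * L" using s L by (auto simp: u_def field_simps)
  define i where "i n = nat \<lfloor>u * 2 ^ n\<rfloor>" for n :: nat
  define x where "x n = s + real (i n) * L / 2 ^ n" for n
  have ri: "real (i n) = of_int \<lfloor>u * 2 ^ n\<rfloor>" for n using u by (simp add: i_def)
  have "(\<lambda>n. of_int \<lfloor>u * 2 ^ n\<rfloor> / 2 ^ n) \<longlonglongrightarrow> u"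
  proof (rule tendsto_sandwich[OF _ _ _ tendsto_const])
    show "\<forall>\<^sub>F n in sequentially. u - 1 / 2 ^ n \<le> of_int \<lfloor>u * 2 ^ n\<rfloor> / 2 ^ n"
    proof (intro always_eventually allI)
      fix n :: nat
      have "u * 2 ^ n - 1 \<le> of_int \<lfloor>u * 2 ^ n\<rfloor>" by linarith
      then have "(u * 2 ^ n - 1) / 2 ^ n \<le> of_int \<lfloor>u * 2 ^ n\<rfloor> / 2 ^ n" by (rule divide_right_mono) simp
      then show "u - 1 / 2 ^ n \<le> of_int \<lfloor>u * 2 ^ n\<rfloor> / 2 ^ n" by (simp add: diff_divide_distrib)
    qed
    show "\<forall>\<^sub>F n in sequentially. of_int \<lfloor>u * 2 ^ n\<rfloor> / 2 ^ n \<le> u"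
      by (intro always_eventually allI) (simp add: field_simps)
    show "(\<lambda>n. u - 1 / 2 ^ n) \<longlonglongrightarrow> u" by real_asymp
  qed
  then have "(\<lambda>n. s + (of_int \<lfloor>u * 2 ^ n\<rfloor> / 2 ^ n) * L) \<longlonglongrightarrow> s + u * L"
    by (intro tendsto_intros)
  then have x: "x \<longlonglongrightarrow> t" using u ri by (simp add: x_def[abs_def])
  have "continuous_on {0..} (\<lambda>t. ennreal (exp (c * (W t \<omega> - W s \<omega>))))"
    using W_continuous[OF \<omega>] by (intro continuous_on_ennreal continuous_intros)
  then have "(\<lambda>n. ennreal (exp (c * (W (x n) \<omega> - W s \<omega>)))) \<longlonglongrightarrow> ennreal (exp (c * (W t \<omega> - W s \<omega>)))"
    by (rule continuous_on_tendsto_compose[OF _ x]) (use s L in \<open>auto simp: x_def\<close>)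
  then show ?thesis
  proof (rule LIMSEQ_le_const2, intro exI[of _ 0] allI impI)
    fix n
    have "u * 2 ^ n \<le> 2 ^ n" using u by simp
    then have "real_of_int \<lfloor>u * 2 ^ n\<rfloor> \<le> 2 ^ n" using of_int_floor_le[of "u * 2 ^ n"] by linarith
    then have "real_of_int \<lfloor>u * 2 ^ n\<rfloor> \<le> real_of_int (2 ^ n)" by simp
    then have "\<lfloor>u * 2 ^ n\<rfloor> \<le> 2 ^ n" unfolding of_int_le_iff .
    then have "i n \<le> 2 ^ n" by (simp add: i_def nat_le_iff)
    then have "ennreal (exp (c * (W (x n) \<omega> - W s \<omega>))) \<le> dyadic_sup c s L n \<omega>"
      unfolding dyadic_sup_def x_def by (intro SUP_upper2[of "i n"]) auto
    also have "\<dots> \<le> running_sup c s L \<omega>"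
      unfolding running_sup_def by (rule SUP_upper) simp
    finally show "ennreal (exp (c * (W (x n) \<omega> - W s \<omega>))) \<le> running_sup c s L \<omega>" .
  qed
qed

definition running_sup_abs :: "real \<Rightarrow> real \<Rightarrow> real \<Rightarrow> 'a \<Rightarrow> ennreal" where
  "running_sup_abs c s L \<omega> = running_sup c s L \<omega> + running_sup (- c) s L \<omega>"

lemma running_sup_abs_measurable:
  "0 \<le> s \<Longrightarrow> 0 \<le> L \<Longrightarrow> running_sup_abs c s L \<in> borel_measurable M"
  unfolding running_sup_abs_def[abs_def] by (intro borel_measurable_add running_sup_measurable)

lemma nn_integral_running_sup_abs:
  assumes "0 \<le> s" "0 \<le> L"
  shows "(\<integral>\<^sup>+\<omega>. running_sup_abs c s L \<omega> \<partial>M) \<le> ennreal (8 * exp (c\<^sup>2 * L / 2))"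
proof -
  have "(\<integral>\<^sup>+\<omega>. running_sup_abs c s L \<omega> \<partial>M)
     = (\<integral>\<^sup>+\<omega>. running_sup c s L \<omega> \<partial>M) + (\<integral>\<^sup>+\<omega>. running_sup (-c) s L \<omega> \<partial>M)"
    unfolding running_sup_abs_def using assms by (intro nn_integral_add running_sup_measurable)
  also have "\<dots> \<le> ennreal (4 * exp (c\<^sup>2 * L / 2)) + ennreal (4 * exp ((-c)\<^sup>2 * L / 2))"
    using assms by (intro add_mono nn_integral_running_sup)
  also have "\<dots> = ennreal (8 * exp (c\<^sup>2 * L / 2))"
    by (subst ennreal_plus[symmetric]) auto
  finally show ?thesis .
qed

lemma exp_abs_le_running_sup_abs:
  assumes "\<omega> \<in> space M" "0 \<le> s" "s \<le> t" "t \<le> s + L" "0 < L" "0 \<le> c"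
  shows "ennreal (exp (c * \<bar>W t \<omega> - W s \<omega>\<bar>)) \<le> running_sup_abs c s L \<omega>"
proof -
  have "exp (c * \<bar>W t \<omega> - W s \<omega>\<bar>) \<le> exp (c * (W t \<omega> - W s \<omega>)) + exp ((- c) * (W t \<omega> - W s \<omega>))"
    using exp_abs_le[of "c * (W t \<omega> - W s \<omega>)"] assms(6) by (simp add: abs_mult)
  then have "ennreal (exp (c * \<bar>W t \<omega> - W s \<omega>\<bar>))
      \<le> ennreal (exp (c * (W t \<omega> - W s \<omega>))) + ennreal (exp ((- c) * (W t \<omega> - W s \<omega>)))"
    using ennreal_leI ennreal_plus[of "exp (c * (W t \<omega> - W s \<omega>))" "exp ((- c) * (W t \<omega> - W s \<omega>))"]
    by (metis exp_ge_zero)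
  also have "\<dots> \<le> running_sup_abs c s L \<omega>"
    unfolding running_sup_abs_def using assms by (intro add_mono exp_le_running_sup)
  finally show ?thesis .
qed

end

section \<open>Paths of the Vasicek equation\<close>

lemma set_integral_continuous_Icc:
  fixes f :: "real \<Rightarrow> real"
  assumes "continuous_on {u..v} f"
  shows "(LBINT s:{u..v}. f s) = integral {u..v} f" "set_integrable lborel {u..v} f"
proof -
  show i: "set_integrable lborel {u..v} f"
    using borel_integrable_atLeastAtMost'[OF assms] .
  show "(LBINT s:{u..v}. f s) = integral {u..v} f"
    by (rule set_borel_integral_eq_integral(2)[OF i])
qed

lemma integral_exp_kernel:
  fixes b t u :: real
  assumes "b \<noteq> 0" "u \<le> t"
  shows "((\<lambda>s. exp (- b * (t - s))) has_integral (1 - exp (- b * (t - u))) / b) {u..t}"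
proof -
  have "((\<lambda>s. exp (- b * (t - s))) has_integral exp (- b * (t - t)) / b - exp (- b * (t - u)) / b) {u..t}"
    using assms
    by (intro fundamental_theorem_of_calculus)
      (auto intro!: derivative_eq_intros simp: has_real_derivative_iff_has_vector_derivative[symmetric])
  then show ?thesis by (simp add: diff_divide_distrib)
qed

text \<open>The Wiener integral of \<open>e\<^sup>-\<^sup>b\<^sup>(\<^sup>t\<^sup>-\<^sup>s\<^sup>)\<close>, integrated by parts so that it makes sense path by path.\<close>

definition ou_path :: "real \<Rightarrow> (real \<Rightarrow> real) \<Rightarrow> real \<Rightarrow> real" where
  "ou_path b w t = w t - b * integral {0..t} (\<lambda>s. exp (- b * (t - s)) * w s)"

text \<open>Subtracting the noise from the path leaves a differentiable function that solves a linear
  equation with integrating factor \<open>e\<^sup>b\<^sup>s\<close>.\<close>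

lemma vasicek_path_explicit:
  fixes x w :: "real \<Rightarrow> real" and a b \<sigma> x0 T t :: real
  assumes b: "b \<noteq> 0"
    and cx: "continuous_on {0..T} x" and cw: "continuous_on {0..T} w"
    and sde: "\<And>t. t \<in> {0..T} \<Longrightarrow> x t = x0 + integral {0..t} (\<lambda>s. a - b * x s) + \<sigma> * w t"
    and t: "t \<in> {0..T}"
  shows "x t = exp (- b * t) * x0 + a / b * (1 - exp (- b * t)) + \<sigma> * ou_path b w t"
proof -
  define D where "D s = x s - \<sigma> * w s" for s
  have ct: "continuous_on {0..t} w" "continuous_on {0..t} x"
    using t by (auto intro: continuous_on_subset[OF cw] continuous_on_subset[OF cx])
  have D: "D s = x0 + integral {0..s} (\<lambda>s. a - b * x s)" if "s \<in> {0..t}" for s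
    using sde[of s] that t by (simp add: D_def)
  have dD: "(D has_real_derivative a - b * x s) (at s within {0..t})" if s: "s \<in> {0..t}" for s
  proof (rule has_field_derivative_transform_within[OF _ zero_less_one s])
    show "x0 + integral {0..s} (\<lambda>s. a - b * x s) = D s" if "s \<in> {0..t}" for s using D[OF that] ..
    show "((\<lambda>s. x0 + integral {0..s} (\<lambda>s. a - b * x s)) has_real_derivative a - b * x s) (at s within {0..t})"
      using s ct by (auto intro!: derivative_eq_intros integral_has_real_derivative continuous_intros)
  qed
  have "((\<lambda>s. exp (b * s) * (a - b * \<sigma> * w s)) has_integral exp (b * t) * D t - exp (b * 0) * D 0) {0..t}"
  proof (rule fundamental_theorem_of_calculus)
    fix s assume s: "s \<in> {0..t}"
    have "((\<lambda>s. exp (b * s) * D s) has_real_derivative (b * exp (b * s)) * D s + (a - b * x s) * exp (b * s)) (at s within {0..t})"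
      by (auto intro!: derivative_eq_intros dD[OF s] simp: algebra_simps)
    also have "(b * exp (b * s)) * D s + (a - b * x s) * exp (b * s) = exp (b * s) * (a - b * \<sigma> * w s)"
      by (simp add: D_def algebra_simps)
    finally show "((\<lambda>s. exp (b * s) * D s) has_vector_derivative exp (b * s) * (a - b * \<sigma> * w s)) (at s within {0..t})"
      by (simp add: has_real_derivative_iff_has_vector_derivative)
  qed (use t in simp)
  then have "((\<lambda>s. exp (- b * t) * (exp (b * s) * (a - b * \<sigma> * w s))) has_integral
      exp (- b * t) * (exp (b * t) * D t - exp (b * 0) * D 0)) {0..t}"
    by (rule has_integral_mult_right)
  moreover have "exp (- b * t) * (exp (b * s) * (a - b * \<sigma> * w s))
     = a * exp (- b * (t - s)) - (b * \<sigma>) * (exp (- b * (t - s)) * w s)" for s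
    by (simp add: algebra_simps exp_diff exp_minus divide_simps)
  moreover have "exp (- b * t) * (exp (b * t) * D t - exp (b * 0) * D 0) = D t - exp (- b * t) * x0"
    using D[of 0] t by (simp add: algebra_simps exp_minus)
  ultimately have 1: "((\<lambda>s. a * exp (- b * (t - s)) - (b * \<sigma>) * (exp (- b * (t - s)) * w s)) has_integral
      D t - exp (- b * t) * x0) {0..t}"
    by simp
  have 2: "((\<lambda>s. exp (- b * (t - s)) * w s) has_integral integral {0..t} (\<lambda>s. exp (- b * (t - s)) * w s)) {0..t}"
    by (intro integrable_integral integrable_continuous_real continuous_intros ct)
  have 3: "((\<lambda>s. a * exp (- b * (t - s)) - (b * \<sigma>) * (exp (- b * (t - s)) * w s)) has_integral
      a * ((1 - exp (- b * (t - 0))) / b) - (b * \<sigma>) * integral {0..t} (\<lambda>s. exp (- b * (t - s)) * w s)) {0..t}"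
    using b t by (intro has_integral_diff has_integral_mult_right integral_exp_kernel 2) auto
  from has_integral_unique[OF 1 3] show ?thesis
    using b by (simp add: D_def ou_path_def field_simps)
qed

lemma ou_path_bound:
  assumes b: "b > 0" and t: "0 \<le> t" and cw: "continuous_on {0..t} w"
    and S: "\<And>s. s \<in> {0..t} \<Longrightarrow> \<bar>w s\<bar> \<le> S"
  shows "\<bar>ou_path b w t\<bar> \<le> 2 * S"
proof -
  have S0: "0 \<le> S" using S[of 0] t by force
  have "\<bar>integral {0..t} (\<lambda>s. exp (- b * (t - s)) * w s)\<bar> \<le> integral {0..t} (\<lambda>s. exp (- b * (t - s)) * S)"
    unfolding real_norm_def[symmetric]
    by (rule integral_norm_bound_integral)
      (auto intro!: integrable_continuous_real continuous_intros cw mult_left_mono S simp: abs_mult)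
  also have "\<dots> = (1 - exp (- b * (t - 0))) / b * S"
    using has_integral_mult_left[OF integral_exp_kernel[of b 0 t], of S] b t
    by (intro integral_unique) auto
  also have "\<dots> \<le> S / b"
    using b S0 by (simp add: field_simps)
  finally have "\<bar>b * integral {0..t} (\<lambda>s. exp (- b * (t - s)) * w s)\<bar> \<le> S"
    using b by (simp add: abs_mult field_simps)
  moreover have "\<bar>w t\<bar> \<le> S" using S[of t] t by simp
  ultimately show ?thesis unfolding ou_path_def by linarith
qed

lemma vasicek_path_integral:
  fixes x w :: "real \<Rightarrow> real"
  assumes b: "b \<noteq> 0" and t: "0 \<le> t" and cx: "continuous_on {0..t} x"
    and sde: "x t = x0 + integral {0..t} (\<lambda>s. a - b * x s) + \<sigma> * w t"
  shows "integral {0..t} x = (x0 + a * t + \<sigma> * w t - x t) / b"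
proof -
  have "((\<lambda>s. a - b * x s) has_integral a * t - b * integral {0..t} x) {0..t}"
    using has_integral_diff[OF has_integral_const_real[of a 0 t]
      has_integral_mult_right[OF integrable_integral[OF integrable_continuous_real[OF cx]], of b]] t
    by (simp add: mult.commute)
  then have "integral {0..t} (\<lambda>s. a - b * x s) = a * t - b * integral {0..t} x"
    by (rule integral_unique)
  with sde b show ?thesis by (simp add: field_simps)
qed

text \<open>Over a time \<open>h\<close> the part \<open>(\<alpha> / b) |x|\<close> shrinks by the factor \<open>e\<^sup>-\<^sup>b\<^sup>h\<close>, and the drift that
  \<open>\<alpha> \<integral>x\<close> gains from the initial value is at most what is lost in this way. The initial value
  therefore enters with coefficient one, and only the oscillation \<open>S\<close> of the noise is added.\<close>

lemma vasicek_path_restart: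
  fixes x w :: "real \<Rightarrow> real"
  assumes pos: "a > 0" "b > 0" "\<sigma> > 0" "\<alpha> > 0"
    and cx: "continuous_on {0..} x" and cw: "continuous_on {0..} w"
    and sde: "\<And>t. 0 \<le> t \<Longrightarrow> x t = x0 + integral {0..t} (\<lambda>s. a - b * x s) + \<sigma> * w t"
    and k: "0 \<le> k" and h: "0 \<le> h" "h \<le> L"
    and S: "\<And>s. s \<in> {0..h} \<Longrightarrow> \<bar>w (k + s) - w k\<bar> \<le> S"
  shows "\<alpha> * integral {0..k + h} x + \<alpha> / b * \<bar>x (k + h)\<bar>
    \<le> \<alpha> * integral {0..k} x + \<alpha> / b * \<bar>x k\<bar> + \<alpha> / b * (a * L + 2 * a / b + 5 * \<sigma> * S)"
proof -
  define y where "y s = x (k + s)" for s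
  define v where "v s = w (k + s) - w k" for s
  have cy: "continuous_on {0..h} y" unfolding y_def
    by (rule continuous_on_compose2[OF cx]) (use k in \<open>auto intro!: continuous_intros\<close>)
  have cv: "continuous_on {0..h} v" unfolding v_def
    by (intro continuous_intros continuous_on_compose2[OF cw]) (use k in \<open>auto intro!: continuous_intros\<close>)
  have int: "(\<lambda>s. a - b * x s) integrable_on {u..v}" if "0 \<le> u" for u v
    by (intro integrable_continuous_real continuous_intros continuous_on_subset[OF cx]) (use that in auto)
  have sdey: "y t = x k + integral {0..t} (\<lambda>s. a - b * y s) + \<sigma> * v t" if t: "t \<in> {0..h}" for t
  proof -
    have "integral {0..k} (\<lambda>s. a - b * x s) + integral {k..k + t} (\<lambda>s. a - b * x s)
        = integral {0..k + t} (\<lambda>s. a - b * x s)"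
      using t k int by (intro Henstock_Kurzweil_Integration.integral_combine) auto
    moreover have "integral {k..k + t} (\<lambda>s. a - b * x s) = integral {0..t} (\<lambda>s. a - b * y s)"
      using integral_shift_real_ivl[of k k "k + t" "\<lambda>s. a - b * x s"] by (simp add: y_def add.commute)
    ultimately show ?thesis
      using sde[of "k + t"] sde[of k] t k by (simp add: y_def v_def algebra_simps)
  qed
  let ?q = "exp (- b * h)"
  let ?B = "a / b + \<sigma> * (2 * S)"
  have e: "y h = ?q * x k + a / b * (1 - ?q) + \<sigma> * ou_path b v h"
    using pos h by (intro vasicek_path_explicit[OF _ cy cv sdey]) auto
  have q: "0 < ?q" "?q \<le> 1" using pos h by auto
  have ou: "\<bar>ou_path b v h\<bar> \<le> 2 * S"
    using pos h S by (intro ou_path_bound cv) (auto simp: v_def)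
  have err: "\<bar>y h - ?q * x k\<bar> \<le> ?B"
  proof -
    have "\<bar>a / b * (1 - ?q)\<bar> \<le> a / b"
      using q pos by (simp add: abs_mult field_simps)
    moreover have "\<bar>\<sigma> * ou_path b v h\<bar> \<le> \<sigma> * (2 * S)"
      using ou pos by (simp add: abs_mult)
    ultimately show ?thesis unfolding e by linarith
  qed
  have Iy: "integral {0..h} y = (x k + a * h + \<sigma> * v h - y h) / b"
    using pos h sdey[of h] by (intro vasicek_path_integral cy) auto
  have "integral {0..k} x + integral {k..k + h} x = integral {0..k + h} x"
    using k h by (intro Henstock_Kurzweil_Integration.integral_combine integrable_continuous_real continuous_on_subset[OF cx]) auto
  moreover have "integral {k..k + h} x = integral {0..h} y"
    using integral_shift_real_ivl[of k k "k + h" x] by (simp add: y_def[abs_def] add.commute)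
  ultimately have I: "\<alpha> * integral {0..k + h} x = \<alpha> * integral {0..k} x + \<alpha> / b * (x k + a * h + \<sigma> * v h - y h)"
  proof -
    assume "integral {0..k} x + integral {k..k + h} x = integral {0..k + h} x" "integral {k..k + h} x = integral {0..h} y"
    then have "integral {0..k + h} x = integral {0..k} x + (x k + a * h + \<sigma> * v h - y h) / b" using Iy by simp
    then show ?thesis by (simp add: ring_distribs add_divide_distrib diff_divide_distrib)
  qed
  have "\<sigma> * v h \<le> \<sigma> * S" using S[of h] h pos by (auto simp: v_def)
  moreover have "a * h \<le> a * L" using h pos by simp
  moreover have "x k - y h + \<bar>y h\<bar> \<le> \<bar>x k\<bar> + 2 * ?B"
  proof -
    have "\<bar>y h\<bar> \<le> ?q * \<bar>x k\<bar> + ?B" 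
    proof -
      have "\<bar>?q * x k\<bar> = ?q * \<bar>x k\<bar>" by (simp add: abs_mult)
      then show ?thesis using err by linarith
    qed
    moreover have "x k - ?q * x k \<le> \<bar>x k\<bar> - ?q * \<bar>x k\<bar>"
      using q mult_left_mono[of "x k" "\<bar>x k\<bar>" "1 - ?q"] by (simp add: algebra_simps)
    moreover have "X - Y + Z \<le> C + 2 * B" if "Z \<le> R + B" "X - P \<le> C - R" "\<bar>Y - P\<bar> \<le> B" for X Y Z C B R P :: real
      using that by linarith
    ultimately show ?thesis using err by blast
  qed
  moreover have "2 * ?B = 2 * a / b + 4 * (\<sigma> * S)" "5 * \<sigma> * S = 5 * (\<sigma> * S)"
    by (simp_all add: ring_distribs)
  ultimately have "x k + a * h + \<sigma> * v h - y h + \<bar>y h\<bar> \<le> \<bar>x k\<bar> + (a * L + 2 * a / b + 5 * \<sigma> * S)"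
    by linarith
  then have "\<alpha> / b * (x k + a * h + \<sigma> * v h - y h + \<bar>y h\<bar>) \<le> \<alpha> / b * (\<bar>x k\<bar> + (a * L + 2 * a / b + 5 * \<sigma> * S))"
    using pos by (intro mult_left_mono) auto
  then show ?thesis
    unfolding I by (simp add: y_def algebra_simps)
qed

section \<open>The Wiener integral as a limit of Riemann sums\<close>

lemma sum_by_parts:
  fixes e w :: "nat \<Rightarrow> real"
  shows "(\<Sum>k<n. e k * (w (Suc k) - w k)) = e n * w n - e 0 * w 0 - (\<Sum>k<n. (e (Suc k) - e k) * w (Suc k))"
  by (induction n) (auto simp: algebra_simps)

lemma integral_grid:
  fixes f :: "real \<Rightarrow> real" and t :: "nat \<Rightarrow> real"
  assumes "incseq t" "\<And>u v. t 0 \<le> u \<Longrightarrow> f integrable_on {u..v}"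
  shows "(\<Sum>k<n. integral {t k..t (Suc k)} f) = integral {t 0..t n} f"
proof (induction n)
  case (Suc n)
  have "integral {t 0..t n} f + integral {t n..t (Suc n)} f = integral {t 0..t (Suc n)} f"
    using assms by (intro Henstock_Kurzweil_Integration.integral_combine) (auto simp: incseq_def)
  with Suc show ?case by simp
qed simp

definition wiener_sum :: "real \<Rightarrow> (real \<Rightarrow> real) \<Rightarrow> real \<Rightarrow> nat \<Rightarrow> real" where
  "wiener_sum b w t n = (\<Sum>k<n. exp (- b * (t - real k * t / real n)) *
      (w (real (Suc k) * t / real n) - w (real k * t / real n)))"

lemma wiener_sum_by_parts:
  assumes "n > 0" "w 0 = 0"
  shows "wiener_sum b w t n = w t - (\<Sum>k<n. (exp (- b * (t - real (Suc k) * t / real n)) - exp (- b * (t - real k * t / real n))) *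
      w (real (Suc k) * t / real n))"
  unfolding wiener_sum_def
  by (subst sum_by_parts[of "\<lambda>k. exp (- b * (t - real k * t / real n))" "\<lambda>k. w (real k * t / real n)"]) (use assms in simp)

lemma wiener_sum_bound:
  assumes b: "b \<ge> 0" and n: "n > 0" and w0: "w 0 = 0" and t: "0 \<le> t" and S: "\<And>s. s \<in> {0..t} \<Longrightarrow> \<bar>w s\<bar> \<le> S"
  shows "\<bar>wiener_sum b w t n\<bar> \<le> 2 * S"
proof -
  let ?e = "\<lambda>k. exp (- b * (t - real k * t / real n))"
  have S0: "0 \<le> S" using S[of 0] t by force
  have mono: "?e k \<le> ?e (Suc k)" for k
  proof -
    have "real k * t / real n \<le> real (Suc k) * t / real n"
      using t by (intro divide_right_mono mult_right_mono) auto
    then have "- b * (t - real k * t / real n) \<le> - b * (t - real (Suc k) * t / real n)"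
      using b by (intro mult_left_mono_neg) auto
    then show ?thesis by (simp only: exp_le_cancel_iff)
  qed
  have "\<bar>\<Sum>k<n. (?e (Suc k) - ?e k) * w (real (Suc k) * t / real n)\<bar> \<le> (\<Sum>k<n. (?e (Suc k) - ?e k) * S)"
  proof (rule order_trans[OF sum_abs], rule sum_mono)
    fix k assume "k \<in> {..<n}"
    then have "real (Suc k) * t / real n \<le> t"
      using n t by (simp add: divide_le_eq mult.commute[of t] mult_right_mono)
    then have "\<bar>w (real (Suc k) * t / real n)\<bar> \<le> S" using t by (intro S) auto
    then show "\<bar>(?e (Suc k) - ?e k) * w (real (Suc k) * t / real n)\<bar> \<le> (?e (Suc k) - ?e k) * S"
      using mono[of k] by (simp add: abs_mult mult_left_mono)
  qed
  also have "\<dots> = (\<Sum>k<n. ?e (Suc k) - ?e k) * S"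
    by (simp add: sum_distrib_right)
  also have "(\<Sum>k<n. ?e (Suc k) - ?e k) = 1 - exp (- b * t)"
    using n by (subst sum_lessThan_telescope) simp
  also have "(1 - exp (- b * t)) * S \<le> S"
    using S0 by (simp add: algebra_simps)
  finally show ?thesis
    unfolding wiener_sum_by_parts[where w=w, OF n w0] using S[of t] t by force
qed

text \<open>Summation by parts moves the differences to the smooth kernel; what remains is a Riemann sum of
  \<open>b e\<^sup>-\<^sup>b\<^sup>(\<^sup>t\<^sup>-\<^sup>s\<^sup>) w s\<close>, and the error is a modulus of continuity of \<open>w\<close> times the total mass of the
  kernel, which is at most one.\<close>

lemma wiener_sum_converges:
  assumes b: "b > 0" and t: "0 < t" and cw: "continuous_on {0..} w" and w0: "w 0 = 0"
  shows "(\<lambda>n. wiener_sum b w t (Suc n)) \<longlonglongrightarrow> ou_path b w t"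
proof (rule LIMSEQ_I)
  fix \<epsilon> :: real assume \<epsilon>: "0 < \<epsilon>"
  have cwt: "continuous_on {0..t} w" by (rule continuous_on_subset[OF cw]) auto
  then have "uniformly_continuous_on {0..t} w" by (intro compact_uniformly_continuous) auto
  then obtain d where d: "d > 0" "\<And>s s'. s \<in> {0..t} \<Longrightarrow> s' \<in> {0..t} \<Longrightarrow> \<bar>s' - s\<bar> < d \<Longrightarrow> \<bar>w s' - w s\<bar> < \<epsilon> / 2"
    unfolding uniformly_continuous_on_def dist_real_def using \<epsilon> by (metis half_gt_zero)
  obtain n0 :: nat where n0: "t / d < real n0" using reals_Archimedean2 by blast
  show "\<exists>no. \<forall>n\<ge>no. norm (wiener_sum b w t (Suc n) - ou_path b w t) < \<epsilon>"
  proof (intro exI allI impI)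
    fix n assume "n \<ge> n0"
    define N where "N = Suc n"
    have "t / d < real N" using n0 \<open>n \<ge> n0\<close> by (simp add: N_def)
    then have N: "N > 0" "t / real N < d"
      using d(1) by (auto simp: N_def field_simps)
    define \<tau> where "\<tau> k = real k * t / real N" for k
    let ?f = "\<lambda>s. b * exp (- b * (t - s))"
    have inc: "incseq \<tau>" using t by (auto simp: incseq_def \<tau>_def intro!: divide_right_mono mult_right_mono)
    have step: "\<tau> k \<le> \<tau> (Suc k)" for k using inc by (simp add: incseq_SucD)
    have tN: "\<tau> N = t" "\<tau> 0 = 0" using N by (auto simp: \<tau>_def)
    have \<tau>t: "\<tau> k \<in> {0..t}" if "k \<le> N" for k
      using incseqD[OF inc that] tN incseqD[OF inc, of 0 k] by auto
    have ef: "(?f has_integral exp (- b * (t - v)) - exp (- b * (t - u))) {u..v}" if "u \<le> v" for u v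
      using that b by (intro fundamental_theorem_of_calculus)
       (auto intro!: derivative_eq_intros simp: has_real_derivative_iff_has_vector_derivative[symmetric])
    have fi: "?f integrable_on {u..v}" for u v
      by (intro integrable_continuous_real continuous_intros)
    have fwi: "(\<lambda>s. ?f s * w s) integrable_on {u..v}" if "0 \<le> u" for u v
      by (intro integrable_continuous_real continuous_intros continuous_on_subset[OF cw]) (use that in auto)
    have I: "b * integral {0..t} (\<lambda>s. exp (- b * (t - s)) * w s) = (\<Sum>k<N. integral {\<tau> k..\<tau> (Suc k)} (\<lambda>s. ?f s * w s))"
      using integral_grid[OF inc, of "\<lambda>s. ?f s * w s" N] fwi tN by (simp add: mult.assoc)
    have dif: "\<bar>(exp (- b * (t - \<tau> (Suc k))) - exp (- b * (t - \<tau> k))) * w (\<tau> (Suc k)) - integral {\<tau> k..\<tau> (Suc k)} (\<lambda>s. ?f s * w s)\<bar>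
        \<le> \<epsilon> / 2 * (exp (- b * (t - \<tau> (Suc k))) - exp (- b * (t - \<tau> k)))" (is "\<bar>?l\<bar> \<le> _") if k: "k < N" for k
    proof -
      have 0: "0 \<le> \<tau> k" using \<tau>t[of k] k by simp
      have "((\<lambda>s. ?f s * w (\<tau> (Suc k)) - ?f s * w s) has_integral ?l) {\<tau> k..\<tau> (Suc k)}"
        by (intro has_integral_diff has_integral_mult_left ef step integrable_integral fwi 0)
      then have l: "?l = integral {\<tau> k..\<tau> (Suc k)} (\<lambda>s. ?f s * w (\<tau> (Suc k)) - ?f s * w s)"
        by (simp add: integral_unique)
      have "norm (integral {\<tau> k..\<tau> (Suc k)} (\<lambda>s. ?f s * w (\<tau> (Suc k)) - ?f s * w s))
          \<le> integral {\<tau> k..\<tau> (Suc k)} (\<lambda>s. \<epsilon> / 2 * ?f s)"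
      proof (rule integral_norm_bound_integral)
        show "(\<lambda>s. ?f s * w (\<tau> (Suc k)) - ?f s * w s) integrable_on {\<tau> k..\<tau> (Suc k)}"
          by (intro integrable_diff fwi 0 integrable_on_mult_left fi)
        show "(\<lambda>s. \<epsilon> / 2 * ?f s) integrable_on {\<tau> k..\<tau> (Suc k)}"
          by (intro integrable_continuous_real continuous_intros)
        fix s assume s: "s \<in> {\<tau> k..\<tau> (Suc k)}"
        have "\<bar>\<tau> (Suc k) - s\<bar> \<le> t / real N"
          using s by (auto simp: \<tau>_def add_divide_distrib algebra_simps)
        then have "\<bar>w (\<tau> (Suc k)) - w s\<bar> < \<epsilon> / 2"
          using s N \<tau>t[of k] \<tau>t[of "Suc k"] k by (intro d(2)) auto
        then have "?f s * \<bar>w (\<tau> (Suc k)) - w s\<bar> \<le> ?f s * (\<epsilon> / 2)"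
          using b by (intro mult_left_mono) auto
        moreover have "norm (?f s * w (\<tau> (Suc k)) - ?f s * w s) = ?f s * \<bar>w (\<tau> (Suc k)) - w s\<bar>"
          unfolding right_diff_distrib[symmetric] using b by (simp add: abs_mult)
        ultimately show "norm (?f s * w (\<tau> (Suc k)) - ?f s * w s) \<le> \<epsilon> / 2 * ?f s"
          by (simp add: mult.commute)
      qed
      also have "\<dots> = \<epsilon> / 2 * (exp (- b * (t - \<tau> (Suc k))) - exp (- b * (t - \<tau> k)))"
        by (intro integral_unique has_integral_mult_right ef step)
      finally show ?thesis unfolding l by simp
    qed
    have diff: "wiener_sum b w t N - ou_path b w t
       = - (\<Sum>k<N. (exp (- b * (t - \<tau> (Suc k))) - exp (- b * (t - \<tau> k))) * w (\<tau> (Suc k)) - integral {\<tau> k..\<tau> (Suc k)} (\<lambda>s. ?f s * w s))"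
      unfolding wiener_sum_by_parts[where w=w, OF N(1) w0] ou_path_def I sum_subtractf by (simp add: \<tau>_def)
    have "\<bar>wiener_sum b w t N - ou_path b w t\<bar> \<le> (\<Sum>k<N. \<epsilon> / 2 * (exp (- b * (t - \<tau> (Suc k))) - exp (- b * (t - \<tau> k))))"
      unfolding diff abs_minus_cancel by (intro order_trans[OF sum_abs] sum_mono dif) auto
    also have "\<dots> = \<epsilon> / 2 * (exp (- b * (t - \<tau> N)) - exp (- b * (t - \<tau> 0)))"
      unfolding sum_distrib_left[symmetric] by (subst sum_lessThan_telescope) simp
    also have "\<dots> \<le> \<epsilon> / 2 * 1"
      unfolding tN using \<epsilon> by (intro mult_left_mono) auto
    also have "\<dots> < \<epsilon>" using \<epsilon> by simp
    finally show "norm (wiener_sum b w t (Suc n) - ou_path b w t) < \<epsilon>"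
      by (simp add: N_def)
  qed
qed

text \<open>These are the Riemann sums of the variances and covariances; being geometric sums, they have
  closed forms.\<close>

lemma exp_riemann_sum_converges:
  fixes \<beta> t :: real
  assumes "\<beta> > 0" "t > 0"
  shows "(\<lambda>n. \<Sum>k<Suc n. exp (- \<beta> * (t - real k * t / real (Suc n))) * (t / real (Suc n))) \<longlonglongrightarrow> (1 - exp (- \<beta> * t)) / \<beta>"
proof -
  have e: "(\<Sum>k<Suc n. exp (- \<beta> * (t - real k * t / real (Suc n))) * (t / real (Suc n)))
     = (1 - exp (- \<beta> * t)) * ((t / real (Suc n)) / (exp (\<beta> * t / real (Suc n)) - 1))" for n
  proof -
    let ?x = "exp (\<beta> * t / real (Suc n))"
    have x1: "?x \<noteq> 1" using assms by simp
    have "exp (- \<beta> * (t - real k * t / real (Suc n))) = exp (- \<beta> * t) * ?x ^ k" for k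
      by (simp add: exp_of_nat_mult[symmetric] mult_exp_exp algebra_simps)
    then have "(\<Sum>k<Suc n. exp (- \<beta> * (t - real k * t / real (Suc n))) * (t / real (Suc n)))
      = exp (- \<beta> * t) * (t / real (Suc n)) * (\<Sum>k<Suc n. ?x ^ k)"
      unfolding sum_distrib_left by (intro sum.cong) (auto simp: mult_ac)
    also have "(\<Sum>k<Suc n. ?x ^ k) = (?x ^ Suc n - 1) / (?x - 1)"
      by (rule geometric_sum[OF x1])
    also have "?x ^ Suc n = exp (\<beta> * t)"
      by (subst exp_of_nat_mult[symmetric]) simp
    also have "exp (- \<beta> * t) * (t / real (Suc n)) * ((exp (\<beta> * t) - 1) / (?x - 1))
       = (exp (- \<beta> * t) * (exp (\<beta> * t) - 1)) * ((t / real (Suc n)) / (?x - 1))"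
      by simp
    also have "exp (- \<beta> * t) * (exp (\<beta> * t) - 1) = 1 - exp (- \<beta> * t)"
      by (simp add: algebra_simps mult_exp_exp)
    finally show ?thesis .
  qed
  have "(\<lambda>n. (t / real (Suc n)) / (exp (\<beta> * t / real (Suc n)) - 1)) \<longlonglongrightarrow> t * (inverse \<beta> * inverse t)"
    using assms by real_asymp
  also have "t * (inverse \<beta> * inverse t) = 1 / \<beta>" using assms by (simp add: field_simps)
  finally have "(\<lambda>n. (t / real (Suc n)) / (exp (\<beta> * t / real (Suc n)) - 1)) \<longlonglongrightarrow> 1 / \<beta>" .
  then have "(\<lambda>n. (1 - exp (- \<beta> * t)) * ((t / real (Suc n)) / (exp (\<beta> * t / real (Suc n)) - 1))) \<longlonglongrightarrow> (1 - exp (- \<beta> * t)) * (1 / \<beta>)"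
    by (rule tendsto_mult[OF tendsto_const])
  then show ?thesis unfolding e by simp
qed

section \<open>Measurability of continuous processes\<close>

lemma floor_grid:
  assumes "0 \<le> (s::real)"
  shows "real (nat \<lfloor>s * real (Suc n)\<rfloor>) / real (Suc n) \<le> s"
    and "(\<lambda>n. real (nat \<lfloor>s * real (Suc n)\<rfloor>) / real (Suc n)) \<longlonglongrightarrow> s"
proof -
  have e: "real (nat \<lfloor>s * real (Suc n)\<rfloor>) = of_int \<lfloor>s * real (Suc n)\<rfloor>" for n
    using assms by simp
  have le: "real (nat \<lfloor>s * real (Suc n)\<rfloor>) / real (Suc n) \<le> s" for n
    unfolding e by (simp add: divide_le_eq del: of_nat_Suc)
  then show "real (nat \<lfloor>s * real (Suc n)\<rfloor>) / real (Suc n) \<le> s" .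
  show "(\<lambda>n. real (nat \<lfloor>s * real (Suc n)\<rfloor>) / real (Suc n)) \<longlonglongrightarrow> s"
  proof (rule tendsto_sandwich[OF _ _ _ tendsto_const])
    show "\<forall>\<^sub>F n in sequentially. s - 1 / real (Suc n) \<le> real (nat \<lfloor>s * real (Suc n)\<rfloor>) / real (Suc n)"
    proof (intro always_eventually allI)
      fix n :: nat
      have "s * real (Suc n) - 1 \<le> of_int \<lfloor>s * real (Suc n)\<rfloor>" by linarith
      then have "(s * real (Suc n) - 1) / real (Suc n) \<le> of_int \<lfloor>s * real (Suc n)\<rfloor> / real (Suc n)" by (rule divide_right_mono) simp
      then show "s - 1 / real (Suc n) \<le> real (nat \<lfloor>s * real (Suc n)\<rfloor>) / real (Suc n)"
        unfolding e by (simp add: diff_divide_distrib del: of_nat_Suc)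
    qed
    show "(\<lambda>n. s - 1 / real (Suc n)) \<longlonglongrightarrow> s" by real_asymp
  qed (use le in auto)
qed

text \<open>The process is a pointwise limit of processes that are constant in time on the cells of a grid.
  Time is clipped at \<open>0\<close> because nothing is known about negative times.\<close>

lemma continuous_process_measurable:
  fixes X :: "real \<Rightarrow> 'a \<Rightarrow> real"
  assumes X: "\<And>t. 0 \<le> t \<Longrightarrow> X t \<in> borel_measurable M"
    and cont: "\<And>\<omega>. \<omega> \<in> space M \<Longrightarrow> continuous_on {0..} (\<lambda>t. X t \<omega>)"
  shows "(\<lambda>p. X (max 0 (fst p)) (snd p)) \<in> borel_measurable (borel \<Otimes>\<^sub>M M)"
proof (rule borel_measurable_LIMSEQ_real)
  define g where "g n p = nat \<lfloor>max 0 (fst p) * real (Suc n)\<rfloor>" for n and p :: "real \<times> 'a"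
  fix n
  have g: "g n \<in> borel \<Otimes>\<^sub>M M \<rightarrow>\<^sub>M count_space UNIV"
    unfolding g_def by measurable
  have X': "(\<lambda>p. X (real i / real (Suc n)) (snd p)) \<in> borel_measurable (borel \<Otimes>\<^sub>M M)" for i
    by (rule measurable_compose[OF measurable_snd X]) simp
  show "(\<lambda>p. X (real (nat \<lfloor>max 0 (fst p) * real (Suc n)\<rfloor>) / real (Suc n)) (snd p)) \<in> borel_measurable (borel \<Otimes>\<^sub>M M)"
    using measurable_compose_countable[OF X' g] unfolding g_def .
next
  fix p :: "real \<times> 'a" assume p: "p \<in> space (borel \<Otimes>\<^sub>M M)"
  let ?s = "max 0 (fst p)"
  have "(\<lambda>n. real (nat \<lfloor>?s * real (Suc n)\<rfloor>) / real (Suc n)) \<longlonglongrightarrow> ?s"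
    by (rule floor_grid(2)) simp
  moreover have "snd p \<in> space M" using p by (auto simp: space_pair_measure)
  ultimately show "(\<lambda>n. X (real (nat \<lfloor>?s * real (Suc n)\<rfloor>) / real (Suc n)) (snd p)) \<longlonglongrightarrow> X ?s (snd p)"
    by (intro continuous_on_tendsto_compose[OF cont]) auto
qed

lemma running_integral_measurable:
  fixes X :: "real \<Rightarrow> 'a \<Rightarrow> real"
  assumes X: "(\<lambda>p. X (max 0 (fst p)) (snd p)) \<in> borel_measurable (borel \<Otimes>\<^sub>M M)"
  shows "(\<lambda>p. LBINT s:{0..fst p}. X s (snd p)) \<in> borel_measurable (borel \<Otimes>\<^sub>M M)"
proof -
  have X'[measurable]: "(\<lambda>z. X (max 0 (snd z)) (snd (fst z))) \<in> borel_measurable ((borel \<Otimes>\<^sub>M M) \<Otimes>\<^sub>M lborel)"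
    using measurable_compose[OF _ X, of "\<lambda>z. (snd z, snd (fst z))" "(borel \<Otimes>\<^sub>M M) \<Otimes>\<^sub>M lborel"] by simp
  have "(\<lambda>p. \<integral>s. (if 0 \<le> s \<and> s \<le> fst p then X (max 0 s) (snd p) else 0) \<partial>lborel) \<in> borel_measurable (borel \<Otimes>\<^sub>M M)"
  proof (rule lborel.borel_measurable_lebesgue_integral)
    have "(\<lambda>z. if 0 \<le> snd z \<and> snd z \<le> fst (fst z) then X (max 0 (snd z)) (snd (fst z)) else 0)
        \<in> borel_measurable ((borel \<Otimes>\<^sub>M M) \<Otimes>\<^sub>M lborel)"
      by measurable
    then show "(\<lambda>(p, s). if 0 \<le> s \<and> s \<le> fst p then X (max 0 s) (snd p) else 0)
        \<in> borel_measurable ((borel \<Otimes>\<^sub>M M) \<Otimes>\<^sub>M lborel)"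
      by (simp add: case_prod_beta)
  qed
  also have "(\<lambda>p. \<integral>s. (if 0 \<le> s \<and> s \<le> fst p then X (max 0 s) (snd p) else 0) \<partial>lborel)
      = (\<lambda>p. LBINT s:{0..fst p}. X s (snd p))"
    unfolding set_lebesgue_integral_def
    by (intro ext Bochner_Integration.integral_cong refl) (auto simp: indicator_def max_def)
  finally show ?thesis .
qed

section \<open>The Gaussian law of the rate and its integral\<close>

locale vasicek = brownian M F W
  for M :: "'a measure" and F :: "ennreal \<Rightarrow> 'a measure" and W :: "real \<Rightarrow> 'a \<Rightarrow> real" +
  fixes \<rho> :: "real \<Rightarrow> real \<Rightarrow> 'a \<Rightarrow> real" and a b \<sigma> :: real
  assumes a_pos: "a > 0" and b_pos: "b > 0" and \<sigma>_pos: "\<sigma> > 0"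
    and solution: "\<And>r. vasicek_solution M F W a b \<sigma> r (\<rho> r)"
begin

lemma rate_measurable: "0 \<le> t \<Longrightarrow> \<rho> r t \<in> borel_measurable M"
  using solution[of r] unfolding vasicek_solution_def adapted_def by (auto intro: measurable_from_F)

lemma rate_continuous: "\<omega> \<in> space M \<Longrightarrow> continuous_on {0..} (\<lambda>t. \<rho> r t \<omega>)"
  using solution[of r] unfolding vasicek_solution_def continuous_paths_def by auto

lemma rate_joint_measurable: "(\<lambda>p. \<rho> r (max 0 (fst p)) (snd p)) \<in> borel_measurable (borel \<Otimes>\<^sub>M M)"
  by (rule continuous_process_measurable[OF rate_measurable rate_continuous])

abbreviation cum_rate :: "real \<Rightarrow> real \<Rightarrow> 'a \<Rightarrow> real" where
  "cum_rate r t \<omega> \<equiv> (LBINT s:{0..t}. \<rho> r s \<omega>)"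

lemma cum_rate_joint_measurable: "(\<lambda>p. cum_rate r (fst p) (snd p)) \<in> borel_measurable (borel \<Otimes>\<^sub>M M)"
  by (rule running_integral_measurable[OF rate_joint_measurable])

lemma cum_rate_measurable: "cum_rate r t \<in> borel_measurable M"
  using measurable_compose[OF measurable_Pair1'[of t borel M] cum_rate_joint_measurable[of r]] by simp

lemma cum_rate_integral:
  assumes "\<omega> \<in> space M" shows "cum_rate r t \<omega> = integral {0..t} (\<lambda>s. \<rho> r s \<omega>)"
  by (rule set_integral_continuous_Icc) (rule continuous_on_subset[OF rate_continuous[OF assms]], auto)

lemma rate_equation:
  "AE \<omega> in M. \<omega> \<in> space M \<and> W 0 \<omega> = 0 \<and>
    (\<forall>t\<ge>0. \<rho> r t \<omega> = r + integral {0..t} (\<lambda>s. a - b * \<rho> r s \<omega>) + \<sigma> * W t \<omega>)"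
proof -
  have "AE \<omega> in M. \<forall>t\<ge>0. \<rho> r t \<omega> = r + (LBINT s:{0..t}. a - b * \<rho> r s \<omega>) + \<sigma> * W t \<omega>"
    using solution[of r] unfolding vasicek_solution_def by auto
  with W_zero AE_space show ?thesis
  proof eventually_elim
    case (elim \<omega>)
    have "(LBINT s:{0..t}. a - b * \<rho> r s \<omega>) = integral {0..t} (\<lambda>s. a - b * \<rho> r s \<omega>)" for t
      by (intro set_integral_continuous_Icc continuous_intros continuous_on_subset[OF rate_continuous[OF elim(2)]]) auto
    then show ?case using elim by simp
  qed
qed

text \<open>The equation at time \<open>0\<close>; it holds almost surely only, since \<open>W 0 = 0\<close> does.\<close>

lemma rate_start: "AE \<omega> in M. \<rho> r 0 \<omega> = r \<and> cum_rate r 0 \<omega> = 0"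
  using rate_equation[of r]
proof eventually_elim
  case (elim \<omega>)
  have I0: "integral {0..0} f = 0" for f :: "real \<Rightarrow> real"
    using integral_refl[of 0 f] by simp
  have "\<rho> r 0 \<omega> = r + integral {0..0} (\<lambda>s. a - b * \<rho> r s \<omega>) + \<sigma> * W 0 \<omega>"
    using elim by blast
  then show ?case
    unfolding cum_rate_integral[OF conjunct1[OF elim]] I0 using elim by simp
qed

text \<open>The path integral \<open>ou_path\<close> of the Brownian motion, written through the rate started at \<open>0\<close>. The
  two agree almost surely, but this version is measurable by adaptedness of the rate.\<close>

definition ou :: "real \<Rightarrow> 'a \<Rightarrow> real" where
  "ou t \<omega> = (\<rho> 0 t \<omega> - a / b * (1 - exp (- b * t))) / \<sigma>"

lemma ou_measurable: "0 \<le> t \<Longrightarrow> ou t \<in> borel_measurable M"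
  unfolding ou_def[abs_def] using rate_measurable[of t 0] by simp

lemma rate_explicit_path:
  "AE \<omega> in M. \<forall>t\<ge>0. \<rho> r t \<omega> = exp (- b * t) * r + a / b * (1 - exp (- b * t)) + \<sigma> * ou_path b (\<lambda>s. W s \<omega>) t
     \<and> cum_rate r t \<omega> = (r + a * t + \<sigma> * W t \<omega> - \<rho> r t \<omega>) / b"
  using rate_equation[of r]
proof eventually_elim
  case (elim \<omega>)
  note c = rate_continuous[of \<omega> r] W_continuous[of \<omega>]
  have "\<rho> r t \<omega> = exp (- b * t) * r + a / b * (1 - exp (- b * t)) + \<sigma> * ou_path b (\<lambda>s. W s \<omega>) t" if "0 \<le> t" for t
    using b_pos elim that
    by (intro vasicek_path_explicit[where T=t and x="\<lambda>t. \<rho> r t \<omega>"] continuous_on_subset[OF c(1)] continuous_on_subset[OF c(2)]) auto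
  moreover have "cum_rate r t \<omega> = (r + a * t + \<sigma> * W t \<omega> - \<rho> r t \<omega>) / b" if "0 \<le> t" for t
    unfolding cum_rate_integral[OF conjunct1[OF elim]] using b_pos elim that
    by (intro vasicek_path_integral[where w="\<lambda>t. W t \<omega>"] continuous_on_subset[OF c(1)]) auto
  ultimately show ?case by blast
qed

lemma ou_eq_path: "AE \<omega> in M. \<forall>t\<ge>0. ou t \<omega> = ou_path b (\<lambda>s. W s \<omega>) t"
  using rate_explicit_path[of 0] by eventually_elim (use \<sigma>_pos in \<open>simp add: ou_def\<close>)

lemma rate_explicit:
  "AE \<omega> in M. \<forall>t\<ge>0. \<rho> r t \<omega> = exp (- b * t) * r + a / b * (1 - exp (- b * t)) + \<sigma> * ou t \<omega>
     \<and> cum_rate r t \<omega> = (r + a * t + \<sigma> * W t \<omega> - \<rho> r t \<omega>) / b"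
  using rate_explicit_path[of r] ou_eq_path by eventually_elim simp

lemma integrable_running_sup_abs:
  assumes "0 \<le> s" "0 \<le> L"
  shows "integrable M (\<lambda>\<omega>. enn2real (running_sup_abs c s L \<omega>))"
    and "AE \<omega> in M. running_sup_abs c s L \<omega> = ennreal (enn2real (running_sup_abs c s L \<omega>))"
proof -
  note m = running_sup_abs_measurable[OF assms, of c]
  have fin: "(\<integral>\<^sup>+\<omega>. running_sup_abs c s L \<omega> \<partial>M) < \<infinity>"
    using nn_integral_running_sup_abs[OF assms, of c] by (rule le_less_trans) simp
  have ae: "AE \<omega> in M. running_sup_abs c s L \<omega> \<noteq> \<infinity>"
    using fin m by (intro nn_integral_PInf_AE) auto
  then show "AE \<omega> in M. running_sup_abs c s L \<omega> = ennreal (enn2real (running_sup_abs c s L \<omega>))"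
    by eventually_elim (simp add: less_top)
  have "(\<integral>\<^sup>+\<omega>. ennreal (enn2real (running_sup_abs c s L \<omega>)) \<partial>M) = (\<integral>\<^sup>+\<omega>. running_sup_abs c s L \<omega> \<partial>M)"
  proof (rule nn_integral_cong_AE)
    show "AE \<omega> in M. ennreal (enn2real (running_sup_abs c s L \<omega>)) = running_sup_abs c s L \<omega>"
      using ae by eventually_elim (simp add: less_top)
  qed
  then show "integrable M (\<lambda>\<omega>. enn2real (running_sup_abs c s L \<omega>))"
    using m fin by (intro integrableI_nonneg) auto
qed

text \<open>One number \<open>S\<close> bounds the oscillation and serves all exponents \<open>c\<close> at the same time: it is
  attained at some time of the interval.\<close>

lemma path_sup_bound:
  assumes \<omega>: "\<omega> \<in> space M" and "0 \<le> k" "0 < L"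
  obtains S where "\<And>s. s \<in> {0..L} \<Longrightarrow> \<bar>W (k + s) \<omega> - W k \<omega>\<bar> \<le> S"
    and "\<And>c. 0 \<le> c \<Longrightarrow> ennreal (exp (c * S)) \<le> running_sup_abs c k L \<omega>"
proof -
  have "continuous_on {0..L} (\<lambda>s. \<bar>W (k + s) \<omega> - W k \<omega>\<bar>)"
    by (intro continuous_intros continuous_on_compose2[OF W_continuous[OF \<omega>]])
      (use assms in \<open>auto intro!: continuous_intros\<close>)
  then obtain s where s: "s \<in> {0..L}" "\<And>u. u \<in> {0..L} \<Longrightarrow> \<bar>W (k + u) \<omega> - W k \<omega>\<bar> \<le> \<bar>W (k + s) \<omega> - W k \<omega>\<bar>"
    using continuous_attains_sup[of "{0..L}" "\<lambda>s. \<bar>W (k + s) \<omega> - W k \<omega>\<bar>"] assms by auto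
  show thesis
    by (rule that[of "\<bar>W (k + s) \<omega> - W k \<omega>\<bar>"]) (use s assms in \<open>auto intro!: exp_abs_le_running_sup_abs\<close>)
qed

text \<open>The pair \<open>(W\<^sub>t, Y\<^sub>t)\<close> has the exponential moments of a Gaussian vector with variances \<open>t\<close> and
  \<open>(1 - e\<^sup>-\<^sup>2\<^sup>b\<^sup>t) / (2 b)\<close> and covariance \<open>(1 - e\<^sup>-\<^sup>b\<^sup>t) / b\<close>. A linear combination of the two is a limit of
  discrete Wiener integrals, and the maximal inequality supplies a common integrable bound for their
  exponentials.\<close>

lemma
  fixes A :: real and B :: complex
  assumes t: "0 < t"
  shows integrable_joint_cexp: "integrable M (\<lambda>\<omega>. exp (of_real (A * W t \<omega>) + B * of_real (ou t \<omega>)))" (is ?int)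
    and integral_joint_cexp: "(\<integral>\<omega>. exp (of_real (A * W t \<omega>) + B * of_real (ou t \<omega>)) \<partial>M)
      = exp ((of_real (A\<^sup>2 * t) + of_real (2 * A * ((1 - exp (- b * t)) / b)) * B
          + of_real ((1 - exp (- (2 * b) * t)) / (2 * b)) * B\<^sup>2) / 2)" (is "?eq")
proof -
  define N where "N n = Suc n" for n
  define \<tau> where "\<tau> n k = real k * t / real (N n)" for n k
  define e where "e n k = exp (- b * (t - \<tau> n k))" for n k
  define f where "f n \<omega> = exp (\<Sum>k<N n. (of_real A + B * of_real (e n k)) * of_real (W (\<tau> n (Suc k)) \<omega> - W (\<tau> n k) \<omega>))" for n \<omega>
  define C where "C = \<bar>A\<bar> + 2 * norm B"
  have inc: "incseq (\<tau> n)" and \<tau>0: "0 \<le> \<tau> n 0" for n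
    using t by (auto simp: incseq_def \<tau>_def intro!: divide_right_mono mult_right_mono)
  have \<tau>N: "\<tau> n (N n) = t" "\<tau> n 0 = 0" for n by (auto simp: \<tau>_def N_def)
  have fsum: "(\<Sum>k<N n. (of_real A + B * of_real (e n k)) * of_real (W (\<tau> n (Suc k)) \<omega> - W (\<tau> n k) \<omega>))
     = of_real (A * (W t \<omega> - W 0 \<omega>)) + B * of_real (wiener_sum b (\<lambda>s. W s \<omega>) t (N n))" for n \<omega>
  proof -
    have "(\<Sum>k<N n. W (\<tau> n (Suc k)) \<omega> - W (\<tau> n k) \<omega>) = W t \<omega> - W 0 \<omega>"
      by (subst sum_lessThan_telescope) (simp add: \<tau>N)
    moreover have "wiener_sum b (\<lambda>s. W s \<omega>) t (N n) = (\<Sum>k<N n. e n k * (W (\<tau> n (Suc k)) \<omega> - W (\<tau> n k) \<omega>))"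
      unfolding wiener_sum_def e_def \<tau>_def ..
    moreover have "(\<Sum>k<N n. (of_real A + B * of_real (e n k)) * of_real (W (\<tau> n (Suc k)) \<omega> - W (\<tau> n k) \<omega>))
      = of_real (A * (\<Sum>k<N n. W (\<tau> n (Suc k)) \<omega> - W (\<tau> n k) \<omega>)) + B * of_real (\<Sum>k<N n. e n k * (W (\<tau> n (Suc k)) \<omega> - W (\<tau> n k) \<omega>))"
      unfolding of_real_mult of_real_sum sum_distrib_left sum.distrib[symmetric]
      by (intro sum.cong refl) (simp add: algebra_simps)
    ultimately show ?thesis by simp
  qed
  have lim: "AE \<omega> in M. (\<lambda>n. f n \<omega>) \<longlonglongrightarrow> exp (of_real (A * W t \<omega>) + B * of_real (ou t \<omega>))"
    using ou_eq_path W_zero AE_space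
  proof eventually_elim
    case (elim \<omega>)
    have "(\<lambda>n. wiener_sum b (\<lambda>s. W s \<omega>) t (N n)) \<longlonglongrightarrow> ou t \<omega>"
      using wiener_sum_converges[OF b_pos t W_continuous[OF elim(3)] elim(2)] elim(1) t by (simp add: N_def)
    then show ?case
      unfolding f_def fsum elim(2) by (intro tendsto_intros) simp
  qed
  have bound: "AE \<omega> in M. norm (f n \<omega>) \<le> enn2real (running_sup_abs C 0 t \<omega>)" for n
    using W_zero AE_space integrable_running_sup_abs(2)[OF order_refl less_imp_le[OF t], of C]
  proof eventually_elim
    case (elim \<omega>)
    obtain S where S: "\<And>s. s \<in> {0..t} \<Longrightarrow> \<bar>W (0 + s) \<omega> - W 0 \<omega>\<bar> \<le> S"
      and R: "\<And>c. 0 \<le> c \<Longrightarrow> ennreal (exp (c * S)) \<le> running_sup_abs c 0 t \<omega>"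
      using path_sup_bound[OF elim(2) order_refl t] by blast
    let ?w = "wiener_sum b (\<lambda>s. W s \<omega>) t (N n)"
    have w: "\<bar>?w\<bar> \<le> 2 * S"
      using b_pos t elim(1) S by (intro wiener_sum_bound) (auto simp: N_def)
    have Wt: "\<bar>W t \<omega>\<bar> \<le> S" using S[of t] t elim(1) by simp
    \<comment> \<open>Both parts of the exponent are bounded by multiples of the largest value of \<open>|W|\<close>.\<close>
    have "A * W t \<omega> \<le> \<bar>A\<bar> * \<bar>W t \<omega>\<bar>" using abs_ge_self[of "A * W t \<omega>"] by (simp add: abs_mult)
    also have "\<dots> \<le> \<bar>A\<bar> * S" using Wt by (intro mult_left_mono) auto
    finally have 1: "A * W t \<omega> \<le> \<bar>A\<bar> * S" .
    have "Re B * ?w \<le> \<bar>Re B\<bar> * \<bar>?w\<bar>" using abs_ge_self[of "Re B * ?w"] by (simp add: abs_mult)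
    also have "\<dots> \<le> norm B * (2 * S)" using w by (intro mult_mono abs_Re_le_cmod) auto
    finally have "A * W t \<omega> + Re B * ?w \<le> \<bar>A\<bar> * S + norm B * (2 * S)" using 1 by linarith
    also have "\<dots> = C * S" by (simp add: C_def algebra_simps)
    finally have "norm (f n \<omega>) \<le> exp (C * S)"
      unfolding f_def fsum by (simp add: elim(1))
    also have "exp (C * S) \<le> enn2real (running_sup_abs C 0 t \<omega>)"
    proof -
      have "0 \<le> C" by (simp add: C_def)
      from R[OF this] have "ennreal (exp (C * S)) \<le> ennreal (enn2real (running_sup_abs C 0 t \<omega>))"
        by (rule ord_le_eq_trans[OF _ elim(3)])
      then show ?thesis by (rule iffD1[OF ennreal_le_iff[OF enn2real_nonneg]])
    qed
    finally show ?case .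
  qed
  have fm: "f n \<in> borel_measurable M" for n
    using discrete_wiener_cexp[OF inc[of n] \<tau>0[of n], where z="\<lambda>k. of_real A + B * of_real (e n k)" and n="N n"] unfolding f_def[abs_def] by (blast intro: measurable_from_F)
  have [measurable]: "W t \<in> borel_measurable M" "ou t \<in> borel_measurable M"
    using t by (auto intro: W_measurable ou_measurable)
  have gm: "(\<lambda>\<omega>. exp (of_real (A * W t \<omega>) + B * of_real (ou t \<omega>))) \<in> borel_measurable M"
    by measurable
  note dom = integral_dominated_convergence[OF gm fm integrable_running_sup_abs(1)[OF order_refl less_imp_le[OF t]] lim bound]
  show ?int
    by (rule integrable_dominated_convergence[OF gm fm integrable_running_sup_abs(1)[OF order_refl less_imp_le[OF t]] lim bound])
  have Ef: "(\<integral>\<omega>. f n \<omega> \<partial>M) = exp ((of_real (A\<^sup>2 * t) + of_real (2 * A * (\<Sum>k<N n. e n k * (t / real (N n)))) * B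
      + of_real (\<Sum>k<N n. exp (- (2 * b) * (t - \<tau> n k)) * (t / real (N n))) * B\<^sup>2) / 2)" for n
  proof -
    have d: "\<tau> n (Suc k) - \<tau> n k = t / real (N n)" for k
      by (simp add: \<tau>_def diff_divide_distrib[symmetric] algebra_simps)
    have e2: "exp (- (2 * b) * (t - \<tau> n k)) = (e n k)\<^sup>2" for k
      by (simp add: e_def power2_eq_square mult_exp_exp)
    have At: "A\<^sup>2 * t = (\<Sum>k<N n. A\<^sup>2 * (t / real (N n)))"
      by (simp add: N_def)
    have "(\<integral>\<omega>. f n \<omega> \<partial>M) = exp (\<Sum>k<N n. (of_real A + B * of_real (e n k))\<^sup>2 * of_real (t / real (N n)) / 2)"
      using discrete_wiener_cexp[OF inc[of n] \<tau>0[of n], where z="\<lambda>k. of_real A + B * of_real (e n k)" and n="N n"] unfolding f_def[abs_def] d by blast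
    also have "(\<Sum>k<N n. (of_real A + B * of_real (e n k))\<^sup>2 * of_real (t / real (N n)) / 2)
      = (of_real (A\<^sup>2 * t) + of_real (2 * A * (\<Sum>k<N n. e n k * (t / real (N n)))) * B
      + of_real (\<Sum>k<N n. exp (- (2 * b) * (t - \<tau> n k)) * (t / real (N n))) * B\<^sup>2) / 2"
      unfolding At e2 of_real_mult of_real_sum sum_distrib_left sum_distrib_right sum.distrib[symmetric] sum_divide_distrib
      by (intro sum.cong refl) (simp add: power2_eq_square algebra_simps)
    finally show ?thesis .
  qed
  have l1: "(\<lambda>n. \<Sum>k<N n. e n k * (t / real (N n))) \<longlonglongrightarrow> (1 - exp (- b * t)) / b"
    using exp_riemann_sum_converges[OF b_pos t] by (simp only: e_def \<tau>_def N_def)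
  have l2: "(\<lambda>n. \<Sum>k<N n. exp (- (2 * b) * (t - \<tau> n k)) * (t / real (N n))) \<longlonglongrightarrow> (1 - exp (- (2 * b) * t)) / (2 * b)"
    using exp_riemann_sum_converges[of "2 * b" t] b_pos t by (simp only: \<tau>_def N_def mult_pos_pos zero_less_numeral)
  have "(\<lambda>n. \<integral>\<omega>. f n \<omega> \<partial>M) \<longlonglongrightarrow> exp ((of_real (A\<^sup>2 * t) + of_real (2 * A * ((1 - exp (- b * t)) / b)) * B
          + of_real ((1 - exp (- (2 * b) * t)) / (2 * b)) * B\<^sup>2) / 2)"
    unfolding Ef by (intro tendsto_intros l1 l2) simp
  with dom show ?eq by (rule LIMSEQ_unique)
qed

lemma
  fixes A B t :: real
  defines "G \<equiv> exp ((A\<^sup>2 * t + 2 * A * ((1 - exp (- b * t)) / b) * B + (1 - exp (- (2 * b) * t)) / (2 * b) * B\<^sup>2) / 2)"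
  assumes t: "0 < t"
  shows integrable_joint_exp: "integrable M (\<lambda>\<omega>. exp (A * W t \<omega> + B * ou t \<omega>))" (is ?int)
    and integral_joint_exp: "(\<integral>\<omega>. exp (A * W t \<omega> + B * ou t \<omega>) \<partial>M) = G" (is "?eq")
proof -
  have e: "exp (of_real (A * W t \<omega>) + of_real B * of_real (ou t \<omega>)) = complex_of_real (exp (A * W t \<omega> + B * ou t \<omega>))" for \<omega>
    by (simp flip: exp_of_real)
  show ?int
    using integrable_joint_cexp[OF t, of A "of_real B"] unfolding e complex_of_real_integrable_eq .
  have "complex_of_real (\<integral>\<omega>. exp (A * W t \<omega> + B * ou t \<omega>) \<partial>M) = of_real G"
    using integral_joint_cexp[OF t, of A "of_real B"] unfolding e integral_complex_of_real G_def
    by (simp flip: exp_of_real)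
  then show ?eq by (simp only: of_real_eq_iff)
qed

text \<open>A Girsanov transformation for the fixed time \<open>t\<close>: the tilted law stays Gaussian with the same
  variance, and its mean is the covariance of \<open>Y\<^sub>t\<close> with \<open>A W\<^sub>t + B Y\<^sub>t\<close>. Complex exponents give the
  characteristic function under the tilt, so that one-dimensional uniqueness is enough.\<close>

lemma ou_law_tilted:
  fixes A B t :: real
  defines "G \<equiv> exp ((A\<^sup>2 * t + 2 * A * ((1 - exp (- b * t)) / b) * B + (1 - exp (- (2 * b) * t)) / (2 * b) * B\<^sup>2) / 2)"
    and "m \<equiv> A * ((1 - exp (- b * t)) / b) + (1 - exp (- (2 * b) * t)) / (2 * b) * B"
    and "s \<equiv> sqrt ((1 - exp (- (2 * b) * t)) / (2 * b))"
  assumes t: "0 < t"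
  shows "distr (density M (\<lambda>\<omega>. ennreal (exp (A * W t \<omega> + B * ou t \<omega>) / G))) borel (ou t)
    = distr gauss borel (\<lambda>x. m + s * x)" (is "?P = _")
proof (rule gaussian_law_of_char)
  have [measurable]: "W t \<in> borel_measurable M" "ou t \<in> borel_measurable M"
    using t by (auto intro: W_measurable ou_measurable)
  let ?D = "\<lambda>\<omega>. exp (A * W t \<omega> + B * ou t \<omega>) / G"
  have G: "G > 0" by (simp add: G_def)
  have D: "integrable M ?D" "(\<integral>\<omega>. ?D \<omega> \<partial>M) = 1"
    using integrable_joint_exp[OF t, of A B] integral_joint_exp[OF t, of A B] G
    unfolding G_def[symmetric] by auto
  have "emeasure (density M (\<lambda>\<omega>. ennreal (?D \<omega>))) (space M) = (\<integral>\<^sup>+\<omega>. ennreal (?D \<omega>) \<partial>M)"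
    by (subst emeasure_density) (auto intro!: nn_integral_cong)
  also have "\<dots> = 1"
    using nn_integral_eq_integral[OF D(1)] G D(2) by simp
  finally have "prob_space (density M (\<lambda>\<omega>. ennreal (?D \<omega>)))"
    by (intro prob_spaceI) simp
  then show "real_distribution ?P"
    by (rule prob_space.real_distribution_distr) simp
  fix u
  let ?v = "(1 - exp (- (2 * b) * t)) / (2 * b)"
  have v: "s\<^sup>2 = ?v"
    using b_pos t unfolding s_def by (intro real_sqrt_pow2 divide_nonneg_pos) auto
  have "char ?P u = (\<integral>\<omega>. ?D \<omega> *\<^sub>R exp (\<i> * of_real (u * ou t \<omega>)) \<partial>M)"
    unfolding char_def using G by (subst integral_distr) (auto simp: integral_density)
  also have "\<dots> = (\<integral>\<omega>. inverse (of_real G) * exp (of_real (A * W t \<omega>) + (of_real B + \<i> * of_real u) * of_real (ou t \<omega>)) \<partial>M)"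
    by (intro Bochner_Integration.integral_cong refl)
      (simp add: scaleR_conv_of_real exp_add exp_of_real[symmetric] field_simps)
  also have "\<dots> = inverse (of_real G) * exp ((of_real (A\<^sup>2 * t) + of_real (2 * A * ((1 - exp (- b * t)) / b)) * (of_real B + \<i> * of_real u)
          + of_real ?v * (of_real B + \<i> * of_real u)\<^sup>2) / 2)"
    unfolding integral_mult_right_zero integral_joint_cexp[OF t] ..
  also have "inverse (of_real G) = exp (complex_of_real (- ((A\<^sup>2 * t + 2 * A * ((1 - exp (- b * t)) / b) * B + ?v * B\<^sup>2) / 2)))"
    unfolding G_def exp_minus[symmetric] exp_of_real[symmetric] of_real_minus ..
  also have "exp (complex_of_real (- ((A\<^sup>2 * t + 2 * A * ((1 - exp (- b * t)) / b) * B + ?v * B\<^sup>2) / 2)))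
     * exp ((of_real (A\<^sup>2 * t) + of_real (2 * A * ((1 - exp (- b * t)) / b)) * (of_real B + \<i> * of_real u)
          + of_real ?v * (of_real B + \<i> * of_real u)\<^sup>2) / 2)
     = exp (\<i> * of_real (u * m) - of_real (u\<^sup>2 * s\<^sup>2 / 2))"
  proof -
    have "- ((p + q * B + v * B\<^sup>2) / 2) + (p + q * (B + \<i> * U) + v * (B + \<i> * U)\<^sup>2) / 2
       = \<i> * (U * (q / 2 + v * B)) - U\<^sup>2 * v / 2" for p q v B U :: complex
      by (simp add: power2_eq_square field_simps)
    from this[of "of_real (A\<^sup>2 * t)" "of_real (2 * A * ((1 - exp (- b * t)) / b))" "of_real B" "of_real ?v" "of_real u"]
    show ?thesis
      unfolding mult_exp_exp v m_def by (intro arg_cong[where f=exp]) simp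
  qed
  finally show "char ?P u = exp (\<i> * of_real (u * m) - of_real (u\<^sup>2 * s\<^sup>2 / 2))" .
qed

subsection \<open>The Feynman-Kac kernel\<close>

definition decay :: "real \<Rightarrow> real" where
  "decay t = exp (- b * t)"

text \<open>The mean of \<open>r\<^sub>t\<close> under the density proportional to \<open>exp (\<theta> \<integral>r)\<close>, for the rate started at \<open>0\<close>;
  \<open>rate_sd\<close> is its standard deviation, which the density does not change, and \<open>log_mass\<close> is the
  logarithm of the total mass of \<open>exp (\<theta> \<integral>r)\<close>.\<close>

definition tilted_mean :: "real \<Rightarrow> real \<Rightarrow> real" where
  "tilted_mean \<theta> t = a / b * (1 - decay t) + \<theta> * \<sigma>\<^sup>2 * (1 - decay t)\<^sup>2 / (2 * b\<^sup>2)"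

definition rate_sd :: "real \<Rightarrow> real" where
  "rate_sd t = \<sigma> * sqrt ((1 - (decay t)\<^sup>2) / (2 * b))"

definition log_mass :: "real \<Rightarrow> real \<Rightarrow> real" where
  "log_mass \<theta> t = \<theta> * (a / b) * (t - (1 - decay t) / b)
    + \<theta>\<^sup>2 * \<sigma>\<^sup>2 / (2 * b\<^sup>2) * (t - 2 * (1 - decay t) / b + (1 - (decay t)\<^sup>2) / (2 * b))"

lemma decay_0 [simp]: "decay 0 = 1" by (simp add: decay_def)

lemma decay_pos [simp]: "0 < decay t" by (simp add: decay_def)

lemma decay_nonneg [simp]: "0 \<le> decay t" by (simp add: decay_def)

lemma decay_le_1: "0 \<le> t \<Longrightarrow> decay t \<le> 1"
  using b_pos by (simp add: decay_def)

lemma decay_add: "decay (s + t) = decay s * decay t"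
  by (simp add: decay_def mult_exp_exp algebra_simps)

lemma rate_sd_nonneg: "0 \<le> t \<Longrightarrow> 0 \<le> rate_sd t"
  using \<sigma>_pos b_pos decay_le_1[of t] unfolding rate_sd_def
  by (intro mult_nonneg_nonneg real_sqrt_ge_zero divide_nonneg_pos) (auto simp: power_le_one less_imp_le)

lemma rate_sd_square: "0 \<le> t \<Longrightarrow> (rate_sd t)\<^sup>2 = \<sigma>\<^sup>2 * (1 - (decay t)\<^sup>2) / (2 * b)"
  using b_pos decay_le_1[of t] unfolding rate_sd_def power_mult_distrib
  by (subst real_sqrt_pow2) (auto simp: power_le_one less_imp_le)

text \<open>The exponent \<open>\<theta> \<integral>r\<close> is affine in \<open>W\<^sub>t - Y\<^sub>t\<close>, so the tilt is the one with \<open>A = \<theta> \<sigma> / b\<close> and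
  \<open>B = - A\<close>.\<close>

lemma nn_integral_kernel:
  assumes [measurable]: "\<phi> \<in> borel_measurable borel" and t: "0 \<le> t"
  shows "(\<integral>\<^sup>+\<omega>. \<phi> (\<rho> r t \<omega>) * ennreal (exp (\<theta> * cum_rate r t \<omega>)) \<partial>M)
    = ennreal (exp (\<theta> * r * (1 - decay t) / b + log_mass \<theta> t)) *
      (\<integral>\<^sup>+x. \<phi> (decay t * r + tilted_mean \<theta> t + rate_sd t * x) \<partial>gauss)"
proof (cases "t = 0")
  case True
  have "(\<integral>\<^sup>+\<omega>. \<phi> (\<rho> r t \<omega>) * ennreal (exp (\<theta> * cum_rate r t \<omega>)) \<partial>M) = (\<integral>\<^sup>+\<omega>. \<phi> r \<partial>M)"
  proof (rule nn_integral_cong_AE)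
    show "AE \<omega> in M. \<phi> (\<rho> r t \<omega>) * ennreal (exp (\<theta> * cum_rate r t \<omega>)) = \<phi> r"
      using rate_start[of r] unfolding True by eventually_elim simp
  qed
  also have "\<dots> = \<phi> r" by (simp add: emeasure_space_1)
  also have "\<dots> = (\<integral>\<^sup>+x. \<phi> r \<partial>gauss)"
    by (simp only: nn_integral_const prob_space.emeasure_space_1[OF prob_space_std_normal] mult_1_right)
  finally show ?thesis
    using True by (simp add: log_mass_def tilted_mean_def rate_sd_def)
next
  case False
  then have t: "0 < t" using t by simp
  have [measurable]: "W t \<in> borel_measurable M" "ou t \<in> borel_measurable M"
    using t by (auto intro: W_measurable ou_measurable)
  define A where "A = \<theta> * \<sigma> / b"
  let ?q = "decay t"
  define v where "v = (1 - exp (- (2 * b) * t)) / (2 * b)"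
  have v: "v = (1 - ?q\<^sup>2) / (2 * b)"
    by (simp add: v_def decay_def power2_eq_square mult_exp_exp)
  define G where "G = exp ((A\<^sup>2 * t + 2 * A * ((1 - exp (- b * t)) / b) * (- A) + (1 - exp (- (2 * b) * t)) / (2 * b) * (- A)\<^sup>2) / 2)"
  define m where "m = A * ((1 - exp (- b * t)) / b) + (1 - exp (- (2 * b) * t)) / (2 * b) * (- A)"
  define L where "L = \<theta> * r * (1 - ?q) / b + \<theta> * (a / b) * (t - (1 - ?q) / b)"
  have G0: "0 < G" by (simp add: G_def)
  note law = ou_law_tilted[OF t, of A "- A", folded G_def m_def, folded v_def]
  let ?D = "\<lambda>\<omega>. exp (A * W t \<omega> + - A * ou t \<omega>) / G"
  let ?f = "\<lambda>y. \<phi> (?q * r + a / b * (1 - ?q) + \<sigma> * y)"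
  have "(\<integral>\<^sup>+\<omega>. \<phi> (\<rho> r t \<omega>) * ennreal (exp (\<theta> * cum_rate r t \<omega>)) \<partial>M)
      = (\<integral>\<^sup>+\<omega>. ennreal (exp L * G) * (ennreal (?D \<omega>) * ?f (ou t \<omega>)) \<partial>M)"
  proof (rule nn_integral_cong_AE)
    show "AE \<omega> in M. \<phi> (\<rho> r t \<omega>) * ennreal (exp (\<theta> * cum_rate r t \<omega>))
        = ennreal (exp L * G) * (ennreal (?D \<omega>) * ?f (ou t \<omega>))"
      using rate_explicit[of r]
    proof eventually_elim
      case (elim \<omega>)
      then have r: "\<rho> r t \<omega> = ?q * r + a / b * (1 - ?q) + \<sigma> * ou t \<omega>"
        and c: "cum_rate r t \<omega> = (r + a * t + \<sigma> * W t \<omega> - \<rho> r t \<omega>) / b"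
        using t by (auto simp: decay_def)
      have "\<theta> * cum_rate r t \<omega> = L + (A * W t \<omega> + - A * ou t \<omega>)"
        unfolding c r L_def A_def using b_pos by (simp add: field_simps)
      then have "exp (\<theta> * cum_rate r t \<omega>) = (exp L * G) * ?D \<omega>"
        using G0 by (simp add: exp_add)
      then have "ennreal (exp (\<theta> * cum_rate r t \<omega>)) = ennreal (exp L * G) * ennreal (?D \<omega>)"
        using G0 by (simp only:) (rule ennreal_mult, auto)
      then show ?case unfolding r by (simp add: mult_ac)
    qed
  qed
  also have "\<dots> = ennreal (exp L * G) * (\<integral>\<^sup>+\<omega>. ennreal (?D \<omega>) * ?f (ou t \<omega>) \<partial>M)"
    by (rule nn_integral_cmult) measurable
  also have "(\<integral>\<^sup>+\<omega>. ennreal (?D \<omega>) * ?f (ou t \<omega>) \<partial>M)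
      = (\<integral>\<^sup>+y. ?f y \<partial>distr (density M (\<lambda>\<omega>. ennreal (?D \<omega>))) borel (ou t))"
    by (subst nn_integral_distr) (auto simp: nn_integral_density)
  also have "\<dots> = (\<integral>\<^sup>+x. ?f (m + sqrt v * x) \<partial>gauss)"
    unfolding law by (subst nn_integral_distr) auto
  also have "(\<lambda>x. ?f (m + sqrt v * x)) = (\<lambda>x. \<phi> (?q * r + tilted_mean \<theta> t + rate_sd t * x))"
  proof
    fix x
    have me: "m = A * ((1 - ?q)\<^sup>2 / (2 * b))"
      unfolding m_def v_def[symmetric] v decay_def[symmetric] using b_pos
      by (simp add: field_simps power2_eq_square)
    have "\<sigma> * m = \<theta> * \<sigma>\<^sup>2 * (1 - ?q)\<^sup>2 / (2 * b\<^sup>2)"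
      unfolding me A_def using b_pos by (simp add: power2_eq_square mult_ac)
    then show "?f (m + sqrt v * x) = \<phi> (?q * r + tilted_mean \<theta> t + rate_sd t * x)"
      by (simp add: tilted_mean_def rate_sd_def v algebra_simps)
  qed
  also have "exp L * G = exp (\<theta> * r * (1 - ?q) / b + log_mass \<theta> t)"
  proof -
    have "(A\<^sup>2 * t + 2 * A * ((1 - ?q) / b) * (- A) + (1 - ?q\<^sup>2) / (2 * b) * (- A)\<^sup>2) / 2
        = A\<^sup>2 / 2 * (t - 2 * (1 - ?q) / b + (1 - ?q\<^sup>2) / (2 * b))"
      by (simp add: power2_eq_square algebra_simps add_divide_distrib diff_divide_distrib)
    also have "A\<^sup>2 / 2 = \<theta>\<^sup>2 * \<sigma>\<^sup>2 / (2 * b\<^sup>2)"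
      by (simp add: A_def power_divide power_mult_distrib)
    finally show ?thesis
      unfolding G_def v_def[symmetric] v decay_def[symmetric] mult_exp_exp
      by (simp add: L_def log_mass_def)
  qed
  finally show ?thesis .
qed

lemma kernel_law:
  assumes t: "0 \<le> t"
  shows "distr (density M (\<lambda>\<omega>. ennreal (exp (\<theta> * cum_rate r t \<omega> - (\<theta> * r * (1 - decay t) / b + log_mass \<theta> t))))) borel (\<rho> r t)
    = distr gauss borel (\<lambda>x. decay t * r + tilted_mean \<theta> t + rate_sd t * x)" (is "?l = ?r")
proof (rule measure_eqI)
  have [measurable]: "\<rho> r t \<in> borel_measurable M" "cum_rate r t \<in> borel_measurable M"
    using rate_measurable[OF t] cum_rate_measurable by auto
  let ?K = "\<theta> * r * (1 - decay t) / b + log_mass \<theta> t"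
  fix S assume "S \<in> sets ?l"
  then have [measurable]: "S \<in> sets borel" by simp
  have "emeasure ?l S = (\<integral>\<^sup>+y. indicator S y \<partial>?l)" by simp
  also have "\<dots> = (\<integral>\<^sup>+\<omega>. ennreal (exp (\<theta> * cum_rate r t \<omega> - ?K)) * indicator S (\<rho> r t \<omega>) \<partial>M)"
    by (subst nn_integral_distr) (auto simp: nn_integral_density)
  also have "\<dots> = (\<integral>\<^sup>+\<omega>. ennreal (exp (- ?K)) * (indicator S (\<rho> r t \<omega>) * ennreal (exp (\<theta> * cum_rate r t \<omega>))) \<partial>M)"
  proof (rule nn_integral_cong)
    fix \<omega>
    have "exp (\<theta> * cum_rate r t \<omega> - ?K) = exp (- ?K) * exp (\<theta> * cum_rate r t \<omega>)"
      unfolding mult_exp_exp by (rule arg_cong[where f=exp]) simp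
    then have "ennreal (exp (\<theta> * cum_rate r t \<omega> - ?K)) = ennreal (exp (- ?K)) * ennreal (exp (\<theta> * cum_rate r t \<omega>))"
      by (simp only: ennreal_mult exp_ge_zero)
    then show "ennreal (exp (\<theta> * cum_rate r t \<omega> - ?K)) * indicator S (\<rho> r t \<omega>)
       = ennreal (exp (- ?K)) * (indicator S (\<rho> r t \<omega>) * ennreal (exp (\<theta> * cum_rate r t \<omega>)))"
      by (simp only: mult_ac)
  qed
  also have "\<dots> = ennreal (exp (- ?K)) * (\<integral>\<^sup>+\<omega>. indicator S (\<rho> r t \<omega>) * ennreal (exp (\<theta> * cum_rate r t \<omega>)) \<partial>M)"
    by (rule nn_integral_cmult) measurable
  also have "\<dots> = (ennreal (exp (- ?K)) * ennreal (exp ?K)) *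
      (\<integral>\<^sup>+x. indicator S (decay t * r + tilted_mean \<theta> t + rate_sd t * x) \<partial>gauss)"
  proof -
    have "(\<integral>\<^sup>+\<omega>. indicator S (\<rho> r t \<omega>) * ennreal (exp (\<theta> * cum_rate r t \<omega>)) \<partial>M)
      = ennreal (exp ?K) * (\<integral>\<^sup>+x. indicator S (decay t * r + tilted_mean \<theta> t + rate_sd t * x) \<partial>gauss)"
      by (rule nn_integral_kernel[OF _ t]) simp
    then show ?thesis by (simp only: mult.assoc)
  qed
  also have "ennreal (exp (- ?K)) * ennreal (exp ?K) = 1"
    by (simp only: ennreal_mult[symmetric] exp_ge_zero mult_exp_exp) simp
  also have "1 * (\<integral>\<^sup>+x. indicator S (decay t * r + tilted_mean \<theta> t + rate_sd t * x) \<partial>gauss)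
      = (\<integral>\<^sup>+y. indicator S y \<partial>?r)"
    by (subst nn_integral_distr) auto
  also have "\<dots> = emeasure ?r S" by simp
  finally show "emeasure ?l S = emeasure ?r S" .
qed simp

lemma
  fixes \<phi> :: "real \<Rightarrow> real"
  assumes \<phi>[measurable]: "\<phi> \<in> borel_measurable borel" and t: "0 \<le> t"
  shows integrable_kernel:
      "integrable M (\<lambda>\<omega>. \<phi> (\<rho> r t \<omega>) * exp (\<theta> * cum_rate r t \<omega>))
      \<longleftrightarrow> integrable gauss (\<lambda>x. \<phi> (decay t * r + tilted_mean \<theta> t + rate_sd t * x))" (is ?int)
    and integral_kernel: "(\<integral>\<omega>. \<phi> (\<rho> r t \<omega>) * exp (\<theta> * cum_rate r t \<omega>) \<partial>M)
      = exp (\<theta> * r * (1 - decay t) / b + log_mass \<theta> t) *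
        (\<integral>x. \<phi> (decay t * r + tilted_mean \<theta> t + rate_sd t * x) \<partial>gauss)" (is ?eq)
proof -
  have [measurable]: "\<rho> r t \<in> borel_measurable M" "cum_rate r t \<in> borel_measurable M"
    using rate_measurable[OF t] cum_rate_measurable by auto
  let ?K = "\<theta> * r * (1 - decay t) / b + log_mass \<theta> t"
  let ?D = "\<lambda>\<omega>. exp (\<theta> * cum_rate r t \<omega> - ?K)"
  let ?P = "distr (density M (\<lambda>\<omega>. ennreal (?D \<omega>))) borel (\<rho> r t)"
  have e: "\<phi> (\<rho> r t \<omega>) * exp (\<theta> * cum_rate r t \<omega>) = exp ?K * (?D \<omega> * \<phi> (\<rho> r t \<omega>))" for \<omega>
    by (simp add: exp_diff)
  have i1: "integrable ?P \<phi> \<longleftrightarrow> integrable M (\<lambda>\<omega>. ?D \<omega> * \<phi> (\<rho> r t \<omega>))"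
    by (subst integrable_distr_eq) (auto simp: integrable_density)
  have I1: "(\<integral>y. \<phi> y \<partial>?P) = (\<integral>\<omega>. ?D \<omega> * \<phi> (\<rho> r t \<omega>) \<partial>M)"
    by (subst integral_distr) (auto simp: integral_density)
  have i2: "integrable ?P \<phi> \<longleftrightarrow> integrable gauss (\<lambda>x. \<phi> (decay t * r + tilted_mean \<theta> t + rate_sd t * x))"
    unfolding kernel_law[OF t] by (subst integrable_distr_eq) auto
  have I2: "(\<integral>y. \<phi> y \<partial>?P) = (\<integral>x. \<phi> (decay t * r + tilted_mean \<theta> t + rate_sd t * x) \<partial>gauss)"
    unfolding kernel_law[OF t] by (subst integral_distr) auto
  show ?int unfolding e i2[symmetric] i1 by simp
  show ?eq unfolding e I2[symmetric] I1 by simp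
qed

end

section \<open>The weighted space\<close>

text \<open>The filter at infinity of a normed space has a countable base.\<close>

lemma tendsto_at_infinity_sequentiallyI:
  fixes f :: "'b :: real_normed_vector \<Rightarrow> 'c :: topological_space"
  assumes "\<And>x. filterlim x at_infinity sequentially \<Longrightarrow> (\<lambda>n. f (x n)) \<longlonglongrightarrow> l"
  shows "(f \<longlongrightarrow> l) at_infinity"
proof (rule ccontr)
  assume "\<not> ?thesis"
  then obtain S where S: "open S" "l \<in> S" "\<not> eventually (\<lambda>x. f x \<in> S) at_infinity"
    unfolding tendsto_def by blast
  then have "\<forall>n::nat. \<exists>x. real n \<le> norm x \<and> f x \<notin> S"
    unfolding eventually_at_infinity by blast
  then obtain x where x: "\<And>n::nat. real n \<le> norm (x n)" "\<And>n. f (x n) \<notin> S" by metis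
  have "filterlim (\<lambda>n. norm (x n)) at_top sequentially"
    by (rule filterlim_at_top_mono[OF filterlim_real_sequentially]) (use x in auto)
  then have "(\<lambda>n. f (x n)) \<longlonglongrightarrow> l"
    by (intro assms filterlim_norm_at_top_imp_at_infinity)
  then have "eventually (\<lambda>n. f (x n) \<in> S) sequentially"
    using S unfolding tendsto_def by blast
  then show False using x(2) by simp
qed

lemma weighted_space_continuous: "\<phi> \<in> weighted_space c \<Longrightarrow> continuous_on UNIV \<phi>"
  by (simp add: weighted_space_def)

lemma weighted_space_measurable: "\<phi> \<in> weighted_space c \<Longrightarrow> \<phi> \<in> borel_measurable borel"
  by (intro borel_measurable_continuous_onI weighted_space_continuous)

lemma weighted_space_bounded:
  assumes "\<phi> \<in> weighted_space c"
  shows "bdd_above (range (\<lambda>r. \<bar>\<phi> r\<bar> * exp (- c * \<bar>r\<bar>)))"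
proof -
  let ?g = "\<lambda>r. \<bar>\<phi> r\<bar> * exp (- c * \<bar>r\<bar>)"
  have lim: "(?g \<longlongrightarrow> 0) at_infinity" and c: "continuous_on UNIV \<phi>"
    using assms by (auto simp: weighted_space_def)
  have "eventually (\<lambda>r. ?g r < 1) at_infinity"
    using lim by (rule order_tendstoD) simp
  then obtain R where R: "\<And>r. R \<le> norm r \<Longrightarrow> ?g r < 1"
    unfolding eventually_at_infinity by blast
  have "continuous_on (cball 0 R) ?g"
    by (intro continuous_intros continuous_on_subset[OF c]) auto
  then have "bounded (?g ` cball 0 R)"
    by (intro compact_imp_bounded compact_continuous_image) auto
  then obtain B where B: "\<And>r. r \<in> cball 0 R \<Longrightarrow> norm (?g r) \<le> B"
    unfolding bounded_iff by (metis imageI)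
  show ?thesis
  proof (rule bdd_aboveI2)
    fix r
    show "?g r \<le> max 1 B"
      using R[of r] B[of r] by (cases "R \<le> norm r") (auto simp: le_max_iff_disj)
  qed
qed

lemma weighted_norm_upper:
  assumes "\<phi> \<in> weighted_space c"
  shows "\<bar>\<phi> r\<bar> * exp (- c * \<bar>r\<bar>) \<le> weighted_norm c \<phi>"
  unfolding weighted_norm_def by (rule cSUP_upper[OF UNIV_I weighted_space_bounded[OF assms]])

lemma weighted_growth:
  assumes "\<phi> \<in> weighted_space c"
  shows "\<bar>\<phi> r\<bar> \<le> weighted_norm c \<phi> * exp (c * \<bar>r\<bar>)"
  using weighted_norm_upper[OF assms, of r] by (simp add: exp_minus field_simps)

lemma weighted_norm_nonneg: "\<phi> \<in> weighted_space c \<Longrightarrow> 0 \<le> weighted_norm c \<phi>"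
  using weighted_norm_upper[of \<phi> c 0] by (rule order_trans[rotated]) simp_all

lemma weighted_norm_least:
  assumes "\<And>r. \<bar>\<phi> r\<bar> * exp (- c * \<bar>r\<bar>) \<le> K"
  shows "weighted_norm c \<phi> \<le> K"
  unfolding weighted_norm_def by (rule cSUP_least) (use assms in auto)

lemma weighted_space_diff:
  assumes "\<phi> \<in> weighted_space c" "\<psi> \<in> weighted_space c"
  shows "(\<lambda>x. \<phi> x - \<psi> x) \<in> weighted_space c"
proof -
  have "((\<lambda>r. \<bar>\<phi> r\<bar> * exp (- c * \<bar>r\<bar>) + \<bar>\<psi> r\<bar> * exp (- c * \<bar>r\<bar>)) \<longlongrightarrow> 0 + 0) at_infinity"
    using assms unfolding weighted_space_def by (intro tendsto_add) auto
  then have lim: "((\<lambda>r. \<bar>\<phi> r\<bar> * exp (- c * \<bar>r\<bar>) + \<bar>\<psi> r\<bar> * exp (- c * \<bar>r\<bar>)) \<longlongrightarrow> 0) at_infinity"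
    by simp
  have "((\<lambda>r. \<bar>\<phi> r - \<psi> r\<bar> * exp (- c * \<bar>r\<bar>)) \<longlongrightarrow> 0) at_infinity"
    by (rule Lim_null_comparison[OF _ lim], intro always_eventually allI)
      (simp add: abs_mult distrib_right[symmetric] mult_right_mono)
  moreover have "continuous_on UNIV (\<lambda>x. \<phi> x - \<psi> x)"
    using assms by (intro continuous_intros weighted_space_continuous)
  ultimately show ?thesis by (simp add: weighted_space_def)
qed

text \<open>The term \<open>r (1 - q)\<close> makes up for the contraction of \<open>r\<close> to \<open>q r\<close>, so the right-hand sides are
  free of \<open>r\<close> and of \<open>q\<close>.\<close>

lemma weighted_kernel_bound:
  fixes c q r m s x :: real
  assumes \<phi>: "\<phi> \<in> weighted_space c" and "0 \<le> c" "0 < q" "q \<le> 1" "\<bar>m\<bar> \<le> m'" "0 \<le> s" "s \<le> s'"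
  shows "c * \<bar>q * r + m + s * x\<bar> + c * (r * (1 - q) - \<bar>r\<bar>) \<le> c * (m' + s' * \<bar>x\<bar>)" (is ?le)
    and "\<bar>\<phi> (q * r + m + s * x) * exp (c * (r * (1 - q) - \<bar>r\<bar>))\<bar> \<le> weighted_norm c \<phi> * exp (c * (m' + s' * \<bar>x\<bar>))"
proof -
  let ?y = "q * r + m + s * x"
  have "\<bar>?y\<bar> \<le> \<bar>q * r\<bar> + \<bar>m\<bar> + \<bar>s * x\<bar>" by linarith
  moreover have "\<bar>q * r\<bar> = q * \<bar>r\<bar>" "\<bar>s * x\<bar> = s * \<bar>x\<bar>" using assms by (auto simp: abs_mult)
  moreover have "s * \<bar>x\<bar> \<le> s' * \<bar>x\<bar>" using assms by (intro mult_right_mono) auto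
  moreover have "r * (1 - q) \<le> \<bar>r\<bar> * (1 - q)" using assms by (intro mult_right_mono) auto
  moreover have "\<bar>r\<bar> * (1 - q) = \<bar>r\<bar> - q * \<bar>r\<bar>" by (simp add: algebra_simps)
  ultimately have "\<bar>?y\<bar> + (r * (1 - q) - \<bar>r\<bar>) \<le> m' + s' * \<bar>x\<bar>" using assms(5) by linarith
  from mult_left_mono[OF this assms(2)] show le: ?le by (simp add: distrib_left)
  have "\<bar>\<phi> ?y * exp (c * (r * (1 - q) - \<bar>r\<bar>))\<bar> \<le> weighted_norm c \<phi> * exp (c * \<bar>?y\<bar>) * exp (c * (r * (1 - q) - \<bar>r\<bar>))"
    unfolding abs_mult using weighted_growth[OF \<phi>, of ?y] by (simp add: mult_right_mono)
  also have "\<dots> \<le> weighted_norm c \<phi> * exp (c * (m' + s' * \<bar>x\<bar>))"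
    unfolding mult.assoc mult_exp_exp using le weighted_norm_nonneg[OF \<phi>] by (intro mult_left_mono) auto
  finally show "\<bar>\<phi> ?y * exp (c * (r * (1 - q) - \<bar>r\<bar>))\<bar> \<le> weighted_norm c \<phi> * exp (c * (m' + s' * \<bar>x\<bar>))" .
qed

lemma integrable_weighted_envelope:
  assumes "0 \<le> c" "0 \<le> s'"
  shows "integrable gauss (\<lambda>x. K * exp (c * (m' + s' * \<bar>x\<bar>)))"
proof -
  have "integrable gauss (\<lambda>x. (K * exp (c * m')) * exp ((c * s') * \<bar>x\<bar>))"
    using assms by (intro integrable_mult_right integrable_gaussian_exp_abs) auto
  then show ?thesis by (simp add: mult_exp_exp algebra_simps)
qed

lemma integrable_weighted_kernel:
  fixes c q r m s :: real
  assumes \<phi>: "\<phi> \<in> weighted_space c" and "0 \<le> c" "0 < q" "q \<le> 1" "0 \<le> s"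
  shows "integrable gauss (\<lambda>x. \<phi> (q * r + m + s * x) * exp (c * (r * (1 - q) - \<bar>r\<bar>)))" (is ?w)
    and "integrable gauss (\<lambda>x. \<phi> (q * r + m + s * x))"
proof -
  have [measurable]: "\<phi> \<in> borel_measurable borel" using \<phi> by (rule weighted_space_measurable)
  show w: ?w
  proof (rule Bochner_Integration.integrable_bound[OF integrable_weighted_envelope[of c s "weighted_norm c \<phi>" "\<bar>m\<bar>"]])
    show "AE x in gauss. norm (\<phi> (q * r + m + s * x) * exp (c * (r * (1 - q) - \<bar>r\<bar>)))
        \<le> norm (weighted_norm c \<phi> * exp (c * (\<bar>m\<bar> + s * \<bar>x\<bar>)))"
      using weighted_kernel_bound(2)[OF \<phi> assms(2-4) order_refl assms(5) order_refl] weighted_norm_nonneg[OF \<phi>]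
      by (intro AE_I2) (simp add: abs_mult)
  qed (use assms in auto)
  have "integrable gauss (\<lambda>x. (\<phi> (q * r + m + s * x) * exp (c * (r * (1 - q) - \<bar>r\<bar>))) * exp (- (c * (r * (1 - q) - \<bar>r\<bar>))))"
    using w by (rule integrable_mult_left)
  then show "integrable gauss (\<lambda>x. \<phi> (q * r + m + s * x))"
    by (simp add: mult.assoc mult_exp_exp)
qed

lemma weighted_kernel_limit:
  fixes q r m s :: "nat \<Rightarrow> real" and c :: real
  assumes \<phi>: "\<phi> \<in> weighted_space c" and c: "0 \<le> c"
    and q: "\<And>n. 0 < q n" "\<And>n. q n \<le> 1" and m: "\<And>n. \<bar>m n\<bar> \<le> m'" and s: "\<And>n. 0 \<le> s n" "\<And>n. s n \<le> s'"
    and [measurable]: "l \<in> borel_measurable borel"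
    and lim: "\<And>x. (\<lambda>n. \<phi> (q n * r n + m n + s n * x) * exp (c * (r n * (1 - q n) - \<bar>r n\<bar>))) \<longlonglongrightarrow> l x"
  shows "(\<lambda>n. \<integral>x. \<phi> (q n * r n + m n + s n * x) * exp (c * (r n * (1 - q n) - \<bar>r n\<bar>)) \<partial>gauss)
    \<longlonglongrightarrow> (\<integral>x. l x \<partial>gauss)"
proof (rule integral_dominated_convergence[where w="\<lambda>x. weighted_norm c \<phi> * exp (c * (m' + s' * \<bar>x\<bar>))"])
  have [measurable]: "\<phi> \<in> borel_measurable borel" using \<phi> by (rule weighted_space_measurable)
  show "l \<in> borel_measurable gauss" by measurable
  show "(\<lambda>x. \<phi> (q n * r n + m n + s n * x) * exp (c * (r n * (1 - q n) - \<bar>r n\<bar>))) \<in> borel_measurable gauss" for n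
    by measurable
  show "integrable gauss (\<lambda>x. weighted_norm c \<phi> * exp (c * (m' + s' * \<bar>x\<bar>)))"
    using c order_trans[OF s] by (rule integrable_weighted_envelope)
  show "AE x in gauss. norm (\<phi> (q n * r n + m n + s n * x) * exp (c * (r n * (1 - q n) - \<bar>r n\<bar>)))
      \<le> weighted_norm c \<phi> * exp (c * (m' + s' * \<bar>x\<bar>))" for n
    unfolding real_norm_def
    by (intro AE_I2 weighted_kernel_bound(2) \<phi> c q m s)
qed (use lim in auto)

text \<open>Escaping starting points: a contraction factor bounded below drives the arguments of \<open>\<phi>\<close> to
  infinity, where its weighted value vanishes.\<close>

lemma weighted_kernel_limit_infinity:
  fixes q r m s :: "nat \<Rightarrow> real" and c :: real
  assumes \<phi>: "\<phi> \<in> weighted_space c" and c: "0 \<le> c"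
    and q: "0 < q0" "\<And>n. q0 \<le> q n" "\<And>n. q n \<le> 1" and m: "\<And>n. \<bar>m n\<bar> \<le> m'" and s: "\<And>n. 0 \<le> s n" "\<And>n. s n \<le> s'"
    and r: "filterlim r at_infinity sequentially"
  shows "(\<lambda>n. \<integral>x. \<phi> (q n * r n + m n + s n * x) * exp (c * (r n * (1 - q n) - \<bar>r n\<bar>)) \<partial>gauss) \<longlonglongrightarrow> 0"
proof -
  have q': "0 < q n" for n using q(1) q(2)[of n] by linarith
  have "(\<lambda>n. \<integral>x. \<phi> (q n * r n + m n + s n * x) * exp (c * (r n * (1 - q n) - \<bar>r n\<bar>)) \<partial>gauss)
      \<longlonglongrightarrow> (\<integral>x. 0 \<partial>gauss)"
  proof (rule weighted_kernel_limit[OF \<phi> c q' q(3) m s])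
    fix x
    let ?y = "\<lambda>n. q n * r n + m n + s n * x"
    have "filterlim (\<lambda>n. q0 * norm (r n) - (m' + s' * \<bar>x\<bar>)) at_top sequentially"
    proof -
      have "filterlim (\<lambda>n. norm (r n)) at_top sequentially"
        using r by (rule filterlim_at_infinity_imp_norm_at_top)
      then have "filterlim (\<lambda>n. q0 * norm (r n)) at_top sequentially"
        by (rule filterlim_tendsto_pos_mult_at_top[OF tendsto_const q(1)])
      from filterlim_tendsto_add_at_top[OF tendsto_const this, of "- (m' + s' * \<bar>x\<bar>)"]
      show ?thesis by (simp add: algebra_simps)
    qed
    then have "filterlim (\<lambda>n. norm (?y n)) at_top sequentially"
    proof (rule filterlim_at_top_mono, intro always_eventually allI)
      fix n
      have "q0 * \<bar>r n\<bar> \<le> q n * \<bar>r n\<bar>" using q(2)[of n] by (intro mult_right_mono) auto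
      moreover have "\<bar>q n * r n\<bar> = q n * \<bar>r n\<bar>" using q'[of n] by (simp add: abs_mult)
      moreover have "\<bar>s n * x\<bar> \<le> s' * \<bar>x\<bar>" using s[of n] by (simp add: abs_mult mult_right_mono)
      ultimately show "q0 * norm (r n) - (m' + s' * \<bar>x\<bar>) \<le> norm (?y n)"
        using m[of n] unfolding real_norm_def by linarith
    qed
    then have y: "filterlim ?y at_infinity sequentially"
      by (rule filterlim_norm_at_top_imp_at_infinity)
    have "((\<lambda>r. \<bar>\<phi> r\<bar> * exp (- c * \<bar>r\<bar>)) \<longlongrightarrow> 0) at_infinity"
      using \<phi> by (simp add: weighted_space_def)
    from filterlim_compose[OF this y]
    have "(\<lambda>n. (\<bar>\<phi> (?y n)\<bar> * exp (- c * \<bar>?y n\<bar>)) * exp (c * (m' + s' * \<bar>x\<bar>))) \<longlonglongrightarrow> 0"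
      by (rule tendsto_mult_left_zero)
    then show "(\<lambda>n. \<phi> (?y n) * exp (c * (r n * (1 - q n) - \<bar>r n\<bar>))) \<longlonglongrightarrow> 0"
    proof (rule Lim_null_comparison[rotated], intro always_eventually allI)
      fix n
      have "norm (\<phi> (?y n) * exp (c * (r n * (1 - q n) - \<bar>r n\<bar>)))
         = \<bar>\<phi> (?y n)\<bar> * exp (- c * \<bar>?y n\<bar> + (c * \<bar>?y n\<bar> + c * (r n * (1 - q n) - \<bar>r n\<bar>)))"
        by (simp add: abs_mult)
      also have "\<dots> \<le> \<bar>\<phi> (?y n)\<bar> * exp (- c * \<bar>?y n\<bar> + c * (m' + s' * \<bar>x\<bar>))"
        using weighted_kernel_bound(1)[OF \<phi> c q'[of n] q(3)[of n] m[of n] s(1)[of n] s(2)[of n], of "r n" x]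
        by (intro mult_left_mono) auto
      also have "\<dots> = (\<bar>\<phi> (?y n)\<bar> * exp (- c * \<bar>?y n\<bar>)) * exp (c * (m' + s' * \<bar>x\<bar>))"
        by (simp only: exp_add mult.assoc)
      finally show "norm (\<phi> (?y n) * exp (c * (r n * (1 - q n) - \<bar>r n\<bar>)))
        \<le> (\<bar>\<phi> (?y n)\<bar> * exp (- c * \<bar>?y n\<bar>)) * exp (c * (m' + s' * \<bar>x\<bar>))" .
    qed
  qed simp
  then show ?thesis by simp
qed

lemma weighted_kernel_limit_finite:
  fixes q r m s :: "nat \<Rightarrow> real" and c :: real
  assumes \<phi>: "\<phi> \<in> weighted_space c" and c: "0 \<le> c"
    and q: "\<And>n. 0 < q n" "\<And>n. q n \<le> 1" "q \<longlonglongrightarrow> q'" and m: "m \<longlonglongrightarrow> m'" and s: "\<And>n. 0 \<le> s n" "s \<longlonglongrightarrow> s'"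
    and r: "r \<longlonglongrightarrow> r'"
  shows "(\<lambda>n. \<integral>x. \<phi> (q n * r n + m n + s n * x) * exp (c * (r n * (1 - q n) - \<bar>r n\<bar>)) \<partial>gauss)
    \<longlonglongrightarrow> (\<integral>x. \<phi> (q' * r' + m' + s' * x) * exp (c * (r' * (1 - q') - \<bar>r'\<bar>)) \<partial>gauss)"
proof -
  have [measurable]: "\<phi> \<in> borel_measurable borel" using \<phi> by (rule weighted_space_measurable)
  obtain B where B: "\<And>n. norm (m n) \<le> B"
    using convergent_imp_Bseq[of m] m unfolding convergent_def Bseq_def by blast
  obtain B' where B': "\<And>n. norm (s n) \<le> B'"
    using convergent_imp_Bseq[of s] s(2) unfolding convergent_def Bseq_def by blast
  show ?thesis
  proof (rule weighted_kernel_limit[OF \<phi> c q(1,2), of _ B _ B'])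
    show "\<bar>m n\<bar> \<le> B" for n using B[of n] by simp
    show "s n \<le> B'" for n using B'[of n] by simp
    fix x
    have "(\<lambda>n. \<phi> (q n * r n + m n + s n * x)) \<longlonglongrightarrow> \<phi> (q' * r' + m' + s' * x)"
      by (rule continuous_on_tendsto_compose[OF weighted_space_continuous[OF \<phi>]])
        (auto intro!: tendsto_intros q m s r)
    then show "(\<lambda>n. \<phi> (q n * r n + m n + s n * x) * exp (c * (r n * (1 - q n) - \<bar>r n\<bar>)))
        \<longlonglongrightarrow> \<phi> (q' * r' + m' + s' * x) * exp (c * (r' * (1 - q') - \<bar>r'\<bar>))"
      by (intro tendsto_intros q r)
  qed (use s in auto)
qed

lemma lipschitz_image_in_weighted_space:
  fixes f :: "real \<Rightarrow> real"
  assumes c: "0 < c" and f: "L-lipschitz_on {0..} f" "bounded (f ` {0..})"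
    and \<phi>: "\<phi> \<in> weighted_space c" "\<And>r. 0 \<le> \<phi> r"
  shows "(\<lambda>r. f (\<phi> r)) \<in> weighted_space c"
proof -
  have "continuous_on UNIV (\<lambda>r. f (\<phi> r))"
    by (rule continuous_on_compose2[OF lipschitz_on_continuous_on[OF f(1)] weighted_space_continuous[OF \<phi>(1)]])
      (use \<phi>(2) in auto)
  moreover have "((\<lambda>r. \<bar>f (\<phi> r)\<bar> * exp (- c * \<bar>r\<bar>)) \<longlongrightarrow> 0) at_infinity"
  proof -
    obtain B where B: "\<And>x. 0 \<le> x \<Longrightarrow> \<bar>f x\<bar> \<le> B"
      using f(2) unfolding bounded_iff by (auto simp: Ball_def)
    have "filterlim (\<lambda>r::real. c * norm r) at_top at_infinity"
      by (rule filterlim_tendsto_pos_mult_at_top[OF tendsto_const c filterlim_norm_at_top])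
    then have "((\<lambda>r::real. exp (- (c * norm r))) \<longlongrightarrow> 0) at_infinity"
      by (intro filterlim_compose[OF exp_at_bot] filterlim_uminus_at_top[THEN iffD1])
    then have "((\<lambda>r::real. B * exp (- (c * norm r))) \<longlongrightarrow> 0) at_infinity"
      by (rule tendsto_mult_right_zero)
    then show ?thesis
      by (rule Lim_null_comparison[rotated])
        (intro always_eventually allI, simp add: abs_mult B \<phi>(2) mult_right_mono)
  qed
  ultimately show ?thesis by (simp add: weighted_space_def)
qed

lemma integral_gaussian_convolution:
  fixes f :: "real \<Rightarrow> real"
  assumes [measurable]: "f \<in> borel_measurable borel"
    and int: "integrable gauss (\<lambda>x. f (sqrt (p\<^sup>2 + q\<^sup>2) * x))"
  shows "(\<integral>x. (\<integral>y. f (p * x + q * y) \<partial>gauss) \<partial>gauss)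
    = (\<integral>x. f (sqrt (p\<^sup>2 + q\<^sup>2) * x) \<partial>gauss)"
proof -
  interpret prob_space gauss by (rule prob_space_std_normal)
  interpret PP: pair_prob_space gauss gauss ..
  let ?P = "distr (gauss \<Otimes>\<^sub>M gauss) borel (\<lambda>(x, y). p * x + q * y)"
  have "integrable ?P f"
    unfolding gaussian_convolution using int by (subst integrable_distr_eq) auto
  then have i: "integrable (gauss \<Otimes>\<^sub>M gauss) (\<lambda>(x, y). f (p * x + q * y))"
    by (subst (asm) integrable_distr_eq) (auto simp: case_prod_unfold)
  have "(\<integral>x. f (sqrt (p\<^sup>2 + q\<^sup>2) * x) \<partial>gauss) = (\<integral>z. f z \<partial>?P)"
    unfolding gaussian_convolution by (subst integral_distr) auto
  also have "\<dots> = (\<integral>(x, y). f (p * x + q * y) \<partial>(gauss \<Otimes>\<^sub>M gauss))"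
    by (subst integral_distr) (auto simp: case_prod_unfold)
  also have "\<dots> = (\<integral>x. (\<integral>y. f (p * x + q * y) \<partial>gauss) \<partial>gauss)"
    using PP.integral_fst'[OF i] by simp
  finally show ?thesis ..
qed

section \<open>The Feynman-Kac semigroup\<close>

context vasicek
begin

context
  fixes \<alpha> :: real
  assumes \<alpha>_pos: "0 < \<alpha>"
begin

abbreviation fk :: "real \<Rightarrow> (real \<Rightarrow> real) \<Rightarrow> real \<Rightarrow> real" where
  "fk \<equiv> feynman_kac M \<alpha> \<rho>"

lemma weight_nonneg: "0 \<le> \<alpha> / b" "0 < \<alpha> / b"
  using \<alpha>_pos b_pos by auto

lemma feynman_kac_formula:
  assumes "\<phi> \<in> weighted_space (\<alpha> / b)" "0 \<le> t"
  shows "fk t \<phi> r = exp (\<alpha> * r * (1 - decay t) / b + log_mass \<alpha> t) *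
    (\<integral>x. \<phi> (decay t * r + tilted_mean \<alpha> t + rate_sd t * x) \<partial>gauss)"
  unfolding feynman_kac_def by (rule integral_kernel[OF weighted_space_measurable[OF assms(1)] assms(2)])

text \<open>The weight is moved under the integral, which is the form covered by the limit theorems for
  weighted kernels.\<close>

lemma feynman_kac_weighted:
  assumes "\<phi> \<in> weighted_space (\<alpha> / b)" "0 \<le> t"
  shows "fk t \<phi> r * exp (- (\<alpha> / b) * \<bar>r\<bar>) = exp (log_mass \<alpha> t) *
    (\<integral>x. \<phi> (decay t * r + tilted_mean \<alpha> t + rate_sd t * x) * exp (\<alpha> / b * (r * (1 - decay t) - \<bar>r\<bar>)) \<partial>gauss)"
proof -
  have "exp (\<alpha> * r * (1 - decay t) / b + log_mass \<alpha> t) * exp (- (\<alpha> / b) * \<bar>r\<bar>)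
     = exp (log_mass \<alpha> t) * exp (\<alpha> / b * (r * (1 - decay t) - \<bar>r\<bar>))"
    unfolding mult_exp_exp by (rule arg_cong[where f=exp]) (simp add: right_diff_distrib diff_divide_distrib mult.assoc)
  then show ?thesis
    unfolding feynman_kac_formula[OF assms] integral_mult_left_zero by (simp add: mult_ac)
qed

lemma feynman_kac_in_space:
  assumes \<phi>: "\<phi> \<in> weighted_space (\<alpha> / b)" and t: "0 \<le> t"
  shows "fk t \<phi> \<in> weighted_space (\<alpha> / b)"
proof -
  let ?f = "\<lambda>r. \<integral>x. \<phi> (decay t * r + tilted_mean \<alpha> t + rate_sd t * x) * exp (\<alpha> / b * (r * (1 - decay t) - \<bar>r\<bar>)) \<partial>gauss"
  have fk: "fk t \<phi> r = exp (log_mass \<alpha> t) * ?f r * exp (\<alpha> / b * \<bar>r\<bar>)" for r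
    using feynman_kac_weighted[OF assms, of r, symmetric] by (simp add: exp_minus)
  have "continuous_on UNIV (fk t \<phi>)"
  proof (rule continuous_on_sequentiallyI)
    fix r :: "nat \<Rightarrow> real" and r' assume r: "r \<longlonglongrightarrow> r'"
    have "(\<lambda>n. ?f (r n)) \<longlonglongrightarrow> ?f r'"
      by (rule weighted_kernel_limit_finite[OF \<phi> weight_nonneg(1) _ _ tendsto_const tendsto_const _ tendsto_const r])
        (use t decay_le_1 rate_sd_nonneg in auto)
    then show "(\<lambda>n. fk t \<phi> (r n)) \<longlonglongrightarrow> fk t \<phi> r'"
      unfolding fk by (intro tendsto_intros r)
  qed
  moreover have "((\<lambda>r. \<bar>fk t \<phi> r\<bar> * exp (- (\<alpha> / b) * \<bar>r\<bar>)) \<longlongrightarrow> 0) at_infinity"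
  proof (rule tendsto_at_infinity_sequentiallyI)
    fix r :: "nat \<Rightarrow> real" assume r: "filterlim r at_infinity sequentially"
    have "(\<lambda>n. ?f (r n)) \<longlonglongrightarrow> 0"
      by (rule weighted_kernel_limit_infinity[OF \<phi> weight_nonneg(1) decay_pos order_refl _ order_refl _ order_refl r])
        (use t decay_le_1 rate_sd_nonneg in auto)
    then have "(\<lambda>n. \<bar>exp (log_mass \<alpha> t) * ?f (r n)\<bar>) \<longlonglongrightarrow> 0"
      by (intro tendsto_rabs_zero tendsto_mult_right_zero)
    then show "(\<lambda>n. \<bar>fk t \<phi> (r n)\<bar> * exp (- (\<alpha> / b) * \<bar>r n\<bar>)) \<longlonglongrightarrow> 0"
      unfolding feynman_kac_weighted[OF assms, symmetric] abs_mult by simp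
  qed
  ultimately show ?thesis by (simp add: weighted_space_def)
qed

lemma feynman_kac_bounded:
  assumes t: "0 \<le> t"
  shows "\<exists>K. \<forall>\<phi>\<in>weighted_space (\<alpha> / b). weighted_norm (\<alpha> / b) (fk t \<phi>) \<le> K * weighted_norm (\<alpha> / b) \<phi>"
proof -
  let ?e = "\<lambda>x. exp (\<alpha> / b * (\<bar>tilted_mean \<alpha> t\<bar> + rate_sd t * \<bar>x\<bar>))"
  let ?K = "exp (log_mass \<alpha> t) * (\<integral>x. ?e x \<partial>gauss)"
  show ?thesis
  proof (intro exI[of _ ?K] ballI weighted_norm_least)
    fix \<phi> r assume \<phi>: "\<phi> \<in> weighted_space (\<alpha> / b)"
    let ?g = "\<lambda>x. \<phi> (decay t * r + tilted_mean \<alpha> t + rate_sd t * x) * exp (\<alpha> / b * (r * (1 - decay t) - \<bar>r\<bar>))"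
    let ?N = "weighted_norm (\<alpha> / b) \<phi>"
    have ie: "integrable gauss (\<lambda>x. ?N * ?e x)"
      by (rule integrable_weighted_envelope[OF weight_nonneg(1) rate_sd_nonneg[OF t]])
    have ig: "integrable gauss ?g"
      by (rule integrable_weighted_kernel(1)[OF \<phi> weight_nonneg(1) decay_pos decay_le_1[OF t] rate_sd_nonneg[OF t]])
    have "\<bar>\<integral>x. ?g x \<partial>gauss\<bar> \<le> (\<integral>x. \<bar>?g x\<bar> \<partial>gauss)"
      by (rule integral_abs_bound)
    also have "\<dots> \<le> (\<integral>x. ?N * ?e x \<partial>gauss)"
      using t decay_le_1[OF t] rate_sd_nonneg[OF t]
      by (intro integral_mono integrable_abs ig ie weighted_kernel_bound(2) \<phi> weight_nonneg(1)) auto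
    also have "\<dots> = (\<integral>x. ?e x \<partial>gauss) * ?N" by simp
    finally have "exp (log_mass \<alpha> t) * \<bar>\<integral>x. ?g x \<partial>gauss\<bar> \<le> ?K * ?N"
      by (simp add: mult.assoc)
    moreover have "\<bar>fk t \<phi> r\<bar> * exp (- (\<alpha> / b) * \<bar>r\<bar>) = exp (log_mass \<alpha> t) * \<bar>\<integral>x. ?g x \<partial>gauss\<bar>"
    proof -
      have "\<bar>fk t \<phi> r\<bar> * exp (- (\<alpha> / b) * \<bar>r\<bar>) = \<bar>fk t \<phi> r * exp (- (\<alpha> / b) * \<bar>r\<bar>)\<bar>"
        by (simp add: abs_mult)
      then show ?thesis unfolding feynman_kac_weighted[OF \<phi> t] by (simp add: abs_mult)
    qed
    ultimately show "\<bar>fk t \<phi> r\<bar> * exp (- (\<alpha> / b) * \<bar>r\<bar>) \<le> ?K * ?N" by simp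
  qed
qed

lemma feynman_kac_zero:
  assumes \<phi>: "\<phi> \<in> weighted_space (\<alpha> / b)"
  shows "fk 0 \<phi> = \<phi>"
proof
  fix r
  interpret G: prob_space gauss by (rule prob_space_std_normal)
  show "fk 0 \<phi> r = \<phi> r"
    unfolding feynman_kac_formula[OF \<phi> order_refl]
    using G.prob_space by (simp add: log_mass_def tilted_mean_def rate_sd_def)
qed

lemma feynman_kac_linear:
  assumes \<phi>: "\<phi> \<in> weighted_space (\<alpha> / b)" and t: "0 \<le> t"
  shows "\<psi> \<in> weighted_space (\<alpha> / b) \<Longrightarrow> fk t (\<lambda>x. \<phi> x + \<psi> x) = (\<lambda>x. fk t \<phi> x + fk t \<psi> x)"
    and "fk t (\<lambda>x. c * \<phi> x) = (\<lambda>x. c * fk t \<phi> x)"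
proof -
  have int: "integrable M (\<lambda>\<omega>. \<phi> (\<rho> r t \<omega>) * exp (\<alpha> * cum_rate r t \<omega>))" if "\<phi> \<in> weighted_space (\<alpha> / b)" for \<phi> r
    unfolding integrable_kernel[OF weighted_space_measurable[OF that] t]
    by (rule integrable_weighted_kernel(2)[OF that weight_nonneg(1) decay_pos decay_le_1[OF t] rate_sd_nonneg[OF t]])
  show "fk t (\<lambda>x. \<phi> x + \<psi> x) = (\<lambda>x. fk t \<phi> x + fk t \<psi> x)" if "\<psi> \<in> weighted_space (\<alpha> / b)"
    unfolding feynman_kac_def distrib_right
    by (intro ext Bochner_Integration.integral_add int \<phi> that)
  show "fk t (\<lambda>x. c * \<phi> x) = (\<lambda>x. c * fk t \<phi> x)"
    unfolding feynman_kac_def mult.assoc by simp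
qed

text \<open>The identities behind the Chapman-Kolmogorov equation, for variances, means and masses. They are
  polynomial in the decay factors.\<close>

lemma kernel_composition:
  assumes "0 \<le> s" "0 \<le> t"
  shows "(decay t * rate_sd s)\<^sup>2 + (rate_sd t)\<^sup>2 = (rate_sd (s + t))\<^sup>2"
    and "decay t * (tilted_mean \<alpha> s + rate_sd s * (\<alpha> / b * (1 - decay t) * rate_sd s)) + tilted_mean \<alpha> t = tilted_mean \<alpha> (s + t)"
    and "\<alpha> * r * (1 - decay s) / b + log_mass \<alpha> s + (\<alpha> * (decay s * r + tilted_mean \<alpha> s) * (1 - decay t) / b + log_mass \<alpha> t)
      + (\<alpha> / b * (1 - decay t) * rate_sd s)\<^sup>2 / 2 = \<alpha> * r * (1 - decay (s + t)) / b + log_mass \<alpha> (s + t)"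
proof -
  have b0: "b \<noteq> 0" using b_pos by simp
  note sq = rate_sd_square[OF assms(1)] rate_sd_square[OF assms(2)] rate_sd_square[OF add_nonneg_nonneg[OF assms]]
  show "(decay t * rate_sd s)\<^sup>2 + (rate_sd t)\<^sup>2 = (rate_sd (s + t))\<^sup>2"
    unfolding power_mult_distrib sq decay_add using b0 by (simp add: field_simps power2_eq_square)
  have e: "rate_sd s * (\<alpha> / b * (1 - decay t) * rate_sd s) = \<alpha> / b * (1 - decay t) * (rate_sd s)\<^sup>2"
    by (simp add: power2_eq_square)
  show "decay t * (tilted_mean \<alpha> s + rate_sd s * (\<alpha> / b * (1 - decay t) * rate_sd s)) + tilted_mean \<alpha> t = tilted_mean \<alpha> (s + t)"
    unfolding e sq tilted_mean_def decay_add using b0 by (simp add: field_simps power2_eq_square)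
  show "\<alpha> * r * (1 - decay s) / b + log_mass \<alpha> s + (\<alpha> * (decay s * r + tilted_mean \<alpha> s) * (1 - decay t) / b + log_mass \<alpha> t)
      + (\<alpha> / b * (1 - decay t) * rate_sd s)\<^sup>2 / 2 = \<alpha> * r * (1 - decay (s + t)) / b + log_mass \<alpha> (s + t)"
    unfolding power_mult_distrib sq log_mass_def tilted_mean_def decay_add using b0
    by (simp add: field_simps power2_eq_square)
qed

text \<open>The mass of the inner kernel is an exponential in the intermediate point. Tilting by it shifts the
  outer variable by \<open>l\<close>, and then the two independent normal variables are added.\<close>

lemma feynman_kac_semigroup:
  assumes \<phi>: "\<phi> \<in> weighted_space (\<alpha> / b)" and s: "0 \<le> s" and t: "0 \<le> t"
  shows "fk (s + t) \<phi> = fk s (fk t \<phi>)"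
proof
  fix r
  have [measurable]: "\<phi> \<in> borel_measurable borel" using \<phi> by (rule weighted_space_measurable)
  have \<psi>: "fk t \<phi> \<in> weighted_space (\<alpha> / b)" by (rule feynman_kac_in_space[OF \<phi> t])
  have [measurable]: "fk t \<phi> \<in> borel_measurable borel" using \<psi> by (rule weighted_space_measurable)
  define Y where "Y = decay s * r + tilted_mean \<alpha> s"
  define l where "l = \<alpha> / b * (1 - decay t) * rate_sd s"
  define C where "C = \<alpha> * Y * (1 - decay t) / b + log_mass \<alpha> t"
  define h where "h z = (\<integral>x. \<phi> (decay t * (Y + rate_sd s * z) + tilted_mean \<alpha> t + rate_sd t * x) \<partial>gauss)" for z
  define y0 where "y0 = decay t * (Y + rate_sd s * l) + tilted_mean \<alpha> t"
  have fkz: "fk t \<phi> (Y + rate_sd s * z) = exp C * (exp (l * z) *\<^sub>R h z)" for z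
  proof -
    have "exp (\<alpha> * (Y + rate_sd s * z) * (1 - decay t) / b + log_mass \<alpha> t) = exp C * exp (l * z)"
      unfolding mult_exp_exp C_def l_def by (rule arg_cong[where f=exp]) (simp add: algebra_simps add_divide_distrib diff_divide_distrib)
    then show ?thesis unfolding feynman_kac_formula[OF \<phi> t] h_def by simp
  qed
  have hm: "h \<in> borel_measurable borel"
  proof -
    have "h = (\<lambda>z. inverse (exp C) * exp (- (l * z)) * fk t \<phi> (Y + rate_sd s * z))"
      unfolding fkz by (simp add: exp_minus field_simps)
    moreover have "\<dots> \<in> borel_measurable borel" by measurable
    ultimately show ?thesis by simp
  qed
  have h_shift: "h (z + l) = (\<integral>x. \<phi> (y0 + (decay t * rate_sd s * z + rate_sd t * x)) \<partial>gauss)" for z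
    unfolding h_def y0_def by (simp add: algebra_simps)
  have y0: "y0 = decay (s + t) * r + tilted_mean \<alpha> (s + t)"
    using kernel_composition(2)[OF s t] unfolding y0_def Y_def l_def decay_add by (simp add: algebra_simps)
  have sd: "sqrt ((decay t * rate_sd s)\<^sup>2 + (rate_sd t)\<^sup>2) = rate_sd (s + t)"
    unfolding kernel_composition(1)[OF s t] using rate_sd_nonneg s t by simp
  have "fk s (fk t \<phi>) r = exp (\<alpha> * r * (1 - decay s) / b + log_mass \<alpha> s) * (\<integral>z. fk t \<phi> (Y + rate_sd s * z) \<partial>gauss)"
    unfolding feynman_kac_formula[OF \<psi> s] Y_def ..
  also have "(\<integral>z. fk t \<phi> (Y + rate_sd s * z) \<partial>gauss) = exp C * (exp (l\<^sup>2 / 2) * (\<integral>z. h (z + l) \<partial>gauss))"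
    unfolding fkz integral_mult_right_zero integral_gaussian_tilt[OF hm] by simp
  also have "(\<integral>z. h (z + l) \<partial>gauss) = (\<integral>x. \<phi> (y0 + rate_sd (s + t) * x) \<partial>gauss)"
    unfolding h_shift sd[symmetric]
  proof (rule integral_gaussian_convolution)
    show "integrable gauss (\<lambda>x. \<phi> (y0 + sqrt ((decay t * rate_sd s)\<^sup>2 + (rate_sd t)\<^sup>2) * x))"
      unfolding sd y0
      by (rule integrable_weighted_kernel(2)[OF \<phi> weight_nonneg(1) decay_pos decay_le_1 rate_sd_nonneg])
        (use s t in auto)
  qed measurable
  also have "exp (\<alpha> * r * (1 - decay s) / b + log_mass \<alpha> s) * (exp C * (exp (l\<^sup>2 / 2) * (\<integral>x. \<phi> (y0 + rate_sd (s + t) * x) \<partial>gauss)))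
      = exp (\<alpha> * r * (1 - decay s) / b + log_mass \<alpha> s + C + l\<^sup>2 / 2) * (\<integral>x. \<phi> (y0 + rate_sd (s + t) * x) \<partial>gauss)"
    by (simp add: exp_add)
  also have "\<alpha> * r * (1 - decay s) / b + log_mass \<alpha> s + C + l\<^sup>2 / 2 = \<alpha> * r * (1 - decay (s + t)) / b + log_mass \<alpha> (s + t)"
    unfolding C_def Y_def l_def by (rule kernel_composition(3)[OF s t])
  also have "exp \<dots> * (\<integral>x. \<phi> (y0 + rate_sd (s + t) * x) \<partial>gauss) = fk (s + t) \<phi> r"
    using s t unfolding y0 by (subst feynman_kac_formula[OF \<phi>]) auto
  finally show "fk (s + t) \<phi> r = fk s (fk t \<phi>) r" ..
qed

lemma kernel_parameters_limit:
  assumes "t \<longlonglongrightarrow> 0"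
  shows "(\<lambda>n. decay (t n)) \<longlonglongrightarrow> 1" "(\<lambda>n. tilted_mean \<alpha> (t n)) \<longlonglongrightarrow> 0"
    "(\<lambda>n. rate_sd (t n)) \<longlonglongrightarrow> 0" "(\<lambda>n. log_mass \<alpha> (t n)) \<longlonglongrightarrow> 0"
proof -
  show d: "(\<lambda>n. decay (t n)) \<longlonglongrightarrow> 1"
    unfolding decay_def by (auto intro!: tendsto_eq_intros assms)
  show "(\<lambda>n. tilted_mean \<alpha> (t n)) \<longlonglongrightarrow> 0"
    unfolding tilted_mean_def using b_pos by (auto intro!: tendsto_eq_intros d)
  show "(\<lambda>n. rate_sd (t n)) \<longlonglongrightarrow> 0"
    unfolding rate_sd_def using b_pos by (auto intro!: tendsto_eq_intros d)
  show "(\<lambda>n. log_mass \<alpha> (t n)) \<longlonglongrightarrow> 0"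
    unfolding log_mass_def using b_pos by (auto intro!: tendsto_eq_intros d assms)
qed

text \<open>Both kinds of sequences of starting points are covered, because a sequence of near-maximizers has
  a subsequence of one of the two kinds.\<close>

lemma feynman_kac_small_time:
  assumes \<phi>: "\<phi> \<in> weighted_space (\<alpha> / b)"
    and t: "\<And>n. 0 \<le> t n" "\<And>n. t n \<le> 1" "t \<longlonglongrightarrow> 0"
    and r: "filterlim r at_infinity sequentially \<or> r \<longlonglongrightarrow> r'"
  shows "(\<lambda>n. \<bar>fk (t n) \<phi> (r n) - \<phi> (r n)\<bar> * exp (- (\<alpha> / b) * \<bar>r n\<bar>)) \<longlonglongrightarrow> 0"
proof -
  interpret G: prob_space gauss by (rule prob_space_std_normal)
  let ?c = "\<alpha> / b"
  let ?f = "\<lambda>n. \<integral>x. \<phi> (decay (t n) * r n + tilted_mean \<alpha> (t n) + rate_sd (t n) * x) * exp (?c * (r n * (1 - decay (t n)) - \<bar>r n\<bar>)) \<partial>gauss"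
  note par = kernel_parameters_limit[OF t(3)]
  have "(\<lambda>n. exp (log_mass \<alpha> (t n)) * ?f n - \<phi> (r n) * exp (- ?c * \<bar>r n\<bar>)) \<longlonglongrightarrow> 0"
    using r
  proof
    assume r: "filterlim r at_infinity sequentially"
    obtain B where B: "\<And>n. norm (tilted_mean \<alpha> (t n)) \<le> B"
      using convergent_imp_Bseq[of "\<lambda>n. tilted_mean \<alpha> (t n)"] par(2) unfolding convergent_def Bseq_def by blast
    obtain B' where B': "\<And>n. norm (rate_sd (t n)) \<le> B'"
      using convergent_imp_Bseq[of "\<lambda>n. rate_sd (t n)"] par(3) unfolding convergent_def Bseq_def by blast
    have "?f \<longlonglongrightarrow> 0"
    proof (rule weighted_kernel_limit_infinity[OF \<phi> weight_nonneg(1) decay_pos[of 1] _ _ _ _ _ r])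
      show "decay 1 \<le> decay (t n)" for n
        using t(2)[of n] b_pos by (simp add: decay_def)
      show "\<bar>tilted_mean \<alpha> (t n)\<bar> \<le> B" for n using B[of n] by simp
      show "rate_sd (t n) \<le> B'" for n using B'[of n] by simp
    qed (use t decay_le_1 rate_sd_nonneg in auto)
    moreover have "(\<lambda>n. \<bar>\<phi> (r n)\<bar> * exp (- ?c * \<bar>r n\<bar>)) \<longlonglongrightarrow> 0"
      using \<phi> r by (auto simp: weighted_space_def intro: filterlim_compose)
    then have "(\<lambda>n. \<phi> (r n) * exp (- ?c * \<bar>r n\<bar>)) \<longlonglongrightarrow> 0"
      by (subst tendsto_rabs_zero_iff[symmetric]) (simp add: abs_mult)
    ultimately have "(\<lambda>n. exp (log_mass \<alpha> (t n)) * ?f n - \<phi> (r n) * exp (- ?c * \<bar>r n\<bar>)) \<longlonglongrightarrow> exp 0 * 0 - 0"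
      by (intro tendsto_diff tendsto_mult tendsto_exp par(4))
    then show ?thesis by (simp only: mult_zero_right diff_0_right)
  next
    assume r: "r \<longlonglongrightarrow> r'"
    have "?f \<longlonglongrightarrow> (\<integral>x. \<phi> (1 * r' + 0 + 0 * x) * exp (?c * (r' * (1 - 1) - \<bar>r'\<bar>)) \<partial>gauss)"
      by (rule weighted_kernel_limit_finite[OF \<phi> weight_nonneg(1) _ _ par(1,2) _ par(3) r])
        (use t decay_le_1 rate_sd_nonneg in auto)
    then have "?f \<longlonglongrightarrow> \<phi> r' * exp (- ?c * \<bar>r'\<bar>)"
      using G.prob_space by simp
    moreover have "(\<lambda>n. \<phi> (r n)) \<longlonglongrightarrow> \<phi> r'"
      by (rule continuous_on_tendsto_compose[OF weighted_space_continuous[OF \<phi>] r]) auto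
    ultimately have "(\<lambda>n. exp (log_mass \<alpha> (t n)) * ?f n - \<phi> (r n) * exp (- ?c * \<bar>r n\<bar>))
        \<longlonglongrightarrow> exp 0 * (\<phi> r' * exp (- ?c * \<bar>r'\<bar>)) - \<phi> r' * exp (- ?c * \<bar>r'\<bar>)"
      by (intro tendsto_diff tendsto_mult tendsto_exp tendsto_const tendsto_rabs par(4) r)
    then show ?thesis by (simp only: exp_zero mult_1_left diff_self)
  qed
  then have "(\<lambda>n. \<bar>exp (log_mass \<alpha> (t n)) * ?f n - \<phi> (r n) * exp (- ?c * \<bar>r n\<bar>)\<bar>) \<longlonglongrightarrow> 0"
    by (rule tendsto_rabs_zero)
  then show ?thesis
    unfolding feynman_kac_weighted[OF \<phi> t(1), symmetric] left_diff_distrib[symmetric] abs_mult by simp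
qed

text \<open>Were the norms not to vanish, there would be times tending to \<open>0\<close> and points where the weighted
  difference stays above some \<open>\<epsilon> / 2\<close>; a subsequence of these points converges or escapes.\<close>

lemma feynman_kac_strongly_continuous:
  assumes \<phi>: "\<phi> \<in> weighted_space (\<alpha> / b)"
  shows "((\<lambda>t. weighted_norm (\<alpha> / b) (\<lambda>x. fk t \<phi> x - \<phi> x)) \<longlongrightarrow> 0) (at_right 0)"
proof (rule tendsto_at_right_sequentially[of 0 1])
  let ?d = "\<lambda>t r. \<bar>fk t \<phi> r - \<phi> r\<bar> * exp (- (\<alpha> / b) * \<bar>r\<bar>)"
  let ?n = "\<lambda>t. weighted_norm (\<alpha> / b) (\<lambda>x. fk t \<phi> x - \<phi> x)"
  fix t :: "nat \<Rightarrow> real" assume t: "\<And>n. 0 < t n" "\<And>n. t n < 1" "t \<longlonglongrightarrow> 0"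
  show "(\<lambda>n. ?n (t n)) \<longlonglongrightarrow> 0"
  proof (rule ccontr)
    assume "\<not> ?thesis"
    then obtain \<epsilon> where \<epsilon>: "\<epsilon> > 0" "\<not> eventually (\<lambda>n. dist (?n (t n)) 0 < \<epsilon>) sequentially"
      unfolding tendsto_iff by blast
    then obtain u :: "nat \<Rightarrow> nat" where u: "strict_mono u" "\<And>n. \<not> dist (?n (t (u n))) 0 < \<epsilon>"
      using not_eventually_sequentiallyD by blast
    \<comment> \<open>The norm is a supremum that need not be attained; half of \<open>\<epsilon>\<close> leaves room for an actual point.\<close>
    have "\<exists>r. ?d (t (u n)) r > \<epsilon> / 2" for n
    proof (rule ccontr)
      assume "\<not> ?thesis"
      then have "?n (t (u n)) \<le> \<epsilon> / 2"
        by (intro weighted_norm_least) (auto simp: not_less)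
      moreover have "0 \<le> ?n (t (u n))"
        using t(1)[of "u n"] by (intro weighted_norm_nonneg weighted_space_diff feynman_kac_in_space \<phi>) auto
      ultimately show False using u(2)[of n] \<epsilon>(1) by (simp add: dist_real_def)
    qed
    then obtain r where r: "\<And>n. ?d (t (u n)) (r n) > \<epsilon> / 2" by metis
    have no: False if "strict_mono v" "filterlim (r \<circ> v) at_infinity sequentially \<or> (r \<circ> v) \<longlonglongrightarrow> r'" for v :: "nat \<Rightarrow> nat" and r'
    proof -
      have "(\<lambda>n. t (u (v n))) \<longlonglongrightarrow> 0"
        using LIMSEQ_subseq_LIMSEQ[OF LIMSEQ_subseq_LIMSEQ[OF t(3) u(1)] that(1)] by (simp add: o_def)
      then have "(\<lambda>n. ?d (t (u (v n))) (r (v n))) \<longlonglongrightarrow> 0"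
        using feynman_kac_small_time[OF \<phi>, of "\<lambda>n. t (u (v n))" "r \<circ> v" r'] t that(2) by (auto simp: less_imp_le o_def)
      then have "eventually (\<lambda>n. ?d (t (u (v n))) (r (v n)) < \<epsilon> / 2) sequentially"
        using \<epsilon>(1) by (intro order_tendstoD) auto
      then obtain n where "?d (t (u (v n))) (r (v n)) < \<epsilon> / 2"
        by (auto simp: eventually_sequentially)
      then show False using r[of "v n"] by simp
    qed
    show False
    proof (cases "filterlim r at_infinity sequentially")
      case True
      show False by (rule no[of id 0]) (use True in \<open>auto simp: strict_mono_def\<close>)
    next
      case False
      then obtain R where "\<not> eventually (\<lambda>n. R \<le> norm (r n)) sequentially"
        using filterlim_at_infinity[of 0 r sequentially] by auto
      then obtain v :: "nat \<Rightarrow> nat" where v: "strict_mono v" "\<And>n. \<not> R \<le> norm (r (v n))"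
        using not_eventually_sequentiallyD by blast
      have "bounded (range (r \<circ> v))"
        unfolding bounded_iff using v(2) by (intro exI[of _ R]) (auto simp: not_le less_imp_le)
      then obtain l w where w: "strict_mono (w :: nat \<Rightarrow> nat)" "((r \<circ> v) \<circ> w) \<longlonglongrightarrow> l"
        using bounded_imp_convergent_subsequence by blast
      show False
        by (rule no[of "v \<circ> w" l]) (use v w in \<open>auto simp: o_assoc strict_mono_o\<close>)
    qed
  qed
qed simp

lemma feynman_kac_C0_semigroup:
  "C0_semigroup_on (weighted_space (\<alpha> / b)) (weighted_norm (\<alpha> / b)) fk"
  unfolding C0_semigroup_on_def
proof (intro conjI allI impI ballI)
  fix t :: real and c \<phi> assume t: "0 \<le> t" and \<phi>: "\<phi> \<in> weighted_space (\<alpha> / b)"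
  show "fk t \<phi> \<in> weighted_space (\<alpha> / b)" by (rule feynman_kac_in_space[OF \<phi> t])
  show "fk t (\<lambda>x. \<phi> x + \<psi> x) = (\<lambda>x. fk t \<phi> x + fk t \<psi> x)" if "\<psi> \<in> weighted_space (\<alpha> / b)" for \<psi>
    by (rule feynman_kac_linear(1)[OF \<phi> t that])
  show "fk t (\<lambda>x. c * \<phi> x) = (\<lambda>x. c * fk t \<phi> x)" by (rule feynman_kac_linear(2)[OF \<phi> t])
  show "fk (s + t) \<phi> = fk s (fk t \<phi>)" if "0 \<le> s" for s by (rule feynman_kac_semigroup[OF \<phi> that t])
next
  fix \<phi> assume \<phi>: "\<phi> \<in> weighted_space (\<alpha> / b)"
  show "fk 0 \<phi> = \<phi>" by (rule feynman_kac_zero[OF \<phi>])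
  show "((\<lambda>t. weighted_norm (\<alpha> / b) (\<lambda>x. fk t \<phi> x - \<phi> x)) \<longlongrightarrow> 0) (at_right 0)"
    by (rule feynman_kac_strongly_continuous[OF \<phi>])
qed (rule feynman_kac_bounded)

end

end

section \<open>Moment generating functions of bounded variables\<close>

lemma exp_remainder_le:
  fixes y :: real
  assumes "\<bar>y\<bar> \<le> 1"
  shows "\<bar>exp y - 1 - y\<bar> \<le> y\<^sup>2"
proof -
  have lower: "1 + y \<le> exp y" by (rule exp_ge_add_one_self)
  have "exp y \<le> 1 + y + y\<^sup>2"
  proof (cases "0 \<le> y")
    case True
    then show ?thesis using exp_bound[of y] assms by simp
  next
    case False
    define x where "x = - y"
    have x: "0 < x" "x \<le> 1" using False assms by (auto simp: x_def)
    have "(1 + x) * (1 - x + x\<^sup>2) = 1 + x * x\<^sup>2" by (simp add: algebra_simps power2_eq_square)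
    then have "1 \<le> (1 + x) * (1 - x + x\<^sup>2)" using x by simp
    also have "\<dots> \<le> exp x * (1 - x + x\<^sup>2)"
    proof (rule mult_right_mono[OF exp_ge_add_one_self])
      show "0 \<le> 1 - x + x\<^sup>2" using x by simp
    qed
    finally show ?thesis by (simp add: x_def exp_minus field_simps)
  qed
  with lower zero_le_power2[of y] show ?thesis by linarith
qed

text \<open>The function \<open>N\<close> will be a moment generating function of this kind, with \<open>\<mu>\<close> a discounted measure
  on times and \<open>u\<close> a bounded change of time.\<close>

locale bounded_mgf = finite_measure \<mu> for \<mu> :: "real measure" +
  fixes u :: "real \<Rightarrow> real"
  assumes sets_\<mu>: "sets \<mu> = sets borel"
    and u_measurable: "u \<in> borel_measurable borel"
    and u_nonneg: "\<And>t. 0 \<le> u t" and u_le_1: "\<And>t. u t \<le> 1"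
begin

definition mgf :: "nat \<Rightarrow> real \<Rightarrow> real" where
  "mgf j x = (\<integral>t. u t ^ j * exp (x * u t) \<partial>\<mu>)"

lemma u_measurable' [measurable]: "u \<in> borel_measurable \<mu>"
  using u_measurable by (simp cong: measurable_cong_sets add: measurable_cong_sets[OF sets_\<mu> refl])

lemma mgf_bound: "u t ^ j * exp (x * u t) \<le> exp \<bar>x\<bar>" "0 \<le> u t ^ j * exp (x * u t)"
proof -
  have "u t ^ j \<le> 1" using u_nonneg u_le_1 by (intro power_le_one)
  moreover have "x * u t \<le> \<bar>x\<bar>"
    using mult_mono[of x "\<bar>x\<bar>" "u t" 1] u_nonneg[of t] u_le_1[of t] by simp
  ultimately have "u t ^ j * exp (x * u t) \<le> 1 * exp \<bar>x\<bar>"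
    by (intro mult_mono) auto
  then show "u t ^ j * exp (x * u t) \<le> exp \<bar>x\<bar>" by simp
  show "0 \<le> u t ^ j * exp (x * u t)" using u_nonneg by simp
qed

lemma integrable_mgf: "integrable \<mu> (\<lambda>t. u t ^ j * exp (x * u t))"
  by (rule integrable_const_bound[of _ "exp \<bar>x\<bar>"]) (use mgf_bound in auto)

lemma mgf_nonneg: "0 \<le> mgf j x"
  unfolding mgf_def by (intro Bochner_Integration.integral_nonneg mgf_bound)

lemma mgf_Suc_le: "mgf (Suc j) x \<le> mgf j x"
  unfolding mgf_def
proof (intro integral_mono integrable_mgf)
  fix t
  have "u t ^ Suc j \<le> u t ^ j" using u_nonneg u_le_1 by (intro power_decreasing) auto
  then show "u t ^ Suc j * exp (x * u t) \<le> u t ^ j * exp (x * u t)" by (rule mult_right_mono) simp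
qed

text \<open>For \<open>|h| \<le> 1\<close> the second-order remainder of the exponential is at most \<open>h\<^sup>2\<close>, uniformly in \<open>t\<close>.\<close>

lemma mgf_derivative: "(mgf j has_real_derivative mgf (Suc j) x) (at x)"
  unfolding DERIV_def
proof -
  let ?K = "exp \<bar>x\<bar> * measure \<mu> (space \<mu>)"
  have rem: "\<bar>mgf j (x + h) - mgf j x - h * mgf (Suc j) x\<bar> \<le> h\<^sup>2 * ?K" if h: "\<bar>h\<bar> \<le> 1" for h
  proof -
    have e: "u t ^ j * exp ((x + h) * u t) - u t ^ j * exp (x * u t) - h * (u t ^ Suc j * exp (x * u t))
       = u t ^ j * exp (x * u t) * (exp (h * u t) - 1 - h * u t)" for t
      by (simp add: algebra_simps mult_exp_exp[symmetric])
    have d: "mgf j (x + h) - mgf j x - h * mgf (Suc j) x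
       = (\<integral>t. u t ^ j * exp ((x + h) * u t) - u t ^ j * exp (x * u t) - h * (u t ^ Suc j * exp (x * u t)) \<partial>\<mu>)"
      unfolding mgf_def using integrable_mgf[of j "x + h"] integrable_mgf[of j x] integrable_mgf[of "Suc j" x]
      by (simp del: power_Suc)
    have "\<bar>mgf j (x + h) - mgf j x - h * mgf (Suc j) x\<bar> \<le> (\<integral>t. \<bar>u t ^ j * exp ((x + h) * u t) - u t ^ j * exp (x * u t) - h * (u t ^ Suc j * exp (x * u t))\<bar> \<partial>\<mu>)"
      unfolding d by (rule integral_abs_bound)
    also have "\<dots> \<le> (\<integral>t. exp \<bar>x\<bar> * h\<^sup>2 \<partial>\<mu>)"
    proof (rule integral_mono)
      show "integrable \<mu> (\<lambda>t. \<bar>u t ^ j * exp ((x + h) * u t) - u t ^ j * exp (x * u t) - h * (u t ^ Suc j * exp (x * u t))\<bar>)"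
        by (intro integrable_abs Bochner_Integration.integrable_diff integrable_mult_right integrable_mgf)
      fix t
      have "\<bar>h * u t\<bar> \<le> \<bar>h\<bar>"
        using u_nonneg[of t] u_le_1[of t] by (simp add: abs_mult mult_left_le)
      then have "\<bar>exp (h * u t) - 1 - h * u t\<bar> \<le> (h * u t)\<^sup>2"
        using h by (intro exp_remainder_le) linarith
      also have "\<dots> \<le> h\<^sup>2"
        using \<open>\<bar>h * u t\<bar> \<le> \<bar>h\<bar>\<close> by (simp add: abs_le_square_iff)
      finally have "\<bar>exp (h * u t) - 1 - h * u t\<bar> \<le> h\<^sup>2" .
      moreover have "\<bar>u t ^ j * exp (x * u t)\<bar> \<le> exp \<bar>x\<bar>" using mgf_bound[of t j x] by simp
      ultimately show "\<bar>u t ^ j * exp ((x + h) * u t) - u t ^ j * exp (x * u t) - h * (u t ^ Suc j * exp (x * u t))\<bar> \<le> exp \<bar>x\<bar> * h\<^sup>2"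
        unfolding e abs_mult[of "u t ^ j * exp (x * u t)"] by (intro mult_mono) auto
    qed simp
    also have "\<dots> = h\<^sup>2 * ?K" by simp
    finally show ?thesis .
  qed
  have "((\<lambda>h. (mgf j (x + h) - mgf j x) / h - mgf (Suc j) x) \<longlongrightarrow> 0) (at 0)"
  proof (rule Lim_null_comparison)
    have "eventually (\<lambda>h. \<bar>h\<bar> \<le> 1 \<and> h \<noteq> 0) (at (0::real))"
      unfolding eventually_at by (intro exI[of _ 1]) (auto simp: dist_real_def)
    then show "\<forall>\<^sub>F h in at 0. norm ((mgf j (x + h) - mgf j x) / h - mgf (Suc j) x) \<le> \<bar>h\<bar> * ?K"
    proof eventually_elim
      case (elim h)
      have "(mgf j (x + h) - mgf j x) / h - mgf (Suc j) x = (mgf j (x + h) - mgf j x - h * mgf (Suc j) x) / h"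
        using elim by (simp add: field_simps)
      then have "norm ((mgf j (x + h) - mgf j x) / h - mgf (Suc j) x) = \<bar>mgf j (x + h) - mgf j x - h * mgf (Suc j) x\<bar> / \<bar>h\<bar>"
        by (simp add: abs_divide)
      also have "\<dots> \<le> h\<^sup>2 * ?K / \<bar>h\<bar>"
        using rem[of h] elim by (intro divide_right_mono) auto
      also have "\<dots> = \<bar>h\<bar> * ?K"
        using elim by (simp add: power2_eq_square abs_if field_simps)
      finally show ?case .
    qed
    have "((\<lambda>h. \<bar>h\<bar> * ?K) \<longlongrightarrow> \<bar>0::real\<bar> * ?K) (at 0)"
      by (intro tendsto_intros)
    then show "((\<lambda>h. \<bar>h\<bar> * ?K) \<longlongrightarrow> 0) (at (0::real))" by simp
  qed
  then show "((\<lambda>h. (mgf j (x + h) - mgf j x) / h) \<longlongrightarrow> mgf (Suc j) x) (at 0)"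
    by (rule LIM_zero_cancel)
qed

lemma mgf_mono: "x \<le> y \<Longrightarrow> mgf j x \<le> mgf j y"
  unfolding mgf_def using u_nonneg
  by (intro integral_mono integrable_mgf mult_left_mono) (auto intro: mult_right_mono)

lemma mgf_pos:
  assumes "emeasure \<mu> (space \<mu>) \<noteq> 0"
  shows "0 < mgf 0 x"
proof -
  have "mgf 0 x \<noteq> 0"
  proof
    assume "mgf 0 x = 0"
    then have "AE t in \<mu>. u t ^ 0 * exp (x * u t) = 0"
      unfolding mgf_def using integral_nonneg_eq_0_iff_AE[OF integrable_mgf[of 0 x]] mgf_bound(2) by simp
    then have "AE t in \<mu>. False" by simp
    then show False using assms by (simp add: eventually_False ae_filter_eq_bot_iff)
  qed
  with mgf_nonneg[of 0 x] show ?thesis by linarith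
qed

lemma mgf_exp_decay:
  assumes "AE t in \<mu>. u t < 1"
  shows "((\<lambda>x. mgf 0 x * exp (- x)) \<longlongrightarrow> 0) at_top"
proof (rule tendsto_at_topI_sequentially)
  fix X :: "nat \<Rightarrow> real" assume X: "filterlim X at_top sequentially"
  have X': "filterlim (\<lambda>n. max 0 (X n)) at_top sequentially"
    by (rule filterlim_at_top_mono[OF X]) simp
  have "(\<lambda>n. \<integral>t. exp (max 0 (X n) * (u t - 1)) \<partial>\<mu>) \<longlonglongrightarrow> (\<integral>t. 0 \<partial>\<mu>)"
  proof (rule integral_dominated_convergence[where w="\<lambda>_. 1"])
    show "AE t in \<mu>. (\<lambda>n. exp (max 0 (X n) * (u t - 1))) \<longlonglongrightarrow> 0"
      using assms
    proof eventually_elim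
      case (elim t)
      then have "filterlim (\<lambda>n. (u t - 1) * max 0 (X n)) at_bot sequentially"
        by (intro filterlim_tendsto_neg_mult_at_bot[OF tendsto_const _ X']) simp
      then show ?case by (intro filterlim_compose[OF exp_at_bot]) (simp add: mult.commute)
    qed
    show "AE t in \<mu>. norm (exp (max 0 (X n) * (u t - 1))) \<le> 1" for n
      using u_le_1 by (intro AE_I2) (simp add: mult_nonneg_nonpos)
  qed auto
  moreover have "eventually (\<lambda>n. (\<integral>t. exp (max 0 (X n) * (u t - 1)) \<partial>\<mu>) = mgf 0 (X n) * exp (- X n)) sequentially"
  proof -
    have "eventually (\<lambda>n. 0 \<le> X n) sequentially" using X by (simp add: filterlim_at_top)
    then show ?thesis
    proof eventually_elim
      case (elim n)
      have "(\<integral>t. exp (max 0 (X n) * (u t - 1)) \<partial>\<mu>) = (\<integral>t. (u t ^ 0 * exp (X n * u t)) * exp (- X n) \<partial>\<mu>)"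
        using elim by (intro Bochner_Integration.integral_cong refl) (simp add: mult_exp_exp algebra_simps)
      then show ?case unfolding mgf_def by simp
    qed
  qed
  ultimately show "(\<lambda>n. mgf 0 (X n) * exp (- X n)) \<longlonglongrightarrow> 0"
    by (simp add: Lim_transform_eventually)
qed

end

section \<open>The function \<open>N\<close>\<close>

context vasicek
begin

text \<open>The correction terms to linear growth are negative: \<open>(1 - q\<^sup>2) / 2\<close> is at most \<open>2 (1 - q)\<close>.\<close>

lemma log_mass_le:
  assumes "0 \<le> \<theta>" "0 \<le> t"
  shows "log_mass \<theta> t \<le> (\<theta> * a / b + \<theta>\<^sup>2 * \<sigma>\<^sup>2 / (2 * b\<^sup>2)) * t"
proof -
  let ?q = "decay t"
  have q: "0 < ?q" "?q \<le> 1" using decay_le_1[OF assms(2)] by auto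
  have "(1 - ?q) / b \<ge> 0" using q b_pos by simp
  then have 1: "\<theta> * (a / b) * (t - (1 - ?q) / b) \<le> \<theta> * (a / b) * t"
    using assms a_pos b_pos by (intro mult_left_mono) auto
  have "1 - ?q\<^sup>2 \<le> 4 * (1 - ?q)"
    using mult_right_mono[of "1 + ?q" 4 "1 - ?q"] q by (simp add: power2_eq_square algebra_simps)
  then have "(1 - ?q\<^sup>2) / (2 * b) \<le> 2 * (1 - ?q) / b"
  proof -
    assume "1 - ?q\<^sup>2 \<le> 4 * (1 - ?q)"
    then have "(1 - ?q\<^sup>2) / (2 * b) \<le> 4 * (1 - ?q) / (2 * b)"
      using b_pos by (intro divide_right_mono) auto
    moreover have "4 * x / (2 * b) = 2 * x / b" for x by simp
    ultimately show ?thesis by (simp only:)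
  qed
  then have 2: "\<theta>\<^sup>2 * \<sigma>\<^sup>2 / (2 * b\<^sup>2) * (t - 2 * (1 - ?q) / b + (1 - ?q\<^sup>2) / (2 * b)) \<le> \<theta>\<^sup>2 * \<sigma>\<^sup>2 / (2 * b\<^sup>2) * t"
    by (intro mult_left_mono) auto
  show ?thesis using add_mono[OF 1 2] unfolding log_mass_def by (simp add: distrib_right)
qed

lemma decay_derivative: "(decay has_real_derivative - b * decay t) (at t within S)"
  unfolding decay_def by (auto intro!: derivative_eq_intros)

lemma log_mass_derivative:
  "(log_mass \<theta> has_real_derivative \<theta> * (a / b) * (1 - decay t) + \<theta>\<^sup>2 * \<sigma>\<^sup>2 / (2 * b\<^sup>2) * (1 - decay t)\<^sup>2) (at t within S)"
proof -
  have b0: "b \<noteq> 0" using b_pos by simp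
  have d1: "((\<lambda>t. t - (1 - decay t) / b) has_real_derivative 1 - decay t) (at t within S)"
    by (auto intro!: derivative_eq_intros decay_derivative simp: b0)
  have d2: "((\<lambda>t. t - 2 * (1 - decay t) / b + (1 - (decay t)\<^sup>2) / (2 * b)) has_real_derivative (1 - decay t)\<^sup>2) (at t within S)"
    by (auto intro!: derivative_eq_intros decay_derivative simp: b0 power2_eq_square algebra_simps)
  show ?thesis
    using DERIV_add[OF DERIV_cmult[OF d1, of "\<theta> * (a / b)"] DERIV_cmult[OF d2, of "\<theta>\<^sup>2 * \<sigma>\<^sup>2 / (2 * b\<^sup>2)"]]
    unfolding log_mass_def[abs_def] .
qed

end

locale vasicek_discounted = vasicek M F W \<rho> a b \<sigma>
  for M :: "'a measure" and F :: "ennreal \<Rightarrow> 'a measure" and W :: "real \<Rightarrow> 'a \<Rightarrow> real"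
    and \<rho> :: "real \<Rightarrow> real \<Rightarrow> 'a \<Rightarrow> real" and a b \<sigma> :: real +
  fixes \<alpha> \<gamma> :: real
  assumes \<alpha>: "0 < \<alpha>" "\<alpha> < 1"
    and \<gamma>: "\<alpha> * a / b + \<alpha>\<^sup>2 * \<sigma>\<^sup>2 / ((1 - \<alpha>) * b\<^sup>2) < \<gamma>"
begin

text \<open>The exponent that multiplies \<open>\<integral>r\<close> in the definition of \<open>N\<close>.\<close>

definition conj_exp :: real where "conj_exp = \<alpha> / (1 - \<alpha>)"

definition log_weight :: "real \<Rightarrow> real" where
  "log_weight t = log_mass conj_exp t - \<gamma> / (1 - \<alpha>) * t"

definition log_weight_rate :: "real \<Rightarrow> real" where
  "log_weight_rate t = conj_exp * (a / b) * (1 - decay t) + conj_exp\<^sup>2 * \<sigma>\<^sup>2 / (2 * b\<^sup>2) * (1 - decay t)\<^sup>2 - \<gamma> / (1 - \<alpha>)"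

text \<open>The exponential rate at which the integrand of \<open>N\<close> decays in time. Its positivity is what the
  lower bound on \<open>\<gamma>\<close> provides.\<close>

definition discount_gap :: real where
  "discount_gap = \<gamma> / (1 - \<alpha>) - (conj_exp * a / b + conj_exp\<^sup>2 * \<sigma>\<^sup>2 / (2 * b\<^sup>2))"

definition N_law :: "real measure" where
  "N_law = density lborel (\<lambda>t. ennreal (indicator {0..} t * exp (log_weight t)))"

text \<open>Clipped at \<open>0\<close> in order to stay in \<open>[0, 1)\<close> everywhere; negative times have no mass.\<close>

definition time_change :: "real \<Rightarrow> real" where
  "time_change t = 1 - decay (max 0 t)"

lemma conj_exp_pos: "0 < conj_exp"
  using \<alpha> by (simp add: conj_exp_def)

lemma gamma_pos: "0 < \<gamma>"
proof -
  have "0 \<le> \<alpha> * a / b + \<alpha>\<^sup>2 * \<sigma>\<^sup>2 / ((1 - \<alpha>) * b\<^sup>2)"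
    using \<alpha> a_pos b_pos by (intro add_nonneg_nonneg divide_nonneg_nonneg) auto
  with \<gamma> show ?thesis by linarith
qed

lemma discount_gap_pos: "0 < discount_gap"
proof -
  have e: "(conj_exp * a / b + conj_exp\<^sup>2 * \<sigma>\<^sup>2 / (2 * b\<^sup>2)) * (1 - \<alpha>) = \<alpha> * a / b + \<alpha>\<^sup>2 * \<sigma>\<^sup>2 / ((1 - \<alpha>) * b\<^sup>2) / 2"
  proof -
    have "(x / C * a / b + (x / C)\<^sup>2 * s / (2 * b\<^sup>2)) * C = x * a / b + x\<^sup>2 * s / (C * b\<^sup>2) / 2" if "C \<noteq> 0" for C x s :: real
      using that b_pos by (simp add: field_simps power2_eq_square)
    from this[of "1 - \<alpha>" \<alpha> "\<sigma>\<^sup>2"] show ?thesis unfolding conj_exp_def using \<alpha> by simp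
  qed
  have "0 \<le> \<alpha>\<^sup>2 * \<sigma>\<^sup>2 / ((1 - \<alpha>) * b\<^sup>2)"
    using \<alpha> by (intro divide_nonneg_nonneg) auto
  then have "(conj_exp * a / b + conj_exp\<^sup>2 * \<sigma>\<^sup>2 / (2 * b\<^sup>2)) * (1 - \<alpha>) < \<gamma>"
    unfolding e
  proof -
    have "x + y / 2 < g" if "0 \<le> y" "x + y < g" for x y g :: real using that by linarith
    then show "0 \<le> \<alpha>\<^sup>2 * \<sigma>\<^sup>2 / ((1 - \<alpha>) * b\<^sup>2) \<Longrightarrow> \<alpha> * a / b + \<alpha>\<^sup>2 * \<sigma>\<^sup>2 / ((1 - \<alpha>) * b\<^sup>2) / 2 < \<gamma>"
      using \<gamma> by blast
  qed
  then show ?thesis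
    using \<alpha> unfolding discount_gap_def by (simp add: pos_less_divide_eq)
qed

lemma log_weight_le: "0 \<le> t \<Longrightarrow> log_weight t \<le> - discount_gap * t"
  using log_mass_le[of conj_exp t] conj_exp_pos
  unfolding log_weight_def discount_gap_def by (simp add: algebra_simps)

lemma log_weight_derivative: "(log_weight has_real_derivative log_weight_rate t) (at t within S)"
  unfolding log_weight_def[abs_def] log_weight_rate_def
  by (rule derivative_eq_intros log_mass_derivative refl | simp)+

lemma continuous_parameters:
  "continuous_on S decay" "continuous_on S log_weight" "continuous_on S log_weight_rate"
proof -
  show d: "continuous_on S decay" using decay_derivative by (rule DERIV_continuous_on)
  show "continuous_on S log_weight" using log_weight_derivative by (rule DERIV_continuous_on)
  show "continuous_on S log_weight_rate" unfolding log_weight_rate_def by (intro continuous_intros d)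
qed

lemma measurable_parameters [measurable]:
  "decay \<in> borel_measurable borel" "log_weight \<in> borel_measurable borel" "log_weight_rate \<in> borel_measurable borel"
  by (auto intro!: borel_measurable_continuous_onI continuous_parameters)

lemma log_weight_rate_bounded: "\<exists>D. \<forall>t\<ge>0. \<bar>log_weight_rate t\<bar> \<le> D"
proof (intro exI allI impI)
  fix t :: real assume t: "0 \<le> t"
  let ?q = "decay t"
  have q: "0 < ?q" "?q \<le> 1" using decay_le_1[OF t] by auto
  have A: "0 \<le> conj_exp * (a / b)" and B: "0 \<le> conj_exp\<^sup>2 * \<sigma>\<^sup>2 / (2 * b\<^sup>2)"
    and x: "0 \<le> 1 - ?q" "1 - ?q \<le> 1" "0 \<le> (1 - ?q)\<^sup>2" "(1 - ?q)\<^sup>2 \<le> 1"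
    using q conj_exp_pos a_pos b_pos by (auto intro!: power_le_one simp: less_imp_le)
  note mult_unit_interval[OF A x(1,2)] mult_unit_interval[OF B x(3,4)]
  moreover have "0 \<le> \<gamma> / (1 - \<alpha>)" using gamma_pos \<alpha> by simp
  ultimately show "\<bar>log_weight_rate t\<bar> \<le> conj_exp * (a / b) + conj_exp\<^sup>2 * \<sigma>\<^sup>2 / (2 * b\<^sup>2) + \<gamma> / (1 - \<alpha>)"
    unfolding log_weight_rate_def by linarith
qed

lemma integrable_discount: "integrable lborel (\<lambda>t. indicator {0..} t * exp (- discount_gap * t))"
proof -
  interpret E: prob_space "density lborel (exponential_density discount_gap)"
    by (rule prob_space_exponential_density[OF discount_gap_pos])
  have "integrable (density lborel (exponential_density discount_gap)) (\<lambda>_. 1 / discount_gap)"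
    by simp
  then have "integrable lborel (\<lambda>t. exponential_density discount_gap t * (1 / discount_gap))"
    by (subst (asm) integrable_density) (auto simp: exponential_density_def discount_gap_pos less_imp_le)
  also have "(\<lambda>t. exponential_density discount_gap t * (1 / discount_gap)) = (\<lambda>t. indicator {0..} t * exp (- discount_gap * t))"
    using discount_gap_pos by (auto simp: exponential_density_def indicator_def mult.commute fun_eq_iff)
  finally show ?thesis .
qed

lemma integrable_weight:
  assumes "h \<in> borel_measurable borel" "\<And>t. 0 \<le> t \<Longrightarrow> \<bar>h t\<bar> \<le> K"
  shows "integrable lborel (\<lambda>t. indicator {0..} t * exp (log_weight t) * h t)"
proof (rule Bochner_Integration.integrable_bound[OF integrable_mult_right[OF integrable_discount, of K]])
  have [measurable]: "h \<in> borel_measurable lborel" using assms by simp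
  show "(\<lambda>t. indicator {0..} t * exp (log_weight t) * h t) \<in> borel_measurable lborel" by measurable
  show "AE t in lborel. norm (indicator {0..} t * exp (log_weight t) * h t) \<le> norm (K * (indicator {0..} t * exp (- discount_gap * t)))"
  proof (intro AE_I2)
    fix t :: real
    have K: "0 \<le> K" using assms(2)[of 0] by simp
    show "norm (indicator {0..} t * exp (log_weight t) * h t) \<le> norm (K * (indicator {0..} t * exp (- discount_gap * t)))"
    proof (cases "0 \<le> t")
      case True
      have "exp (log_weight t) * \<bar>h t\<bar> \<le> exp (- discount_gap * t) * K"
        using assms(2)[OF True] log_weight_le[OF True] by (intro mult_mono) auto
      then show ?thesis using True K by (simp add: abs_mult mult.commute)
    qed simp
  qed
qed

lemma N_law_mgf: "bounded_mgf N_law time_change"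
proof -
  have "(\<integral>\<^sup>+t. ennreal (indicator {0..} t * exp (log_weight t)) \<partial>lborel) < \<infinity>"
    using integrableD(2)[OF integrable_weight[of "\<lambda>_. 1" 1]] by (simp add: top.not_eq_extremum)
  then have "finite_measure N_law"
    by (intro finite_measureI) (simp add: N_law_def emeasure_density)
  then show ?thesis
    using decay_le_1 decay_pos[THEN less_imp_le]
    by (intro bounded_mgf.intro bounded_mgf_axioms.intro) (auto simp: N_law_def time_change_def[abs_def])
qed

sublocale Nm: bounded_mgf N_law time_change by (rule N_law_mgf)

lemma N_law_integral:
  assumes [measurable]: "h \<in> borel_measurable borel"
  shows "(\<integral>t. h t \<partial>N_law) = (\<integral>t. indicator {0..} t * exp (log_weight t) * h t \<partial>lborel)"
  unfolding N_law_def by (subst integral_density) auto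

lemma N_law_nonzero: "emeasure N_law (space N_law) \<noteq> 0"
proof
  assume "emeasure N_law (space N_law) = 0"
  then have "(\<integral>\<^sup>+t. ennreal (indicator {0..} t * exp (log_weight t)) \<partial>lborel) = 0"
    by (simp add: N_law_def emeasure_density)
  then have "AE t in lborel. ennreal (indicator {0..} t * exp (log_weight t)) = 0"
    by (subst (asm) nn_integral_0_iff_AE) auto
  then have "AE t in lborel. t \<notin> {0..1::real}"
    by eventually_elim (auto simp: indicator_def)
  then have "emeasure lborel {0..1::real} = 0"
    by (subst (asm) AE_iff_measurable[of "{0..1}"]) auto
  then show False by simp
qed

definition N_fun :: "real \<Rightarrow> real" where
  "N_fun r = Nm.mgf 0 (conj_exp / b * r)"

lemma N_fun_pos: "0 < N_fun r"
  unfolding N_fun_def by (rule Nm.mgf_pos[OF N_law_nonzero])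

text \<open>Tonelli's theorem, and the kernel formula with the constant function \<open>1\<close> at each time.\<close>

lemma value_N_eq: "value_N M \<alpha> \<gamma> \<rho> r = ennreal (N_fun r)"
proof -
  interpret P: pair_sigma_finite M lborel ..
  let ?f = "\<lambda>t \<omega>. ennreal (exp (1 / (1 - \<alpha>) * (- \<gamma> * t + \<alpha> * cum_rate r t \<omega>))) * indicator {0..} t"
  have [measurable]: "(\<lambda>z. cum_rate r (snd z) (fst z)) \<in> borel_measurable (M \<Otimes>\<^sub>M lborel)"
    using measurable_compose[OF measurable_pair_swap' cum_rate_joint_measurable[of r]]
    by (simp add: case_prod_beta cong: measurable_cong_sets)
  have "value_N M \<alpha> \<gamma> \<rho> r = (\<integral>\<^sup>+\<omega>. \<integral>\<^sup>+t. ?f t \<omega> \<partial>lborel \<partial>M)"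
    unfolding value_N_def ..
  also have "\<dots> = (\<integral>\<^sup>+t. \<integral>\<^sup>+\<omega>. ?f t \<omega> \<partial>M \<partial>lborel)"
    by (rule P.Fubini'[symmetric]) (simp add: case_prod_beta)
  also have "\<dots> = (\<integral>\<^sup>+t. ennreal (indicator {0..} t * exp (log_weight t) * exp (conj_exp / b * r * time_change t)) \<partial>lborel)"
  proof (rule nn_integral_cong)
    fix t :: real
    show "(\<integral>\<^sup>+\<omega>. ?f t \<omega> \<partial>M) = ennreal (indicator {0..} t * exp (log_weight t) * exp (conj_exp / b * r * time_change t))"
    proof (cases "0 \<le> t")
      case True
      have e: "ennreal (exp (1 / (1 - \<alpha>) * (- \<gamma> * t + \<alpha> * cum_rate r t \<omega>))) = ennreal (exp (- \<gamma> / (1 - \<alpha>) * t)) * (1 * ennreal (exp (conj_exp * cum_rate r t \<omega>)))" for \<omega>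
        using \<alpha> unfolding mult_1_left ennreal_mult[OF exp_ge_zero exp_ge_zero, symmetric] mult_exp_exp conj_exp_def
        by (simp add: distrib_left add_divide_distrib diff_divide_distrib)
      have [measurable]: "cum_rate r t \<in> borel_measurable M" by (rule cum_rate_measurable)
      have "(\<integral>\<^sup>+\<omega>. ?f t \<omega> \<partial>M) = ennreal (exp (- \<gamma> / (1 - \<alpha>) * t)) * (\<integral>\<^sup>+\<omega>. 1 * ennreal (exp (conj_exp * cum_rate r t \<omega>)) \<partial>M)"
        unfolding e using True by (subst nn_integral_cmult[symmetric]) auto
      also have "(\<integral>\<^sup>+\<omega>. 1 * ennreal (exp (conj_exp * cum_rate r t \<omega>)) \<partial>M) = ennreal (exp (conj_exp * r * (1 - decay t) / b + log_mass conj_exp t)) * (\<integral>\<^sup>+x. 1 \<partial>gauss)"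
        by (rule nn_integral_kernel[OF _ True]) simp
      also have "(\<integral>\<^sup>+x. 1 \<partial>gauss) = 1"
        using prob_space.emeasure_space_1[OF prob_space_std_normal] by simp
      also have "ennreal (exp (- \<gamma> / (1 - \<alpha>) * t)) * (ennreal (exp (conj_exp * r * (1 - decay t) / b + log_mass conj_exp t)) * 1)
         = ennreal (exp (log_weight t) * exp (conj_exp / b * r * time_change t))"
        unfolding mult_1_right ennreal_mult[OF exp_ge_zero exp_ge_zero, symmetric] mult_exp_exp log_weight_def time_change_def
        using True by (simp add: algebra_simps)
      finally show ?thesis using True by simp
    qed simp
  qed
  also have "\<dots> = ennreal (\<integral>t. indicator {0..} t * exp (log_weight t) * exp (conj_exp / b * r * time_change t) \<partial>lborel)"
  proof (rule nn_integral_eq_integral)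
    show "integrable lborel (\<lambda>t. indicator {0..} t * exp (log_weight t) * exp (conj_exp / b * r * time_change t))"
    proof (rule integrable_weight)
      show "(\<lambda>t. exp (conj_exp / b * r * time_change t)) \<in> borel_measurable borel"
        using Nm.u_measurable by measurable
      show "\<bar>exp (conj_exp / b * r * time_change t)\<bar> \<le> exp \<bar>conj_exp / b * r\<bar>" for t
        using Nm.mgf_bound(1)[of t 0 "conj_exp / b * r"] by (simp only: power_0 mult_1_left abs_exp_cancel)
    qed
  qed simp
  also have "(\<integral>t. indicator {0..} t * exp (log_weight t) * exp (conj_exp / b * r * time_change t) \<partial>lborel) = N_fun r"
    unfolding N_fun_def Nm.mgf_def using Nm.u_measurable by (subst N_law_integral) auto
  finally show ?thesis .
qed

abbreviation N_pw :: "real \<Rightarrow> real" where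
  "N_pw \<equiv> N_pow M \<alpha> \<gamma> \<rho>"

definition N1 :: "real \<Rightarrow> real" where "N1 r = Nm.mgf 1 (conj_exp / b * r)"
definition N2 :: "real \<Rightarrow> real" where "N2 r = Nm.mgf 2 (conj_exp / b * r)"

text \<open>Since the value is finite, no information is lost in passing to a real number.\<close>

lemma N_pow_eq: "N_pw = (\<lambda>r. N_fun r powr (1 - \<alpha>))"
  unfolding N_pow_def value_N_eq using N_fun_pos by (simp add: less_imp_le)

lemma N_fun_derivative:
  "(N_fun has_real_derivative conj_exp / b * N1 r) (at r)"
  "(N1 has_real_derivative conj_exp / b * N2 r) (at r)"
proof -
  have lin: "((\<lambda>r. conj_exp / b * r) has_real_derivative conj_exp / b) (at r)"
    by (rule DERIV_cmult_Id)
  show "(N_fun has_real_derivative conj_exp / b * N1 r) (at r)"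
    using DERIV_chain2[OF Nm.mgf_derivative[of 0] lin] unfolding N_fun_def[abs_def] N1_def by (simp add: mult.commute)
  show "(N1 has_real_derivative conj_exp / b * N2 r) (at r)"
    using DERIV_chain2[OF Nm.mgf_derivative[of 1] lin] unfolding N1_def[abs_def] N2_def
    by (simp add: mult.commute numeral_2_eq_2)
qed

lemma N_continuous: "continuous_on S N_fun" "continuous_on S N1" "continuous_on S N2"
proof -
  show "continuous_on S N_fun" "continuous_on S N1"
    by (rule DERIV_continuous_on, rule has_field_derivative_at_within[OF N_fun_derivative(1)])
      (rule DERIV_continuous_on, rule has_field_derivative_at_within[OF N_fun_derivative(2)])
  have c: "continuous_on UNIV (Nm.mgf 2)"
    by (rule DERIV_continuous_on, rule has_field_derivative_at_within[OF Nm.mgf_derivative])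
  show "continuous_on S N2"
    unfolding N2_def by (intro continuous_on_compose2[OF c] continuous_intros) auto
qed

lemma N_order: "0 \<le> N1 r" "N1 r \<le> N_fun r" "0 \<le> N2 r" "N2 r \<le> N_fun r"
  using Nm.mgf_nonneg Nm.mgf_Suc_le[of 0 "conj_exp / b * r"] Nm.mgf_Suc_le[of 1 "conj_exp / b * r"]
  by (auto simp: N1_def N2_def N_fun_def numeral_2_eq_2 intro: order_trans)

definition dN_pw :: "real \<Rightarrow> real" where
  "dN_pw r = (1 - \<alpha>) * N_fun r powr (- \<alpha>) * (conj_exp / b * N1 r)"

definition ddN_pw :: "real \<Rightarrow> real" where
  "ddN_pw r = (1 - \<alpha>) * (- \<alpha> * N_fun r powr (- \<alpha> - 1) * (conj_exp / b * N1 r) * (conj_exp / b * N1 r)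
    + N_fun r powr (- \<alpha>) * (conj_exp / b * (conj_exp / b * N2 r)))"

lemma N_pow_derivative: "(N_pw has_real_derivative dN_pw r) (at r)"
  using DERIV_fun_powr[OF N_fun_derivative(1) N_fun_pos, of "1 - \<alpha>" r]
  unfolding N_pow_eq dN_pw_def by (simp add: mult.assoc)

lemma dN_pow_derivative: "(dN_pw has_real_derivative ddN_pw r) (at r)"
proof -
  note d1 = DERIV_fun_powr[OF N_fun_derivative(1) N_fun_pos, of "- \<alpha>" r]
  note d2 = DERIV_cmult[OF N_fun_derivative(2)[of r], of "conj_exp / b"]
  note DERIV_cmult[OF DERIV_mult[OF d1 d2], of "1 - \<alpha>"]
  then show ?thesis
    unfolding dN_pw_def[abs_def] ddN_pw_def by (simp add: mult_ac)
qed

lemma deriv_N_pow: "deriv N_pw = dN_pw" "deriv dN_pw = ddN_pw"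
  by (auto intro!: ext DERIV_imp_deriv N_pow_derivative dN_pow_derivative)

lemma ddN_continuous: "continuous_on UNIV ddN_pw"
  unfolding ddN_pw_def using N_fun_pos[THEN less_imp_neq]
  by (intro continuous_intros N_continuous) (auto simp: less_imp_neq[OF N_fun_pos, symmetric])

lemma N_pow_C2: "C2_fun N_pw"
proof -
  have "f differentiable_on UNIV" if "\<And>r. (f has_real_derivative f' r) (at r)" for f f' :: "real \<Rightarrow> real"
    using that unfolding differentiable_on_def differentiable_def has_field_derivative_def by blast
  from this[OF N_pow_derivative] this[OF dN_pow_derivative] show ?thesis
    unfolding C2_fun_def deriv_N_pow using ddN_continuous by blast
qed

subsection \<open>Growth of \<open>N\<close>\<close>

lemma time_change_less_1: "time_change t < 1"
  by (simp add: time_change_def)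

text \<open>Raising \<open>N\<close> to the power \<open>1 - \<alpha>\<close> turns its exponential rate into the rate of the weight.\<close>

lemma conj_exp_weight: "(1 - \<alpha>) * (conj_exp / b) = \<alpha> / b"
  using \<alpha> by (simp add: conj_exp_def)

lemma weight_pos: "0 < \<alpha> / b"
  using \<alpha> b_pos by simp

lemma N_fun_mono: "r \<le> r' \<Longrightarrow> N_fun r \<le> N_fun r'"
  unfolding N_fun_def using conj_exp_pos b_pos by (intro Nm.mgf_mono mult_left_mono) auto

lemma N_pow_nonneg: "0 \<le> N_pw r"
  by (simp add: N_pow_def)

lemma N_pow_weighted_at_top: "((\<lambda>r. N_pw r * exp (- (\<alpha> / b) * \<bar>r\<bar>)) \<longlongrightarrow> 0) at_top"
proof -
  have lin: "filterlim (\<lambda>r. conj_exp / b * r) at_top at_top"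
    using conj_exp_pos b_pos by (intro filterlim_tendsto_pos_mult_at_top[OF tendsto_const _ filterlim_ident]) auto
  have "((\<lambda>x. Nm.mgf 0 x * exp (- x)) \<longlongrightarrow> 0) at_top"
    by (rule Nm.mgf_exp_decay) (simp add: time_change_less_1)
  from filterlim_compose[OF this lin]
  have "((\<lambda>r. N_fun r * exp (- (conj_exp / b * r))) \<longlongrightarrow> 0) at_top"
    by (simp add: N_fun_def)
  then have "((\<lambda>r. (N_fun r * exp (- (conj_exp / b * r))) powr (1 - \<alpha>)) \<longlongrightarrow> 0 powr (1 - \<alpha>)) at_top"
    using \<alpha> N_fun_pos by (intro tendsto_powr' tendsto_const) (auto simp: less_imp_le)
  then have lim: "((\<lambda>r. (N_fun r * exp (- (conj_exp / b * r))) powr (1 - \<alpha>)) \<longlongrightarrow> 0) at_top"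
    by simp
  have "eventually (\<lambda>r. (N_fun r * exp (- (conj_exp / b * r))) powr (1 - \<alpha>) = N_pw r * exp (- (\<alpha> / b) * \<bar>r\<bar>)) at_top"
    using eventually_ge_at_top[of 0]
  proof eventually_elim
    case (elim r)
    have "exp (- (conj_exp / b * r)) powr (1 - \<alpha>) = exp (- (((1 - \<alpha>) * (conj_exp / b)) * r))"
      by (simp add: exp_powr_real[symmetric] powr_def)
    also have "\<dots> = exp (- (\<alpha> / b) * \<bar>r\<bar>)" unfolding conj_exp_weight using elim by simp
    finally show ?case
      unfolding N_pow_eq using N_fun_pos[of r] by (simp add: powr_mult less_imp_le)
  qed
  then show ?thesis using lim by (rule Lim_transform_eventually[rotated])
qed

lemma exp_weight_at_bot: "((\<lambda>r. \<bar>r\<bar> * exp (- (\<alpha> / b) * \<bar>r\<bar>)) \<longlongrightarrow> 0) at_bot" "((\<lambda>r. exp (- (\<alpha> / b) * \<bar>r\<bar>)) \<longlongrightarrow> 0) at_bot"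
  "((\<lambda>r. exp (- (\<alpha> / b) * \<bar>r\<bar>)) \<longlongrightarrow> 0) at_top"
proof -
  have "((\<lambda>r. \<bar>r\<bar> * exp (- c * \<bar>r\<bar>)) \<longlongrightarrow> 0) at_bot" "((\<lambda>r. exp (- c * \<bar>r\<bar>)) \<longlongrightarrow> 0) at_bot"
    "((\<lambda>r. exp (- c * \<bar>r\<bar>)) \<longlongrightarrow> 0) at_top" if "0 < c" for c :: real
    using that by real_asymp+
  from this[OF weight_pos] show "((\<lambda>r. \<bar>r\<bar> * exp (- (\<alpha> / b) * \<bar>r\<bar>)) \<longlongrightarrow> 0) at_bot" "((\<lambda>r. exp (- (\<alpha> / b) * \<bar>r\<bar>)) \<longlongrightarrow> 0) at_bot"
  "((\<lambda>r. exp (- (\<alpha> / b) * \<bar>r\<bar>)) \<longlongrightarrow> 0) at_top" by auto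
qed

lemma N_pow_left_bound: "r \<le> 0 \<Longrightarrow> N_pw r \<le> N_pw 0"
  unfolding N_pow_eq using \<alpha> N_fun_mono[of r 0] N_fun_pos[of r] by (intro powr_mono2) auto

lemma N_pow_weighted_at_bot: "((\<lambda>r. N_pw r * exp (- (\<alpha> / b) * \<bar>r\<bar>)) \<longlongrightarrow> 0) at_bot"
proof (rule Lim_null_comparison)
  show "((\<lambda>r. N_pw 0 * exp (- (\<alpha> / b) * \<bar>r\<bar>)) \<longlongrightarrow> 0) at_bot"
    by (rule tendsto_mult_right_zero[OF exp_weight_at_bot(2)])
  show "\<forall>\<^sub>F r in at_bot. norm (N_pw r * exp (- (\<alpha> / b) * \<bar>r\<bar>)) \<le> N_pw 0 * exp (- (\<alpha> / b) * \<bar>r\<bar>)"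
    using eventually_le_at_bot[of 0]
    by eventually_elim (use N_pow_left_bound N_pow_nonneg in \<open>simp add: abs_mult mult_right_mono\<close>)
qed

lemma weighted_space_realI:
  assumes "continuous_on UNIV \<phi>"
    and "((\<lambda>r. \<phi> r * exp (- c * \<bar>r\<bar>)) \<longlongrightarrow> 0) at_top" "((\<lambda>r. \<phi> r * exp (- c * \<bar>r\<bar>)) \<longlongrightarrow> 0) at_bot"
  shows "\<phi> \<in> weighted_space c"
proof -
  have "((\<lambda>r. \<phi> r * exp (- c * \<bar>r\<bar>)) \<longlongrightarrow> 0) at_infinity"
    unfolding at_infinity_eq_at_top_bot by (rule filterlim_sup[OF assms(2,3)])
  from tendsto_rabs_zero[OF this] show ?thesis
    using assms(1) by (simp add: weighted_space_def abs_mult)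
qed

lemma N_pow_in_space: "N_pw \<in> weighted_space (\<alpha> / b)"
proof (rule weighted_space_realI[OF _ N_pow_weighted_at_top N_pow_weighted_at_bot])
  show "continuous_on UNIV N_pw"
    by (rule DERIV_continuous_on, rule has_field_derivative_at_within[OF N_pow_derivative])
qed

subsection \<open>The generator\<close>

text \<open>The terms of the generator with the unbounded coefficient \<open>r\<close>, up to the factor
  \<open>\<alpha> N\<^sup>-\<^sup>\<alpha>\<close>. A direct estimate by \<open>|r| N\<close> would not be good enough for large positive \<open>r\<close>.\<close>

definition N_drift :: "real \<Rightarrow> real" where
  "N_drift r = r * (N_fun r - N1 r)"

lemma log_weight_0: "log_weight 0 = 0"
  by (simp add: log_weight_def log_mass_def)

text \<open>The function \<open>g t = exp (log_weight t + C r (1 - e\<^sup>-\<^sup>b\<^sup>t))\<close> falls from \<open>1\<close> to \<open>0\<close> on the half-line, and the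
  derivative of its exponent contains the factor \<open>C r b e\<^sup>-\<^sup>b\<^sup>t\<close>, which is the integrand of
  \<open>N_drift\<close> up to a constant.\<close>

lemma N_drift_integration_by_parts:
  "conj_exp * N_drift r + (\<integral>t. log_weight_rate t * exp (conj_exp / b * r * time_change t) \<partial>N_law) = - 1"
proof -
  let ?C = "conj_exp / b * r"
  define g where "g t = exp (log_weight t) * exp (?C * (1 - decay t))" for t
  define g' where "g' t = (log_weight_rate t + ?C * (b * decay t)) * g t" for t
  have dg: "(g has_real_derivative g' t) (at t)" for t
  proof -
    have "((\<lambda>t. exp (log_weight t + ?C * (1 - decay t))) has_real_derivative
        exp (log_weight t + ?C * (1 - decay t)) * (log_weight_rate t + ?C * (0 - - b * decay t))) (at t)"
      by (intro DERIV_fun_exp DERIV_add DERIV_cmult DERIV_diff DERIV_const log_weight_derivative decay_derivative)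
    then show ?thesis unfolding g_def[abs_def] g'_def by (simp add: exp_add mult_ac)
  qed
  obtain D where D: "\<And>t. 0 \<le> t \<Longrightarrow> \<bar>log_weight_rate t\<bar> \<le> D" using log_weight_rate_bounded by blast
  have D0: "0 \<le> D" using D[of 0] by simp
  have cg: "continuous_on S g'" for S
    unfolding g'_def g_def by (intro continuous_intros continuous_parameters)
  let ?e = "\<lambda>t. exp (?C * (1 - decay (max 0 t)))"
  have em[measurable]: "?e \<in> borel_measurable borel" by measurable
  have e_le: "\<bar>?e t\<bar> \<le> exp \<bar>?C\<bar>" for t
    using Nm.mgf_bound(1)[of t 0 ?C] by (simp only: power_0 mult_1_left abs_exp_cancel time_change_def)
  have i1: "integrable lborel (\<lambda>t. indicator {0..} t * exp (log_weight t) * (log_weight_rate t * ?e t))"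
  proof (rule integrable_weight[where K="D * exp \<bar>?C\<bar>"])
    show "\<bar>log_weight_rate t * ?e t\<bar> \<le> D * exp \<bar>?C\<bar>" if "0 \<le> t" for t
      unfolding abs_mult[of "log_weight_rate t"] by (rule mult_mono[OF D[OF that] e_le D0 abs_ge_zero])
  qed measurable
  have i2: "integrable lborel (\<lambda>t. indicator {0..} t * exp (log_weight t) * (decay (max 0 t) * ?e t))"
  proof (rule integrable_weight[where K="1 * exp \<bar>?C\<bar>"])
    show "\<bar>decay (max 0 t) * ?e t\<bar> \<le> 1 * exp \<bar>?C\<bar>" if "0 \<le> t" for t
      unfolding abs_mult[of "decay (max 0 t)"]
    proof (rule mult_mono[OF _ e_le _ abs_ge_zero])
      show "\<bar>decay (max 0 t)\<bar> \<le> 1"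
        unfolding abs_of_pos[OF decay_pos] by (rule decay_le_1) simp
    qed simp
  qed measurable
  have split: "indicator {0..} t * g' t = indicator {0..} t * exp (log_weight t) * (log_weight_rate t * ?e t)
      + conj_exp * r * (indicator {0..} t * exp (log_weight t) * (decay (max 0 t) * ?e t))" for t
    using b_pos by (cases "0 \<le> t") (simp_all add: g'_def g_def algebra_simps)
  have int: "integrable lborel (\<lambda>t. indicator {0..} t * g' t)"
    unfolding split by (intro Bochner_Integration.integrable_add i1 integrable_mult_right i2)
  have I: "(\<integral>t. indicator {0..} t * g' t \<partial>lborel)
      = (\<integral>t. log_weight_rate t * exp (?C * time_change t) \<partial>N_law) + conj_exp * N_drift r"
  proof -
    have "N_fun r - N1 r = (\<integral>t. decay (max 0 t) * ?e t \<partial>N_law)"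
    proof -
      have "(\<lambda>t. decay (max 0 t) * ?e t) = (\<lambda>t. time_change t ^ 0 * exp (?C * time_change t) - time_change t ^ 1 * exp (?C * time_change t))"
        by (simp add: time_change_def algebra_simps)
      then show ?thesis
        unfolding N_fun_def N1_def Nm.mgf_def
        using Nm.integrable_mgf[of 0 ?C] Nm.integrable_mgf[of 1 ?C] by (simp only: Bochner_Integration.integral_diff)
    qed
    also have "\<dots> = (\<integral>t. indicator {0..} t * exp (log_weight t) * (decay (max 0 t) * ?e t) \<partial>lborel)"
      by (rule N_law_integral) measurable
    finally have J: "conj_exp * N_drift r = conj_exp * r * (\<integral>t. indicator {0..} t * exp (log_weight t) * (decay (max 0 t) * ?e t) \<partial>lborel)"
      by (simp add: N_drift_def)
    have K: "(\<integral>t. log_weight_rate t * exp (?C * time_change t) \<partial>N_law)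
        = (\<integral>t. indicator {0..} t * exp (log_weight t) * (log_weight_rate t * ?e t) \<partial>lborel)"
      unfolding time_change_def by (rule N_law_integral) measurable
    show ?thesis
      unfolding J K split using i1 i2
      by (subst Bochner_Integration.integral_add) (auto intro: integrable_mult_right)
  qed
  \<comment> \<open>The fundamental theorem of calculus on \<open>[0, y]\<close>, and the limit \<open>y \<rightarrow> \<infinity>\<close>.\<close>
  have "((\<lambda>y. \<integral>t. indicator {..y} t *\<^sub>R (indicator {0..} t * g' t) \<partial>lborel) \<longlongrightarrow> (\<integral>t. indicator {0..} t * g' t \<partial>lborel)) at_top"
    using int by (intro tendsto_integral_at_top) auto
  moreover have "eventually (\<lambda>y. (\<integral>t. indicator {..y} t *\<^sub>R (indicator {0..} t * g' t) \<partial>lborel) = g y - g 0) at_top"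
    using eventually_ge_at_top[of 0]
  proof eventually_elim
    case (elim y)
    have "(\<integral>t. indicator {..y} t *\<^sub>R (indicator {0..} t * g' t) \<partial>lborel) = (\<integral>t. g' t * indicator {0..y} t \<partial>lborel)"
      by (intro Bochner_Integration.integral_cong refl) (auto simp: indicator_def)
    also have "\<dots> = g y - g 0"
      by (rule integral_FTC_Icc_real[OF elim dg]) (use cg[of UNIV] in \<open>simp add: continuous_on_eq_continuous_at\<close>)
    finally show ?case .
  qed
  ultimately have l1: "((\<lambda>y. g y - g 0) \<longlongrightarrow> (\<integral>t. indicator {0..} t * g' t \<partial>lborel)) at_top"
    by (rule Lim_transform_eventually)
  have "(g \<longlongrightarrow> 0) at_top"
  proof (rule Lim_null_comparison)
    have "((\<lambda>t. exp (- c * t)) \<longlongrightarrow> 0) at_top" if "0 < c" for c :: real using that by real_asymp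
    from tendsto_mult_left_zero[OF this[OF discount_gap_pos], of "exp \<bar>?C\<bar>"]
    show "((\<lambda>t. exp (- discount_gap * t) * exp \<bar>?C\<bar>) \<longlongrightarrow> 0) at_top" .
    show "\<forall>\<^sub>F t in at_top. norm (g t) \<le> exp (- discount_gap * t) * exp \<bar>?C\<bar>"
      using eventually_ge_at_top[of 0]
    proof eventually_elim
      case (elim t)
      have "exp (?C * (1 - decay t)) \<le> exp \<bar>?C\<bar>" using e_le[of t] elim by simp
      then show ?case unfolding g_def real_norm_def abs_mult[of "exp (log_weight t)"] abs_exp_cancel
        using log_weight_le[OF elim] by (intro mult_mono) auto
    qed
  qed
  then have l2: "((\<lambda>y. g y - g 0) \<longlongrightarrow> 0 - g 0) at_top" by (intro tendsto_intros)
  have "(\<integral>t. indicator {0..} t * g' t \<partial>lborel) = 0 - g 0"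
    by (rule tendsto_unique[OF _ l1 l2]) simp
  moreover have "g 0 = 1" by (simp add: g_def log_weight_0)
  ultimately show ?thesis using I by simp
qed

lemma N_drift_bound: "\<exists>D. \<forall>r. \<bar>N_drift r\<bar> \<le> D * (1 + N_fun r)"
proof -
  obtain D where D: "\<And>t. 0 \<le> t \<Longrightarrow> \<bar>log_weight_rate t\<bar> \<le> D" using log_weight_rate_bounded by blast
  have D0: "0 \<le> D" using D[of 0] by simp
  show ?thesis
  proof (intro exI[of _ "(1 + D) / conj_exp"] allI)
    fix r
    let ?C = "conj_exp / b * r"
    have "\<bar>\<integral>t. log_weight_rate t * exp (?C * time_change t) \<partial>N_law\<bar> \<le> (\<integral>t. D * (time_change t ^ 0 * exp (?C * time_change t)) \<partial>N_law)"
    proof (rule order_trans[OF integral_abs_bound integral_mono_AE])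
      have ae: "AE t in N_law. 0 \<le> t"
        unfolding N_law_def by (subst AE_density) (auto simp: indicator_def)
      have dom: "AE t in N_law. \<bar>log_weight_rate t * exp (?C * time_change t)\<bar> \<le> D * (time_change t ^ 0 * exp (?C * time_change t))"
        using ae by eventually_elim (use D in \<open>simp add: abs_mult mult_right_mono\<close>)
      then show "AE t in N_law. \<bar>log_weight_rate t * exp (?C * time_change t)\<bar> \<le> D * (time_change t ^ 0 * exp (?C * time_change t))" .
      show int: "integrable N_law (\<lambda>t. D * (time_change t ^ 0 * exp (?C * time_change t)))"
        by (intro integrable_mult_right Nm.integrable_mgf)
      have [measurable]: "log_weight_rate \<in> borel_measurable N_law"
        using measurable_parameters(3) by (simp add: measurable_cong_sets[OF Nm.sets_\<mu> refl])
      show "integrable N_law (\<lambda>t. \<bar>log_weight_rate t * exp (?C * time_change t)\<bar>)"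
        by (rule Bochner_Integration.integrable_bound[OF int]) (use dom D0 in \<open>auto elim!: eventually_mono\<close>)
    qed
    also have "\<dots> = D * N_fun r" by (simp add: N_fun_def Nm.mgf_def)
    finally have "conj_exp * \<bar>N_drift r\<bar> \<le> 1 + D * N_fun r"
      using N_drift_integration_by_parts[of r] conj_exp_pos by (simp add: abs_mult[of conj_exp, symmetric, simplified] abs_le_iff) linarith
    also have "\<dots> \<le> (1 + D) * (1 + N_fun r)"
      using D0 N_fun_pos[of r] by (simp add: algebra_simps)
    finally show "\<bar>N_drift r\<bar> \<le> (1 + D) / conj_exp * (1 + N_fun r)"
      using conj_exp_pos by (simp add: field_simps)
  qed
qed

lemma N_pow_split: "N_fun r powr (1 - \<alpha>) = N_fun r powr (- \<alpha>) * N_fun r"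
  using N_fun_pos[of r] by (simp add: powr_mult_base[of "N_fun r" "- \<alpha>"] mult.commute)

lemma generator_N_pow:
  "vasicek_generator a b \<sigma> \<alpha> N_pw r = 1 / 2 * \<sigma>\<^sup>2 * ddN_pw r + a * dN_pw r + \<alpha> * (N_fun r powr (- \<alpha>) * N_drift r)"
proof -
  have c: "b * ((1 - \<alpha>) * (conj_exp / b)) = \<alpha>" unfolding conj_exp_weight using b_pos by simp
  have "b * r * dN_pw r = (b * ((1 - \<alpha>) * (conj_exp / b))) * (r * (N_fun r powr (- \<alpha>) * N1 r))"
    unfolding dN_pw_def by (simp add: mult_ac)
  then have "b * r * dN_pw r = \<alpha> * (r * (N_fun r powr (- \<alpha>) * N1 r))" unfolding c .
  moreover have "N_pw r = N_fun r powr (- \<alpha>) * N_fun r" unfolding N_pow_eq N_pow_split ..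
  ultimately show ?thesis
    unfolding vasicek_generator_def deriv_N_pow left_diff_distrib N_drift_def by (auto simp: algebra_simps)
qed

lemma derivative_bounds: "\<exists>K\<ge>0. \<forall>r. \<bar>1 / 2 * \<sigma>\<^sup>2 * ddN_pw r + a * dN_pw r\<bar> \<le> K * N_pw r"
proof -
  define C where "C = conj_exp / b"
  have C: "0 \<le> C" using conj_exp_pos b_pos by (simp add: C_def)
  note defs = dN_pw_def[folded C_def] ddN_pw_def[folded C_def]
  have dd: "\<bar>ddN_pw r\<bar> \<le> (2 * C\<^sup>2) * N_pw r" and d: "\<bar>dN_pw r\<bar> \<le> C * N_pw r" for r
  proof -
    let ?N = "N_fun r"
    have N0: "0 < ?N" by (rule N_fun_pos)
    have p0: "?N powr (1 - \<alpha>) = ?N powr (- \<alpha>) * ?N" "?N powr (- \<alpha>) = ?N powr (- \<alpha> - 1) * ?N"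
      using N0 powr_mult_base[of ?N "- \<alpha>"] powr_mult_base[of ?N "- \<alpha> - 1"] by (simp_all add: mult.commute)
    have "\<bar>dN_pw r\<bar> = (1 - \<alpha>) * (C * (?N powr (- \<alpha>) * N1 r))"
      unfolding defs using \<alpha> C N_order(1)[of r] by (simp add: abs_mult mult_ac)
    also have "\<dots> \<le> 1 * (C * (?N powr (- \<alpha>) * ?N))"
      using \<alpha> C N_order(1,2)[of r] by (intro mult_mono) auto
    finally show "\<bar>dN_pw r\<bar> \<le> C * N_pw r" unfolding N_pow_eq p0(1) by simp
    have e1: "\<bar>- \<alpha> * ?N powr (- \<alpha> - 1) * (C * N1 r) * (C * N1 r)\<bar> \<le> C\<^sup>2 * N_pw r"
    proof -
      have "\<bar>- \<alpha> * ?N powr (- \<alpha> - 1) * (C * N1 r) * (C * N1 r)\<bar> = \<alpha> * (C\<^sup>2 * (?N powr (- \<alpha> - 1) * (N1 r * N1 r)))"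
        using \<alpha> C N_order(1)[of r] by (simp add: abs_mult power2_eq_square mult_ac)
      also have "\<dots> \<le> 1 * (C\<^sup>2 * (?N powr (- \<alpha> - 1) * (?N * ?N)))"
        using \<alpha> C N_order(1,2)[of r] N0 by (intro mult_mono) auto
      also have "\<dots> = C\<^sup>2 * N_pw r" unfolding N_pow_eq p0 by (simp add: mult_ac)
      finally show ?thesis .
    qed
    have e2: "\<bar>?N powr (- \<alpha>) * (C * (C * N2 r))\<bar> \<le> C\<^sup>2 * N_pw r"
    proof -
      have "\<bar>?N powr (- \<alpha>) * (C * (C * N2 r))\<bar> = C\<^sup>2 * (?N powr (- \<alpha>) * N2 r)"
        using C N_order(3)[of r] by (simp add: abs_mult power2_eq_square mult_ac)
      also have "\<dots> \<le> C\<^sup>2 * (?N powr (- \<alpha>) * ?N)"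
        using C N_order(3,4)[of r] by (intro mult_left_mono) auto
      finally show ?thesis unfolding N_pow_eq p0(1) .
    qed
    have "\<bar>ddN_pw r\<bar> \<le> 1 * \<bar>- \<alpha> * ?N powr (- \<alpha> - 1) * (C * N1 r) * (C * N1 r) + ?N powr (- \<alpha>) * (C * (C * N2 r))\<bar>"
      unfolding defs abs_mult[of "1 - \<alpha>"] using \<alpha> by (intro mult_right_mono) auto
    also have "\<dots> \<le> C\<^sup>2 * N_pw r + C\<^sup>2 * N_pw r"
      unfolding mult_1_left by (rule order_trans[OF abs_triangle_ineq add_mono[OF e1 e2]])
    finally show "\<bar>ddN_pw r\<bar> \<le> (2 * C\<^sup>2) * N_pw r" by simp
  qed
  show ?thesis
  proof (intro exI[of _ "1 / 2 * \<sigma>\<^sup>2 * (2 * C\<^sup>2) + a * C"] conjI allI)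
    show "0 \<le> 1 / 2 * \<sigma>\<^sup>2 * (2 * C\<^sup>2) + a * C" using a_pos C by simp
    fix r
    have "\<bar>1 / 2 * \<sigma>\<^sup>2 * ddN_pw r + a * dN_pw r\<bar> \<le> 1 / 2 * \<sigma>\<^sup>2 * \<bar>ddN_pw r\<bar> + a * \<bar>dN_pw r\<bar>"
      using a_pos by (intro order_trans[OF abs_triangle_ineq]) (simp add: abs_mult)
    also have "\<dots> \<le> 1 / 2 * \<sigma>\<^sup>2 * ((2 * C\<^sup>2) * N_pw r) + a * (C * N_pw r)"
      using dd[of r] d[of r] a_pos by (intro add_mono mult_left_mono) auto
    finally show "\<bar>1 / 2 * \<sigma>\<^sup>2 * ddN_pw r + a * dN_pw r\<bar> \<le> (1 / 2 * \<sigma>\<^sup>2 * (2 * C\<^sup>2) + a * C) * N_pw r"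
      by (simp add: algebra_simps)
  qed
qed

text \<open>For large positive \<open>r\<close> the drift is of the order of \<open>1 + N\<close>, and the negative power \<open>N\<^sup>-\<^sup>\<alpha>\<close> is bounded
  by monotonicity. On the negative half-line \<open>N\<close> itself is bounded and the factor \<open>|r|\<close> is beaten by
  the weight.\<close>

lemma generator_in_space: "vasicek_generator a b \<sigma> \<alpha> N_pw \<in> weighted_space (\<alpha> / b)"
proof (rule weighted_space_realI)
  let ?w = "\<lambda>r. exp (- (\<alpha> / b) * \<bar>r\<bar>)"
  let ?G = "vasicek_generator a b \<sigma> \<alpha> N_pw"
  obtain K where K: "0 \<le> K" "\<And>r. \<bar>1 / 2 * \<sigma>\<^sup>2 * ddN_pw r + a * dN_pw r\<bar> \<le> K * N_pw r"
    using derivative_bounds by blast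
  obtain D where D: "\<And>r. \<bar>N_drift r\<bar> \<le> D * (1 + N_fun r)" using N_drift_bound by blast
  have G: "\<bar>?G r\<bar> \<le> K * N_pw r + \<alpha> * (N_fun r powr (- \<alpha>) * \<bar>N_drift r\<bar>)" for r
  proof -
    have "\<bar>?G r\<bar> \<le> \<bar>1 / 2 * \<sigma>\<^sup>2 * ddN_pw r + a * dN_pw r\<bar> + \<bar>\<alpha> * (N_fun r powr (- \<alpha>) * N_drift r)\<bar>"
      unfolding generator_N_pow by (rule abs_triangle_ineq)
    also have "\<bar>\<alpha> * (N_fun r powr (- \<alpha>) * N_drift r)\<bar> = \<alpha> * (N_fun r powr (- \<alpha>) * \<bar>N_drift r\<bar>)"
      using \<alpha> by (simp add: abs_mult)
    finally show ?thesis using K(2)[of r] by linarith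
  qed
  show "continuous_on UNIV ?G"
    unfolding generator_N_pow N_drift_def dN_pw_def
    by (intro continuous_intros ddN_continuous N_continuous) (auto simp: less_imp_neq[OF N_fun_pos, symmetric])
  show "((\<lambda>r. ?G r * ?w r) \<longlongrightarrow> 0) at_top"
  proof (rule Lim_null_comparison)
    let ?B = "\<alpha> * D"
    have "((\<lambda>r. (K + ?B) * (N_pw r * ?w r) + (?B * N_fun 0 powr (- \<alpha>)) * ?w r) \<longlongrightarrow> (K + ?B) * 0 + (?B * N_fun 0 powr (- \<alpha>)) * 0) at_top"
      by (intro tendsto_intros N_pow_weighted_at_top exp_weight_at_bot(3))
    then show "((\<lambda>r. (K + ?B) * (N_pw r * ?w r) + (?B * N_fun 0 powr (- \<alpha>)) * ?w r) \<longlongrightarrow> 0) at_top"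
      by simp
    show "\<forall>\<^sub>F r in at_top. norm (?G r * ?w r) \<le> (K + ?B) * (N_pw r * ?w r) + (?B * N_fun 0 powr (- \<alpha>)) * ?w r"
      using eventually_ge_at_top[of 0]
    proof eventually_elim
      case (elim r)
      have D0: "0 \<le> D"
        using order_trans[OF abs_ge_zero D[of 0]] N_fun_pos[of 0] by (simp add: zero_le_mult_iff)
      have "N_fun r powr (- \<alpha>) * \<bar>N_drift r\<bar> \<le> N_fun r powr (- \<alpha>) * (D * (1 + N_fun r))"
        using D[of r] by (intro mult_left_mono) auto
      also have "\<dots> = D * N_fun r powr (- \<alpha>) + D * N_pw r"
        unfolding N_pow_eq N_pow_split by (simp add: algebra_simps)
      also have "\<dots> \<le> D * N_fun 0 powr (- \<alpha>) + D * N_pw r"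
        using D0 \<alpha> N_fun_mono[OF elim] N_fun_pos[of 0]
        by (intro add_right_mono mult_left_mono powr_mono2') auto
      finally have "\<alpha> * (N_fun r powr (- \<alpha>) * \<bar>N_drift r\<bar>) \<le> \<alpha> * (D * N_fun 0 powr (- \<alpha>) + D * N_pw r)"
        using \<alpha> by (intro mult_left_mono) auto
      with G[of r] have "\<bar>?G r\<bar> \<le> (K + ?B) * N_pw r + ?B * N_fun 0 powr (- \<alpha>)"
        by (simp add: algebra_simps)
      then have "\<bar>?G r\<bar> * ?w r \<le> ((K + ?B) * N_pw r + ?B * N_fun 0 powr (- \<alpha>)) * ?w r"
        by (rule mult_right_mono) simp
      then show ?case by (simp add: abs_mult algebra_simps)
    qed
  qed
  show "((\<lambda>r. ?G r * ?w r) \<longlongrightarrow> 0) at_bot"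
  proof (rule Lim_null_comparison)
    have "((\<lambda>r. K * (N_pw r * ?w r) + (\<alpha> * N_pw 0) * (\<bar>r\<bar> * ?w r)) \<longlongrightarrow> K * 0 + (\<alpha> * N_pw 0) * 0) at_bot"
      by (intro tendsto_intros N_pow_weighted_at_bot exp_weight_at_bot(1))
    then show "((\<lambda>r. K * (N_pw r * ?w r) + (\<alpha> * N_pw 0) * (\<bar>r\<bar> * ?w r)) \<longlongrightarrow> 0) at_bot"
      by simp
    show "\<forall>\<^sub>F r in at_bot. norm (?G r * ?w r) \<le> K * (N_pw r * ?w r) + (\<alpha> * N_pw 0) * (\<bar>r\<bar> * ?w r)"
      using eventually_le_at_bot[of 0]
    proof eventually_elim
      case (elim r)
      have "\<bar>N_drift r\<bar> \<le> \<bar>r\<bar> * N_fun r"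
        unfolding N_drift_def abs_mult using N_order(1,2)[of r] by (intro mult_left_mono) auto
      then have "N_fun r powr (- \<alpha>) * \<bar>N_drift r\<bar> \<le> N_fun r powr (- \<alpha>) * (\<bar>r\<bar> * N_fun r)"
        by (intro mult_left_mono) auto
      also have "\<dots> = \<bar>r\<bar> * N_pw r" unfolding N_pow_eq N_pow_split by simp
      also have "\<dots> \<le> \<bar>r\<bar> * N_pw 0" using N_pow_left_bound[OF elim] by (intro mult_left_mono) auto
      finally have "\<alpha> * (N_fun r powr (- \<alpha>) * \<bar>N_drift r\<bar>) \<le> \<alpha> * (\<bar>r\<bar> * N_pw 0)"
        using \<alpha> by (intro mult_left_mono) auto
      with G[of r] have "\<bar>?G r\<bar> \<le> K * N_pw r + \<alpha> * (\<bar>r\<bar> * N_pw 0)" by linarith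
      then have "\<bar>?G r\<bar> * ?w r \<le> (K * N_pw r + \<alpha> * (\<bar>r\<bar> * N_pw 0)) * ?w r"
        by (rule mult_right_mono) simp
      then show ?case by (simp add: abs_mult algebra_simps)
    qed
  qed
qed

end

section \<open>Envelopes for the discounted rate\<close>

context vasicek
begin

text \<open>The rate has a stationary scale: its tilted means and its standard deviations are bounded in
  time. So only the mass of \<open>exp (\<theta> \<integral>r)\<close> grows.\<close>

lemma exp_moment_bound:
  assumes \<theta>: "0 \<le> \<theta>" and \<eta>: "0 \<le> \<eta>"
  shows "\<exists>B\<ge>0. \<forall>t\<ge>0. (\<integral>\<^sup>+\<omega>. ennreal (exp (\<eta> * \<bar>\<rho> r t \<omega>\<bar> + \<theta> * cum_rate r t \<omega>)) \<partial>M)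
    \<le> ennreal (B * exp ((\<theta> * a / b + \<theta>\<^sup>2 * \<sigma>\<^sup>2 / (2 * b\<^sup>2)) * t))"
proof -
  let ?g = "\<theta> * a / b + \<theta>\<^sup>2 * \<sigma>\<^sup>2 / (2 * b\<^sup>2)"
  define m0 where "m0 = a / b + \<theta> * \<sigma>\<^sup>2 / (2 * b\<^sup>2)"
  define s0 where "s0 = \<sigma> * sqrt (1 / (2 * b))"
  define I where "I = (\<integral>x. exp (\<eta> * s0 * \<bar>x\<bar>) \<partial>gauss)"
  have s0: "0 \<le> s0" using \<sigma>_pos b_pos by (simp add: s0_def)
  have int: "integrable gauss (\<lambda>x. exp (\<eta> * s0 * \<bar>x\<bar>))"
    by (rule integrable_gaussian_exp_abs) (use \<eta> s0 in simp)
  have I0: "0 \<le> I" unfolding I_def by (intro Bochner_Integration.integral_nonneg) simp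
  have m: "\<bar>tilted_mean \<theta> t\<bar> \<le> m0" if t: "0 \<le> t" for t
  proof -
    let ?x = "1 - decay t"
    have x: "0 \<le> ?x" "?x \<le> 1" "0 \<le> ?x\<^sup>2" "?x\<^sup>2 \<le> 1"
      using decay_le_1[OF t] decay_pos[of t] by (auto intro!: power_le_one simp: less_imp_le)
    have A: "0 \<le> a / b" and B: "0 \<le> \<theta> * \<sigma>\<^sup>2 / (2 * b\<^sup>2)" using a_pos b_pos \<theta> by auto
    show ?thesis
      using mult_unit_interval[OF A x(1,2)] mult_unit_interval[OF B x(3,4)] unfolding tilted_mean_def m0_def by simp
  qed
  have s: "0 \<le> rate_sd t" "rate_sd t \<le> s0" if t: "0 \<le> t" for t
  proof -
    show "0 \<le> rate_sd t" by (rule rate_sd_nonneg[OF t])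
    show "rate_sd t \<le> s0"
      unfolding rate_sd_def s0_def using \<sigma>_pos b_pos
      by (intro mult_left_mono real_sqrt_le_mono divide_right_mono) auto
  qed
  show ?thesis
  proof (intro exI[of _ "exp (\<theta> * \<bar>r\<bar> / b + \<eta> * (\<bar>r\<bar> + m0)) * I"] conjI allI impI)
    show "0 \<le> exp (\<theta> * \<bar>r\<bar> / b + \<eta> * (\<bar>r\<bar> + m0)) * I" using I0 by simp
    fix t :: real assume t: "0 \<le> t"
    let ?y = "\<lambda>x. decay t * r + tilted_mean \<theta> t + rate_sd t * x"
    have q: "0 < decay t" "decay t \<le> 1" using decay_le_1[OF t] by auto
    have "(\<integral>\<^sup>+\<omega>. ennreal (exp (\<eta> * \<bar>\<rho> r t \<omega>\<bar> + \<theta> * cum_rate r t \<omega>)) \<partial>M)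
      = (\<integral>\<^sup>+\<omega>. ennreal (exp (\<eta> * \<bar>\<rho> r t \<omega>\<bar>)) * ennreal (exp (\<theta> * cum_rate r t \<omega>)) \<partial>M)"
      by (simp only: exp_add ennreal_mult exp_ge_zero)
    also have "\<dots> = ennreal (exp (\<theta> * r * (1 - decay t) / b + log_mass \<theta> t)) *
        (\<integral>\<^sup>+x. ennreal (exp (\<eta> * \<bar>?y x\<bar>)) \<partial>gauss)"
      by (rule nn_integral_kernel[OF _ t]) measurable
    also have "\<dots> \<le> ennreal (exp (\<theta> * \<bar>r\<bar> / b + ?g * t)) *
        (\<integral>\<^sup>+x. ennreal (exp (\<eta> * (\<bar>r\<bar> + m0))) * ennreal (exp (\<eta> * s0 * \<bar>x\<bar>)) \<partial>gauss)"
    proof (intro mult_mono ennreal_leI nn_integral_mono)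
      have "r * (1 - decay t) \<le> \<bar>r\<bar> * 1" using q by (intro mult_mono) auto
      then have "\<theta> * (r * (1 - decay t)) / b \<le> \<theta> * \<bar>r\<bar> / b"
        using \<theta> b_pos by (intro divide_right_mono mult_left_mono) auto
      then show "exp (\<theta> * r * (1 - decay t) / b + log_mass \<theta> t) \<le> exp (\<theta> * \<bar>r\<bar> / b + ?g * t)"
        using log_mass_le[OF \<theta> t] by (simp add: mult.assoc)
      fix x
      have "\<bar>?y x\<bar> \<le> \<bar>decay t * r\<bar> + \<bar>tilted_mean \<theta> t\<bar> + \<bar>rate_sd t * x\<bar>" by linarith
      also have "\<bar>decay t * r\<bar> \<le> \<bar>r\<bar>" using q by (simp add: abs_mult mult_left_le_one_le less_imp_le)
      also have "\<bar>rate_sd t * x\<bar> \<le> s0 * \<bar>x\<bar>" using s[OF t] by (simp add: abs_mult mult_right_mono)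
      finally have "\<eta> * \<bar>?y x\<bar> \<le> \<eta> * (\<bar>r\<bar> + m0 + s0 * \<bar>x\<bar>)"
        using m[OF t] \<eta> by (intro mult_left_mono) auto
      then have "exp (\<eta> * \<bar>?y x\<bar>) \<le> exp (\<eta> * (\<bar>r\<bar> + m0)) * exp (\<eta> * s0 * \<bar>x\<bar>)"
        by (simp add: mult_exp_exp algebra_simps)
      then show "ennreal (exp (\<eta> * \<bar>?y x\<bar>)) \<le> ennreal (exp (\<eta> * (\<bar>r\<bar> + m0))) * ennreal (exp (\<eta> * s0 * \<bar>x\<bar>))"
        by (simp only: ennreal_mult[symmetric] exp_ge_zero ennreal_leI)
    qed auto
    also have "(\<integral>\<^sup>+x. ennreal (exp (\<eta> * (\<bar>r\<bar> + m0))) * ennreal (exp (\<eta> * s0 * \<bar>x\<bar>)) \<partial>gauss)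
      = ennreal (exp (\<eta> * (\<bar>r\<bar> + m0))) * ennreal I"
      unfolding I_def using int by (subst nn_integral_cmult) (auto simp: nn_integral_eq_integral)
    also have "ennreal (exp (\<theta> * \<bar>r\<bar> / b + ?g * t)) * (ennreal (exp (\<eta> * (\<bar>r\<bar> + m0))) * ennreal I)
      = ennreal (exp (\<theta> * \<bar>r\<bar> / b + \<eta> * (\<bar>r\<bar> + m0)) * I * exp (?g * t))"
      using I0 by (simp add: ennreal_mult[symmetric] exp_add mult_ac)
    finally show "(\<integral>\<^sup>+\<omega>. ennreal (exp (\<eta> * \<bar>\<rho> r t \<omega>\<bar> + \<theta> * cum_rate r t \<omega>)) \<partial>M)
      \<le> ennreal (exp (\<theta> * \<bar>r\<bar> / b + \<eta> * (\<bar>r\<bar> + m0)) * I * exp (?g * t))" .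
  qed
qed

lemma growth_on_interval:
  assumes \<alpha>: "0 < \<alpha>"
  shows "AE \<omega> in M. \<forall>k\<ge>0. \<forall>L>0. \<exists>S. (\<forall>h\<in>{0..L}. \<alpha> * cum_rate r (k + h) \<omega> + \<alpha> / b * \<bar>\<rho> r (k + h) \<omega>\<bar>
      \<le> \<alpha> * cum_rate r k \<omega> + \<alpha> / b * \<bar>\<rho> r k \<omega>\<bar> + \<alpha> / b * (a * L + 2 * a / b) + 5 * (\<alpha> / b) * \<sigma> * S)
    \<and> (\<forall>c\<ge>0. ennreal (exp (c * S)) \<le> running_sup_abs c k L \<omega>)"
  using rate_equation[of r]
proof eventually_elim
  case (elim \<omega>)
  then have \<omega>: "\<omega> \<in> space M" by blast
  show ?case
  proof (intro allI impI)
    fix k L :: real assume k: "0 \<le> k" and L: "0 < L"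
    obtain S where S: "\<And>s. s \<in> {0..L} \<Longrightarrow> \<bar>W (k + s) \<omega> - W k \<omega>\<bar> \<le> S"
      and R: "\<And>c. 0 \<le> c \<Longrightarrow> ennreal (exp (c * S)) \<le> running_sup_abs c k L \<omega>"
      using path_sup_bound[OF \<omega> k L] by blast
    have "\<alpha> * cum_rate r (k + h) \<omega> + \<alpha> / b * \<bar>\<rho> r (k + h) \<omega>\<bar>
      \<le> \<alpha> * cum_rate r k \<omega> + \<alpha> / b * \<bar>\<rho> r k \<omega>\<bar> + \<alpha> / b * (a * L + 2 * a / b) + 5 * (\<alpha> / b) * \<sigma> * S"
      if h: "h \<in> {0..L}" for h
    proof -
      have "\<alpha> * integral {0..k + h} (\<lambda>s. \<rho> r s \<omega>) + \<alpha> / b * \<bar>\<rho> r (k + h) \<omega>\<bar>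
        \<le> \<alpha> * integral {0..k} (\<lambda>s. \<rho> r s \<omega>) + \<alpha> / b * \<bar>\<rho> r k \<omega>\<bar> + \<alpha> / b * (a * L + 2 * a / b + 5 * \<sigma> * S)"
        using elim h S
        by (intro vasicek_path_restart[OF a_pos b_pos \<sigma>_pos \<alpha> rate_continuous[OF \<omega>] W_continuous[OF \<omega>] _ k]) auto
      then show ?thesis
        unfolding cum_rate_integral[OF \<omega>]
      proof -
        have "\<alpha> / b * (X + 5 * \<sigma> * S) = \<alpha> / b * X + 5 * (\<alpha> / b) * \<sigma> * S" for X
          by (simp add: distrib_left mult_ac)
        then show "\<alpha> * integral {0..k + h} (\<lambda>s. \<rho> r s \<omega>) + \<alpha> / b * \<bar>\<rho> r (k + h) \<omega>\<bar>
            \<le> \<alpha> * integral {0..k} (\<lambda>s. \<rho> r s \<omega>) + \<alpha> / b * \<bar>\<rho> r k \<omega>\<bar> + \<alpha> / b * (a * L + 2 * a / b + 5 * \<sigma> * S) \<Longrightarrow>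
          \<alpha> * integral {0..k + h} (\<lambda>s. \<rho> r s \<omega>) + \<alpha> / b * \<bar>\<rho> r (k + h) \<omega>\<bar>
            \<le> \<alpha> * integral {0..k} (\<lambda>s. \<rho> r s \<omega>) + \<alpha> / b * \<bar>\<rho> r k \<omega>\<bar> + \<alpha> / b * (a * L + 2 * a / b) + 5 * (\<alpha> / b) * \<sigma> * S"
          by (simp only: add.assoc[symmetric])
      qed
    qed
    with R show "\<exists>S. (\<forall>h\<in>{0..L}. \<alpha> * cum_rate r (k + h) \<omega> + \<alpha> / b * \<bar>\<rho> r (k + h) \<omega>\<bar>
      \<le> \<alpha> * cum_rate r k \<omega> + \<alpha> / b * \<bar>\<rho> r k \<omega>\<bar> + \<alpha> / b * (a * L + 2 * a / b) + 5 * (\<alpha> / b) * \<sigma> * S)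
      \<and> (\<forall>c\<ge>0. ennreal (exp (c * S)) \<le> running_sup_abs c k L \<omega>)"
      by blast
  qed
qed

text \<open>The interval is extended to \<open>t + 1\<close> so that its length is positive also for \<open>t = 0\<close>.\<close>

definition horizon_envelope :: "real \<Rightarrow> real \<Rightarrow> real \<Rightarrow> 'a \<Rightarrow> ennreal" where
  "horizon_envelope \<alpha> r t \<omega> = ennreal (exp (\<alpha> / b * \<bar>r\<bar> + \<alpha> / b * (a * (t + 1) + 2 * a / b)))
     * running_sup_abs (5 * (\<alpha> / b) * \<sigma>) 0 (t + 1) \<omega>"

lemma horizon_envelope_measurable: "0 \<le> t \<Longrightarrow> horizon_envelope \<alpha> r t \<in> borel_measurable M"
  unfolding horizon_envelope_def[abs_def]
  by (intro borel_measurable_times_ennreal borel_measurable_const running_sup_abs_measurable) auto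

lemma horizon_envelope_integral:
  assumes "0 \<le> t" shows "(\<integral>\<^sup>+\<omega>. horizon_envelope \<alpha> r t \<omega> \<partial>M) < \<infinity>"
proof -
  have m: "running_sup_abs (5 * (\<alpha> / b) * \<sigma>) 0 (t + 1) \<in> borel_measurable M"
    using assms by (intro running_sup_abs_measurable) auto
  have "(\<integral>\<^sup>+\<omega>. running_sup_abs (5 * (\<alpha> / b) * \<sigma>) 0 (t + 1) \<omega> \<partial>M) < \<infinity>"
    using assms by (intro le_less_trans[OF nn_integral_running_sup_abs]) auto
  then show ?thesis
    unfolding horizon_envelope_def by (subst nn_integral_cmult[OF m]) (simp add: ennreal_mult_less_top)
qed

lemma horizon_envelope_bound:
  assumes \<alpha>: "0 < \<alpha>"
  shows "AE \<omega> in M. \<forall>t\<ge>0. \<forall>u\<in>{0..t}. ennreal (exp (\<alpha> * cum_rate r u \<omega> + \<alpha> / b * \<bar>\<rho> r u \<omega>\<bar>)) \<le> horizon_envelope \<alpha> r t \<omega>"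
  using growth_on_interval[OF \<alpha>, of r] rate_start[of r]
proof eventually_elim
  case (elim \<omega>)
  then have z: "cum_rate r 0 \<omega> = 0" "\<rho> r 0 \<omega> = r" by auto
  show ?case
  proof (intro allI impI ballI)
    fix t u :: real assume t: "0 \<le> t" and u: "u \<in> {0..t}"
    have "0 < t + 1" using t by simp
    then obtain S where S: "\<And>h. h \<in> {0..t + 1} \<Longrightarrow> \<alpha> * cum_rate r (0 + h) \<omega> + \<alpha> / b * \<bar>\<rho> r (0 + h) \<omega>\<bar>
      \<le> \<alpha> * cum_rate r 0 \<omega> + \<alpha> / b * \<bar>\<rho> r 0 \<omega>\<bar> + \<alpha> / b * (a * (t + 1) + 2 * a / b) + 5 * (\<alpha> / b) * \<sigma> * S"
      and R: "\<And>c. 0 \<le> c \<Longrightarrow> ennreal (exp (c * S)) \<le> running_sup_abs c 0 (t + 1) \<omega>"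
      using elim(1) by (metis order_refl)
    have "\<alpha> * cum_rate r u \<omega> + \<alpha> / b * \<bar>\<rho> r u \<omega>\<bar> \<le> (\<alpha> / b * \<bar>r\<bar> + \<alpha> / b * (a * (t + 1) + 2 * a / b)) + 5 * (\<alpha> / b) * \<sigma> * S"
      using S[of u] u unfolding z by simp
    then have "ennreal (exp (\<alpha> * cum_rate r u \<omega> + \<alpha> / b * \<bar>\<rho> r u \<omega>\<bar>))
      \<le> ennreal (exp (\<alpha> / b * \<bar>r\<bar> + \<alpha> / b * (a * (t + 1) + 2 * a / b))) * ennreal (exp (5 * (\<alpha> / b) * \<sigma> * S))"
      by (simp only: ennreal_mult[symmetric] exp_ge_zero mult_exp_exp ennreal_leI exp_le_cancel_iff)
    also have "\<dots> \<le> horizon_envelope \<alpha> r t \<omega>"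
      unfolding horizon_envelope_def using \<alpha> b_pos \<sigma>_pos by (intro mult_left_mono R) auto
    finally show "ennreal (exp (\<alpha> * cum_rate r u \<omega> + \<alpha> / b * \<bar>\<rho> r u \<omega>\<bar>)) \<le> horizon_envelope \<alpha> r t \<omega>" .
  qed
qed

section \<open>Uniform integrability up to a finite horizon\<close>

lemma random_time_measurable:
  assumes u: "u \<in> borel_measurable M" "\<And>\<omega>. 0 \<le> u \<omega>"
  shows "(\<lambda>\<omega>. \<rho> r (u \<omega>) \<omega>) \<in> borel_measurable M" "(\<lambda>\<omega>. cum_rate r (u \<omega>) \<omega>) \<in> borel_measurable M"
proof -
  have p: "(\<lambda>\<omega>. (u \<omega>, \<omega>)) \<in> M \<rightarrow>\<^sub>M borel \<Otimes>\<^sub>M M" using u(1) by measurable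
  show "(\<lambda>\<omega>. \<rho> r (u \<omega>) \<omega>) \<in> borel_measurable M"
    using measurable_compose[OF p rate_joint_measurable[of r]] u(2) by (simp add: max_absorb2)
  show "(\<lambda>\<omega>. cum_rate r (u \<omega>) \<omega>) \<in> borel_measurable M"
    using measurable_compose[OF p cum_rate_joint_measurable[of r]] by simp
qed

lemma clipped_time:
  assumes "T \<in> borel_measurable M" "0 \<le> t"
  shows "(\<lambda>\<omega>. enn2real (min (ennreal t) (T \<omega>))) \<in> borel_measurable M"
    and "enn2real (min (ennreal t) (T \<omega>)) \<in> {0..t}"
proof -
  show "(\<lambda>\<omega>. enn2real (min (ennreal t) (T \<omega>))) \<in> borel_measurable M" using assms(1) by measurable
  have "enn2real (min (ennreal t) (T \<omega>)) \<le> enn2real (ennreal t)" by (intro enn2real_mono) auto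
  then show "enn2real (min (ennreal t) (T \<omega>)) \<in> {0..t}" using assms(2) by simp
qed

lemma ennreal_abs_integral_le: "ennreal \<bar>\<integral>x. f x \<partial>N\<bar> \<le> (\<integral>\<^sup>+x. ennreal \<bar>f x\<bar> \<partial>N)" for f :: "'c \<Rightarrow> real"
proof (cases "integrable N f")
  case True
  from integral_norm_bound_ennreal[OF this] show ?thesis by simp
qed (simp add: not_integrable_integral_eq)

context
  fixes \<alpha> :: real and \<phi> :: "real \<Rightarrow> real" and t :: real and T :: "nat \<Rightarrow> 'a \<Rightarrow> ennreal"
  assumes \<alpha>: "0 < \<alpha>" and \<phi>: "\<phi> \<in> weighted_space (\<alpha> / b)" and t: "0 \<le> t"
    and T: "\<And>n. T n \<in> borel_measurable M"
begin

text \<open>The growth condition of the space is matched to the envelope: \<open>|\<phi> r|\<close> is at most a multiple of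
  \<open>e\<^sup>(\<^sup>\<alpha>\<^sup>/\<^sup>b\<^sup>)\<^sup>|\<^sup>r\<^sup>|\<close>.\<close>

lemma discounted_bound:
  "AE \<omega> in M. \<forall>u\<in>{0..t}. ennreal \<bar>\<phi> (\<rho> r u \<omega>) * exp (\<alpha> * cum_rate r u \<omega>)\<bar>
    \<le> ennreal (weighted_norm (\<alpha> / b) \<phi>) * horizon_envelope \<alpha> r t \<omega>"
  using horizon_envelope_bound[OF \<alpha>, of r]
proof eventually_elim
  case (elim \<omega>)
  show ?case
  proof
    fix u assume u: "u \<in> {0..t}"
    have "\<bar>\<phi> (\<rho> r u \<omega>) * exp (\<alpha> * cum_rate r u \<omega>)\<bar> \<le> weighted_norm (\<alpha> / b) \<phi> * exp (\<alpha> / b * \<bar>\<rho> r u \<omega>\<bar>) * exp (\<alpha> * cum_rate r u \<omega>)"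
      unfolding abs_mult abs_exp_cancel by (intro mult_right_mono weighted_growth \<phi>) simp
    also have "\<dots> = weighted_norm (\<alpha> / b) \<phi> * exp (\<alpha> * cum_rate r u \<omega> + \<alpha> / b * \<bar>\<rho> r u \<omega>\<bar>)"
      by (simp add: exp_add mult_ac)
    finally have "ennreal \<bar>\<phi> (\<rho> r u \<omega>) * exp (\<alpha> * cum_rate r u \<omega>)\<bar>
        \<le> ennreal (weighted_norm (\<alpha> / b) \<phi>) * ennreal (exp (\<alpha> * cum_rate r u \<omega> + \<alpha> / b * \<bar>\<rho> r u \<omega>\<bar>))"
      using weighted_norm_nonneg[OF \<phi>] by (simp only: ennreal_mult[symmetric] exp_ge_zero ennreal_leI)
    also have "\<dots> \<le> ennreal (weighted_norm (\<alpha> / b) \<phi>) * horizon_envelope \<alpha> r t \<omega>"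
      using elim t u by (intro mult_left_mono) auto
    finally show "ennreal \<bar>\<phi> (\<rho> r u \<omega>) * exp (\<alpha> * cum_rate r u \<omega>)\<bar>
      \<le> ennreal (weighted_norm (\<alpha> / b) \<phi>) * horizon_envelope \<alpha> r t \<omega>" .
  qed
qed

lemma stopped_payoff_uniformly_integrable:
  "uniformly_integrable M (\<lambda>n \<omega>. let u = enn2real (min (ennreal t) (T n \<omega>)) in
     \<phi> (\<rho> r u \<omega>) * exp (\<alpha> * cum_rate r u \<omega>))"
  unfolding Let_def
proof (rule uniformly_integrable_dominated)
  let ?Y = "\<lambda>\<omega>. ennreal (weighted_norm (\<alpha> / b) \<phi>) * horizon_envelope \<alpha> r t \<omega>"
  show "?Y \<in> borel_measurable M"
    by (intro borel_measurable_times_ennreal borel_measurable_const horizon_envelope_measurable t)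
  show "(\<integral>\<^sup>+\<omega>. ?Y \<omega> \<partial>M) < \<infinity>"
    using horizon_envelope_integral[OF t, of \<alpha> r]
    by (subst nn_integral_cmult[OF horizon_envelope_measurable[OF t]]) (simp add: ennreal_mult_less_top)
  fix n
  have u: "enn2real (min (ennreal t) (T n \<omega>)) \<in> {0..t}" for \<omega> by (rule clipped_time(2)[OF T t])
  have [measurable]: "\<phi> \<in> borel_measurable borel" by (rule weighted_space_measurable[OF \<phi>])
  have [measurable]: "(\<lambda>\<omega>. \<rho> r (enn2real (min (ennreal t) (T n \<omega>))) \<omega>) \<in> borel_measurable M"
    "(\<lambda>\<omega>. cum_rate r (enn2real (min (ennreal t) (T n \<omega>))) \<omega>) \<in> borel_measurable M"
    using random_time_measurable[OF clipped_time(1)[OF T t], of n r] u by auto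
  show "(\<lambda>\<omega>. \<phi> (\<rho> r (enn2real (min (ennreal t) (T n \<omega>))) \<omega>) * exp (\<alpha> * cum_rate r (enn2real (min (ennreal t) (T n \<omega>))) \<omega>)) \<in> borel_measurable M"
    by measurable
  show "AE \<omega> in M. ennreal \<bar>\<phi> (\<rho> r (enn2real (min (ennreal t) (T n \<omega>))) \<omega>) * exp (\<alpha> * cum_rate r (enn2real (min (ennreal t) (T n \<omega>))) \<omega>)\<bar> \<le> ?Y \<omega>"
    using discounted_bound[of r] by eventually_elim (use u in blast)
qed

lemma stopped_integral_uniformly_integrable:
  "uniformly_integrable M (\<lambda>n \<omega>. let u = enn2real (min (ennreal t) (T n \<omega>)) in
     LBINT s:{0..u}. \<phi> (\<rho> r s \<omega>) * exp (\<alpha> * cum_rate r s \<omega>))"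
  unfolding Let_def
proof (rule uniformly_integrable_dominated)
  let ?Z = "\<lambda>\<omega>. ennreal (weighted_norm (\<alpha> / b) \<phi>) * horizon_envelope \<alpha> r t \<omega>"
  let ?Y = "\<lambda>\<omega>. ?Z \<omega> * ennreal t"
  have Zm: "?Z \<in> borel_measurable M"
    by (intro borel_measurable_times_ennreal borel_measurable_const horizon_envelope_measurable t)
  then show "?Y \<in> borel_measurable M"
    by (rule borel_measurable_times_ennreal[OF _ borel_measurable_const])
  have "(\<integral>\<^sup>+\<omega>. ?Z \<omega> \<partial>M) < \<infinity>"
    using horizon_envelope_integral[OF t, of \<alpha> r]
    by (subst nn_integral_cmult[OF horizon_envelope_measurable[OF t]]) (simp add: ennreal_mult_less_top)
  then show "(\<integral>\<^sup>+\<omega>. ?Y \<omega> \<partial>M) < \<infinity>"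
    by (subst nn_integral_multc[OF Zm]) (simp add: ennreal_mult_less_top)
  fix n
  let ?u = "\<lambda>\<omega>. enn2real (min (ennreal t) (T n \<omega>))"
  have u: "?u \<omega> \<in> {0..t}" for \<omega> by (rule clipped_time(2)[OF T t])
  have [measurable]: "\<phi> \<in> borel_measurable borel" by (rule weighted_space_measurable[OF \<phi>])
  have c: "(\<lambda>p. cum_rate r (max 0 (fst p)) (snd p)) \<in> borel_measurable (borel \<Otimes>\<^sub>M M)"
  proof -
    have "(\<lambda>p :: real \<times> 'a. (max 0 (fst p), snd p)) \<in> borel \<Otimes>\<^sub>M M \<rightarrow>\<^sub>M borel \<Otimes>\<^sub>M M" by measurable
    from measurable_compose[OF this cum_rate_joint_measurable[of r]] show ?thesis by simp
  qed
  have "(\<lambda>p. \<phi> (\<rho> r (max 0 (fst p)) (snd p)) * exp (\<alpha> * cum_rate r (max 0 (fst p)) (snd p))) \<in> borel_measurable (borel \<Otimes>\<^sub>M M)"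
    using c rate_joint_measurable[of r] by measurable
  then have li: "(\<lambda>p. LBINT s:{0..fst p}. \<phi> (\<rho> r s (snd p)) * exp (\<alpha> * cum_rate r s (snd p))) \<in> borel_measurable (borel \<Otimes>\<^sub>M M)"
    by (rule running_integral_measurable[where X="\<lambda>s \<omega>. \<phi> (\<rho> r s \<omega>) * exp (\<alpha> * cum_rate r s \<omega>)"])
  have pu: "(\<lambda>\<omega>. (?u \<omega>, \<omega>)) \<in> M \<rightarrow>\<^sub>M borel \<Otimes>\<^sub>M M"
    using clipped_time(1)[OF T t, of n] by measurable
  show "(\<lambda>\<omega>. LBINT s:{0..?u \<omega>}. \<phi> (\<rho> r s \<omega>) * exp (\<alpha> * cum_rate r s \<omega>)) \<in> borel_measurable M"
    using measurable_compose[OF pu li] by (simp only: fst_conv snd_conv)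
  show "AE \<omega> in M. ennreal \<bar>LBINT s:{0..?u \<omega>}. \<phi> (\<rho> r s \<omega>) * exp (\<alpha> * cum_rate r s \<omega>)\<bar> \<le> ?Y \<omega>"
    using discounted_bound[of r]
  proof eventually_elim
    case (elim \<omega>)
    let ?g = "\<lambda>s. \<phi> (\<rho> r s \<omega>) * exp (\<alpha> * cum_rate r s \<omega>)"
    have "ennreal \<bar>LBINT s:{0..?u \<omega>}. ?g s\<bar> \<le> (\<integral>\<^sup>+s. ennreal \<bar>indicator {0..?u \<omega>} s *\<^sub>R ?g s\<bar> \<partial>lborel)"
      unfolding set_lebesgue_integral_def by (rule ennreal_abs_integral_le)
    also have "\<dots> \<le> (\<integral>\<^sup>+s. ?Z \<omega> * indicator {0..t} s \<partial>lborel)"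
      using elim u[of \<omega>] by (intro nn_integral_mono) (auto simp: indicator_def)
    also have "\<dots> = ?Y \<omega>" using t by (simp add: nn_integral_cmult)
    finally show ?case .
  qed
qed

end

end

section \<open>Ruin times\<close>

text \<open>On a compact interval \<open>|v|\<close> attains its minimum, so a path without zero stays away from zero; a path
  with a zero is small at nearby grid points, and rounding down keeps these in the interval.\<close>

lemma hitting_by_grid:
  fixes v :: "real \<Rightarrow> real"
  assumes cont: "continuous_on {0..} v" and t: "0 \<le> t"
  shows "(\<exists>s\<in>{0..t}. v s = 0) \<longleftrightarrow>
    (\<forall>m. \<exists>i n. real i / real (Suc n) \<le> t \<and> \<bar>v (real i / real (Suc n))\<bar> < 1 / real (Suc m))"
proof
  assume "\<exists>s\<in>{0..t}. v s = 0"
  then obtain s where s: "0 \<le> s" "s \<le> t" "v s = 0" by auto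
  have "(\<lambda>n. v (real (nat \<lfloor>s * real (Suc n)\<rfloor>) / real (Suc n))) \<longlonglongrightarrow> v s"
    by (rule continuous_on_tendsto_compose[OF cont floor_grid(2)[OF s(1)]]) (use s in auto)
  then have lim: "(\<lambda>n. \<bar>v (real (nat \<lfloor>s * real (Suc n)\<rfloor>) / real (Suc n))\<bar>) \<longlonglongrightarrow> 0"
    unfolding s(3) by (rule tendsto_rabs_zero)
  show "\<forall>m. \<exists>i n. real i / real (Suc n) \<le> t \<and> \<bar>v (real i / real (Suc n))\<bar> < 1 / real (Suc m)"
  proof
    fix m
    have "eventually (\<lambda>n. \<bar>v (real (nat \<lfloor>s * real (Suc n)\<rfloor>) / real (Suc n))\<bar> < 1 / real (Suc m)) sequentially"
      by (rule order_tendstoD(2)[OF lim]) simp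
    then obtain n where "\<bar>v (real (nat \<lfloor>s * real (Suc n)\<rfloor>) / real (Suc n))\<bar> < 1 / real (Suc m)"
      unfolding eventually_sequentially by blast
    then show "\<exists>i n. real i / real (Suc n) \<le> t \<and> \<bar>v (real i / real (Suc n))\<bar> < 1 / real (Suc m)"
      using order_trans[OF floor_grid(1)[OF s(1)] s(2)] by blast
  qed
next
  assume grid: "\<forall>m. \<exists>i n. real i / real (Suc n) \<le> t \<and> \<bar>v (real i / real (Suc n))\<bar> < 1 / real (Suc m)"
  have "continuous_on {0..t} (\<lambda>s. \<bar>v s\<bar>)"
    by (intro continuous_intros continuous_on_subset[OF cont]) auto
  then obtain s where s: "s \<in> {0..t}" "\<And>u. u \<in> {0..t} \<Longrightarrow> \<bar>v s\<bar> \<le> \<bar>v u\<bar>"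
    using continuous_attains_inf[of "{0..t}" "\<lambda>s. \<bar>v s\<bar>"] t by auto
  have "v s = 0"
  proof (rule ccontr)
    assume "v s \<noteq> 0"
    then obtain m where m: "1 / real (Suc m) < \<bar>v s\<bar>"
      using reals_Archimedean[of "\<bar>v s\<bar>"] by (auto simp: inverse_eq_divide)
    obtain i n where "real i / real (Suc n) \<le> t" "\<bar>v (real i / real (Suc n))\<bar> < 1 / real (Suc m)"
      using grid by blast
    with s(2)[of "real i / real (Suc n)"] m show False by simp
  qed
  with s(1) show "\<exists>s\<in>{0..t}. v s = 0" by blast
qed

text \<open>The zeros form a closed set, so the infimum is attained when it is finite.\<close>

lemma ruin_time_le_iff:
  assumes cont: "continuous_on {0..} (\<lambda>t. V t \<omega>)" and t: "0 \<le> t"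
  shows "ruin_time V \<omega> \<le> ennreal t \<longleftrightarrow> (\<exists>s\<in>{0..t}. V s \<omega> = 0)"
proof
  let ?Z = "{s. 0 \<le> s \<and> V s \<omega> = 0}"
  assume le: "ruin_time V \<omega> \<le> ennreal t"
  have "closed ({0..} \<inter> (\<lambda>s. V s \<omega>) -` {0})"
    by (rule continuous_closed_preimage[OF cont]) auto
  also have "{0..} \<inter> (\<lambda>s. V s \<omega>) -` {0} = ?Z" by auto
  finally have Z: "closed ?Z" .
  have "?Z \<noteq> {}"
  proof
    assume "?Z = {}"
    then have "ruin_time V \<omega> = top" unfolding ruin_time_def by (simp only: image_empty Inf_empty)
    then show False using le by (simp add: top_unique)
  qed
  then have inf: "Inf ?Z \<in> ?Z"
    by (rule closed_contains_Inf) (auto simp: Z bdd_below_def)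
  have "ennreal (Inf ?Z) \<le> ruin_time V \<omega>"
    unfolding ruin_time_def
  proof (rule INF_greatest)
    fix s assume "s \<in> ?Z"
    then have "Inf ?Z \<le> s" by (rule cInf_lower) (auto simp: bdd_below_def)
    then show "ennreal (Inf ?Z) \<le> ennreal s" by (rule ennreal_leI)
  qed
  with le have "ennreal (Inf ?Z) \<le> ennreal t" by (rule order_trans[rotated])
  then have "Inf ?Z \<le> t" using t by (simp add: ennreal_le_iff)
  with inf show "\<exists>s\<in>{0..t}. V s \<omega> = 0" by auto
next
  assume "\<exists>s\<in>{0..t}. V s \<omega> = 0"
  then obtain s where "0 \<le> s" "s \<le> t" "V s \<omega> = 0" by auto
  then have "ruin_time V \<omega> \<le> ennreal s" unfolding ruin_time_def by (intro INF_lower) auto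
  also have "\<dots> \<le> ennreal t" by (rule ennreal_leI) fact
  finally show "ruin_time V \<omega> \<le> ennreal t" .
qed

lemma ruin_time_measurable:
  assumes V: "\<And>t. 0 \<le> t \<Longrightarrow> V t \<in> borel_measurable M"
    and cont: "\<And>\<omega>. \<omega> \<in> space M \<Longrightarrow> continuous_on {0..} (\<lambda>t. V t \<omega>)"
  shows "ruin_time V \<in> borel_measurable M"
proof (rule borel_measurableI_le)
  fix y :: ennreal
  show "{\<omega> \<in> space M. ruin_time V \<omega> \<le> y} \<in> sets M"
  proof (cases y)
    case (real t)
    have [measurable]: "V (real i / real (Suc n)) \<in> borel_measurable M" for i n
      by (rule V) simp
    have "{\<omega> \<in> space M. ruin_time V \<omega> \<le> y} = {\<omega> \<in> space M. \<forall>m. \<exists>i n. real i / real (Suc n) \<le> t \<and> \<bar>V (real i / real (Suc n)) \<omega>\<bar> < 1 / real (Suc m)}"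
      using ruin_time_le_iff[where V=V, OF cont] hitting_by_grid[OF cont] real by auto
    also have "\<dots> \<in> sets M" by measurable
    finally show ?thesis .
  qed simp
qed

section \<open>Discounted values of \<open>N\<close>\<close>

context vasicek_discounted
begin

abbreviation weight :: real where "weight \<equiv> \<alpha> / b"

lemma N_pow_growth: "N_pw x \<le> weighted_norm weight N_pw * exp (weight * \<bar>x\<bar>)"
  using weighted_growth[OF N_pow_in_space, of x] N_pow_nonneg[of x] by simp

lemma N_pow_norm_nonneg: "0 \<le> weighted_norm weight N_pw"
  by (rule weighted_norm_nonneg[OF N_pow_in_space])

lemma gamma_gap: "\<alpha> * a / b + \<alpha>\<^sup>2 * \<sigma>\<^sup>2 / b\<^sup>2 < \<gamma>"
proof -
  have "\<alpha>\<^sup>2 * \<sigma>\<^sup>2 / b\<^sup>2 \<le> \<alpha>\<^sup>2 * \<sigma>\<^sup>2 / ((1 - \<alpha>) * b\<^sup>2)"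
    using \<alpha> b_pos by (intro divide_left_mono) (auto intro: mult_left_le_one_le)
  with \<gamma> show ?thesis by linarith
qed

text \<open>The expectation of \<open>exp (\<alpha> \<integral>r + (\<alpha> / b) |r|)\<close> grows with the rate \<open>\<alpha> a / b + \<alpha>\<^sup>2 \<sigma>\<^sup>2 / (2 b\<^sup>2)\<close>,
  which the discount exceeds.\<close>

lemma discounted_N_vanishes:
  "((\<lambda>t. \<integral>\<^sup>+\<omega>. ennreal (exp (- \<gamma> * t + \<alpha> * cum_rate r t \<omega>) * N_pw (\<rho> r t \<omega>)) \<partial>M) \<longlongrightarrow> 0) at_top"
proof -
  let ?K = "weighted_norm weight N_pw"
  define g where "g = \<alpha> * a / b + \<alpha>\<^sup>2 * \<sigma>\<^sup>2 / (2 * b\<^sup>2)"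
  obtain B where B: "0 \<le> B" "\<And>t. 0 \<le> t \<Longrightarrow> (\<integral>\<^sup>+\<omega>. ennreal (exp (weight * \<bar>\<rho> r t \<omega>\<bar> + \<alpha> * cum_rate r t \<omega>)) \<partial>M) \<le> ennreal (B * exp (g * t))"
    using exp_moment_bound[OF less_imp_le[OF \<alpha>(1)] less_imp_le[OF weight_pos], of r] unfolding g_def by blast
  have "g < \<gamma>"
  proof -
    have "\<alpha>\<^sup>2 * \<sigma>\<^sup>2 / (2 * b\<^sup>2) \<le> \<alpha>\<^sup>2 * \<sigma>\<^sup>2 / b\<^sup>2" using b_pos by (intro divide_left_mono) auto
    then show ?thesis using gamma_gap unfolding g_def by linarith
  qed
  have "((\<lambda>t. exp (- c * t)) \<longlongrightarrow> 0) at_top" if "0 < c" for c :: real using that by real_asymp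
  from tendsto_mult_right_zero[OF this[of "\<gamma> - g"], of "?K * B"] \<open>g < \<gamma>\<close>
  have "((\<lambda>t. ?K * B * exp (- (\<gamma> - g) * t)) \<longlongrightarrow> 0) at_top" by simp
  from tendsto_ennrealI[OF this] have lim: "((\<lambda>t. ennreal (?K * B * exp (- (\<gamma> - g) * t))) \<longlongrightarrow> 0) at_top"
    by simp
  show ?thesis
  proof (rule tendsto_sandwich[OF _ _ tendsto_const lim])
    show "\<forall>\<^sub>F t in at_top. (\<integral>\<^sup>+\<omega>. ennreal (exp (- \<gamma> * t + \<alpha> * cum_rate r t \<omega>) * N_pw (\<rho> r t \<omega>)) \<partial>M) \<le> ennreal (?K * B * exp (- (\<gamma> - g) * t))"
      using eventually_ge_at_top[of 0]
    proof eventually_elim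
      case (elim t)
      have [measurable]: "\<rho> r t \<in> borel_measurable M" "cum_rate r t \<in> borel_measurable M"
        using rate_measurable[OF elim] cum_rate_measurable by auto
      have "(\<integral>\<^sup>+\<omega>. ennreal (exp (- \<gamma> * t + \<alpha> * cum_rate r t \<omega>) * N_pw (\<rho> r t \<omega>)) \<partial>M)
        \<le> (\<integral>\<^sup>+\<omega>. ennreal (?K * exp (- \<gamma> * t)) * ennreal (exp (weight * \<bar>\<rho> r t \<omega>\<bar> + \<alpha> * cum_rate r t \<omega>)) \<partial>M)"
      proof (rule nn_integral_mono)
        fix \<omega>
        have "exp (- \<gamma> * t + \<alpha> * cum_rate r t \<omega>) * N_pw (\<rho> r t \<omega>)
          \<le> exp (- \<gamma> * t + \<alpha> * cum_rate r t \<omega>) * (?K * exp (weight * \<bar>\<rho> r t \<omega>\<bar>))"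
          by (intro mult_left_mono N_pow_growth) simp
        also have "\<dots> = (?K * exp (- \<gamma> * t)) * exp (weight * \<bar>\<rho> r t \<omega>\<bar> + \<alpha> * cum_rate r t \<omega>)"
          by (simp only: exp_add mult_ac)
        finally have "ennreal (exp (- \<gamma> * t + \<alpha> * cum_rate r t \<omega>) * N_pw (\<rho> r t \<omega>))
          \<le> ennreal ((?K * exp (- \<gamma> * t)) * exp (weight * \<bar>\<rho> r t \<omega>\<bar> + \<alpha> * cum_rate r t \<omega>))"
          by (rule ennreal_leI)
        also have "\<dots> = ennreal (?K * exp (- \<gamma> * t)) * ennreal (exp (weight * \<bar>\<rho> r t \<omega>\<bar> + \<alpha> * cum_rate r t \<omega>))"
          by (rule ennreal_mult) (use N_pow_norm_nonneg in auto)
        finally show "ennreal (exp (- \<gamma> * t + \<alpha> * cum_rate r t \<omega>) * N_pw (\<rho> r t \<omega>))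
          \<le> ennreal (?K * exp (- \<gamma> * t)) * ennreal (exp (weight * \<bar>\<rho> r t \<omega>\<bar> + \<alpha> * cum_rate r t \<omega>))" .
      qed
      also have "\<dots> = ennreal (?K * exp (- \<gamma> * t)) * (\<integral>\<^sup>+\<omega>. ennreal (exp (weight * \<bar>\<rho> r t \<omega>\<bar> + \<alpha> * cum_rate r t \<omega>)) \<partial>M)"
        by (rule nn_integral_cmult) measurable
      also have "\<dots> \<le> ennreal (?K * exp (- \<gamma> * t)) * ennreal (B * exp (g * t))"
        by (intro mult_left_mono B(2) elim) simp
      also have "\<dots> = ennreal ((?K * exp (- \<gamma> * t)) * (B * exp (g * t)))"
        by (rule ennreal_mult[symmetric]) (use N_pow_norm_nonneg B(1) in auto)
      also have "(?K * exp (- \<gamma> * t)) * (B * exp (g * t)) = ?K * B * exp (- (\<gamma> - g) * t)"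
      proof -
        have e: "exp (- \<gamma> * t) * exp (g * t) = exp (- (\<gamma> - g) * t)"
          unfolding mult_exp_exp by (rule arg_cong[where f=exp]) (simp add: algebra_simps)
        have "(?K * exp (- \<gamma> * t)) * (B * exp (g * t)) = ?K * B * (exp (- \<gamma> * t) * exp (g * t))"
          by (simp only: mult_ac)
        then show ?thesis unfolding e .
      qed
      finally show ?case .
    qed
  qed simp
qed

text \<open>A bound for the discounted payoff on \<open>[k, k + 1]\<close>. A product \<open>p x\<close> of the value \<open>p\<close> at time \<open>k\<close> and
  the oscillation factor \<open>x\<close> is at most \<open>e\<^sup>\<delta>\<^sup>k p\<^sup>2 + e\<^sup>-\<^sup>\<delta>\<^sup>k x\<^sup>2\<close>; with the right \<open>\<delta>\<close> both terms have
  geometrically decaying expectations.\<close>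

definition interval_envelope :: "real \<Rightarrow> real \<Rightarrow> nat \<Rightarrow> 'a \<Rightarrow> ennreal" where
  "interval_envelope \<delta> r k \<omega> =
    ennreal (exp (2 * (weight * (a + 2 * a / b)) + \<delta> * k - 2 * \<gamma> * k)) * ennreal (exp (2 * weight * \<bar>\<rho> r k \<omega>\<bar> + 2 * \<alpha> * cum_rate r k \<omega>))
    + ennreal (exp (- \<delta> * k)) * running_sup_abs (10 * weight * \<sigma>) k 1 \<omega>"

lemma interval_envelope_measurable: "interval_envelope \<delta> r k \<in> borel_measurable M"
proof -
  have [measurable]: "\<rho> r (real k) \<in> borel_measurable M" "cum_rate r (real k) \<in> borel_measurable M"
    "running_sup_abs (10 * weight * \<sigma>) (real k) 1 \<in> borel_measurable M"
    using rate_measurable[of "real k" r] cum_rate_measurable running_sup_abs_measurable[of "real k" 1] by auto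
  show ?thesis unfolding interval_envelope_def by measurable
qed

lemma interval_envelope_bound:
  "AE \<omega> in M. \<forall>k. \<forall>h\<in>{0..1}. ennreal (exp (- \<gamma> * (real k + h) + \<alpha> * cum_rate r (real k + h) \<omega> + weight * \<bar>\<rho> r (real k + h) \<omega>\<bar>))
    \<le> interval_envelope \<delta> r k \<omega>"
  using growth_on_interval[OF \<alpha>(1), of r]
proof eventually_elim
  case (elim \<omega>)
  show ?case
  proof (intro allI ballI)
    fix k :: nat and h :: real assume h: "h \<in> {0..1}"
    obtain S where S: "\<And>h. h \<in> {0..1} \<Longrightarrow> \<alpha> * cum_rate r (real k + h) \<omega> + weight * \<bar>\<rho> r (real k + h) \<omega>\<bar>
      \<le> \<alpha> * cum_rate r (real k) \<omega> + weight * \<bar>\<rho> r (real k) \<omega>\<bar> + weight * (a * 1 + 2 * a / b) + 5 * weight * \<sigma> * S"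
      and R: "\<And>c. 0 \<le> c \<Longrightarrow> ennreal (exp (c * S)) \<le> running_sup_abs c (real k) 1 \<omega>"
      using elim[rule_format, OF of_nat_0_le_iff zero_less_one, of k] by blast
    define y where "y = weight * (a + 2 * a / b) + (weight * \<bar>\<rho> r k \<omega>\<bar> + \<alpha> * cum_rate r k \<omega>) - \<gamma> * real k"
    define x where "x = 5 * weight * \<sigma> * S"
    have "- \<gamma> * (real k + h) \<le> - \<gamma> * real k"
      using gamma_pos h by (simp add: algebra_simps)
    then have "- \<gamma> * (real k + h) + \<alpha> * cum_rate r (real k + h) \<omega> + weight * \<bar>\<rho> r (real k + h) \<omega>\<bar> \<le> y + x"
      using S[OF h] unfolding y_def x_def by simp
    then have "exp (- \<gamma> * (real k + h) + \<alpha> * cum_rate r (real k + h) \<omega> + weight * \<bar>\<rho> r (real k + h) \<omega>\<bar>) \<le> exp (y + x)"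
      by simp
    also have "\<dots> \<le> exp (2 * y + \<delta> * k) + exp (- \<delta> * k) * exp (2 * x)"
    proof -
      let ?p = "exp (y + \<delta> * k / 2)" and ?q = "exp (x - \<delta> * k / 2)"
      have "exp (y + x) = ?p * ?q" by (simp add: mult_exp_exp)
      also have "\<dots> \<le> ?p\<^sup>2 + ?q\<^sup>2"
      proof -
        have "2 * (?p * ?q) \<le> ?p\<^sup>2 + ?q\<^sup>2" using sum_squares_bound[of ?p ?q] by (simp add: mult.assoc)
        moreover have "0 \<le> ?p * ?q" by simp
        ultimately show ?thesis by linarith
      qed
      also have "?p\<^sup>2 = exp (2 * y + \<delta> * k)" by (simp add: power2_eq_square mult_exp_exp)
      also have "?q\<^sup>2 = exp (- \<delta> * k) * exp (2 * x)" by (simp add: power2_eq_square mult_exp_exp)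
      finally show ?thesis .
    qed
    also have "exp (2 * y + \<delta> * k) = exp (2 * (weight * (a + 2 * a / b)) + \<delta> * k - 2 * \<gamma> * k) * exp (2 * weight * \<bar>\<rho> r k \<omega>\<bar> + 2 * \<alpha> * cum_rate r k \<omega>)"
      unfolding mult_exp_exp y_def by (rule arg_cong[where f=exp]) (simp add: algebra_simps)
    finally have "ennreal (exp (- \<gamma> * (real k + h) + \<alpha> * cum_rate r (real k + h) \<omega> + weight * \<bar>\<rho> r (real k + h) \<omega>\<bar>))
      \<le> ennreal (exp (2 * (weight * (a + 2 * a / b)) + \<delta> * k - 2 * \<gamma> * k)) * ennreal (exp (2 * weight * \<bar>\<rho> r k \<omega>\<bar> + 2 * \<alpha> * cum_rate r k \<omega>))
        + ennreal (exp (- \<delta> * k)) * ennreal (exp (2 * x))"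
      by (simp only: ennreal_mult[symmetric] ennreal_plus[symmetric] exp_ge_zero mult_nonneg_nonneg ennreal_leI)
    also have "\<dots> \<le> interval_envelope \<delta> r k \<omega>"
      unfolding interval_envelope_def
    proof (intro add_left_mono mult_left_mono)
      have "0 \<le> 10 * weight * \<sigma>" using \<alpha> b_pos \<sigma>_pos by simp
      from R[OF this] show "ennreal (exp (2 * x)) \<le> running_sup_abs (10 * weight * \<sigma>) (real k) 1 \<omega>"
        by (simp add: x_def mult.assoc)
    qed simp
    finally show "ennreal (exp (- \<gamma> * (real k + h) + \<alpha> * cum_rate r (real k + h) \<omega> + weight * \<bar>\<rho> r (real k + h) \<omega>\<bar>))
      \<le> interval_envelope \<delta> r k \<omega>" .
  qed
qed

text \<open>The expected square of the value at time \<open>k\<close> is of the order of \<open>e\<^sup>-\<^sup>2\<^sup>\<delta>\<^sup>k\<close>, where \<open>\<delta>\<close> is the excess of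
  \<open>\<gamma>\<close> over \<open>\<alpha> a / b + \<alpha>\<^sup>2 \<sigma>\<^sup>2 / b\<^sup>2\<close>; half of this decay is spent on the factor \<open>e\<^sup>\<delta>\<^sup>k\<close>.\<close>

lemma integrable_global_envelope:
  "\<exists>\<delta>. (\<integral>\<^sup>+\<omega>. (\<Sum>k. interval_envelope \<delta> r k \<omega>) \<partial>M) < \<infinity>"
proof -
  define \<delta> where "\<delta> = \<gamma> - (\<alpha> * a / b + \<alpha>\<^sup>2 * \<sigma>\<^sup>2 / b\<^sup>2)"
  have \<delta>: "0 < \<delta>" using gamma_gap by (simp add: \<delta>_def)
  define g where "g = (2 * \<alpha>) * a / b + (2 * \<alpha>)\<^sup>2 * \<sigma>\<^sup>2 / (2 * b\<^sup>2)"
  have g: "g = 2 * (\<gamma> - \<delta>)"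
    unfolding g_def \<delta>_def by (simp add: power_mult_distrib)
  have nonneg: "0 \<le> 2 * \<alpha>" "0 \<le> 2 * weight" using \<alpha>(1) b_pos by auto
  obtain B where B: "0 \<le> B" "\<And>t. 0 \<le> t \<Longrightarrow> (\<integral>\<^sup>+\<omega>. ennreal (exp (2 * weight * \<bar>\<rho> r t \<omega>\<bar> + 2 * \<alpha> * cum_rate r t \<omega>)) \<partial>M) \<le> ennreal (B * exp (g * t))"
    using exp_moment_bound[OF nonneg, of r] unfolding g_def by blast
  define C where "C = exp (2 * (weight * (a + 2 * a / b)))"
  define D where "D = 8 * exp ((10 * weight * \<sigma>)\<^sup>2 * 1 / 2)"
  have summand: "(\<integral>\<^sup>+\<omega>. interval_envelope \<delta> r k \<omega> \<partial>M) \<le> ennreal ((C * B + D) * exp (- \<delta>) ^ k)" for k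
  proof -
    let ?k = "real k"
    have [measurable]: "\<rho> r ?k \<in> borel_measurable M" "cum_rate r ?k \<in> borel_measurable M"
      using rate_measurable[of ?k r] cum_rate_measurable by auto
    have Rm: "running_sup_abs (10 * weight * \<sigma>) ?k 1 \<in> borel_measurable M" by (rule running_sup_abs_measurable) auto
    have "(\<integral>\<^sup>+\<omega>. interval_envelope \<delta> r k \<omega> \<partial>M)
      = ennreal (exp (2 * (weight * (a + 2 * a / b)) + \<delta> * k - 2 * \<gamma> * k)) * (\<integral>\<^sup>+\<omega>. ennreal (exp (2 * weight * \<bar>\<rho> r k \<omega>\<bar> + 2 * \<alpha> * cum_rate r k \<omega>)) \<partial>M)
      + ennreal (exp (- \<delta> * k)) * (\<integral>\<^sup>+\<omega>. running_sup_abs (10 * weight * \<sigma>) k 1 \<omega> \<partial>M)"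
      unfolding interval_envelope_def using Rm
      by (subst nn_integral_add) (auto simp: nn_integral_cmult)
    also have "\<dots> \<le> ennreal (exp (2 * (weight * (a + 2 * a / b)) + \<delta> * k - 2 * \<gamma> * k)) * ennreal (B * exp (g * k)) + ennreal (exp (- \<delta> * k)) * ennreal D"
      unfolding D_def by (intro add_mono mult_left_mono B(2) nn_integral_running_sup_abs) auto
    also have "\<dots> = ennreal (exp (2 * (weight * (a + 2 * a / b)) + \<delta> * k - 2 * \<gamma> * k) * (B * exp (g * k)) + exp (- \<delta> * k) * D)"
      using B(1) by (simp add: ennreal_mult ennreal_plus D_def)
    also have "exp (2 * (weight * (a + 2 * a / b)) + \<delta> * k - 2 * \<gamma> * k) * (B * exp (g * k)) = C * B * exp (- \<delta> * k)"
    proof -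
      have "exp (2 * (weight * (a + 2 * a / b)) + \<delta> * k - 2 * \<gamma> * k) * exp (g * k) = C * exp (- \<delta> * k)"
        unfolding C_def mult_exp_exp g by (rule arg_cong[where f=exp]) (simp add: algebra_simps)
      then show ?thesis by (simp add: mult_ac)
    qed
    also have "C * B * exp (- \<delta> * k) + exp (- \<delta> * k) * D = (C * B + D) * exp (- \<delta>) ^ k"
      by (simp add: exp_of_nat_mult[symmetric] algebra_simps)
    finally show ?thesis .
  qed
  have "(\<integral>\<^sup>+\<omega>. (\<Sum>k. interval_envelope \<delta> r k \<omega>) \<partial>M) = (\<Sum>k. \<integral>\<^sup>+\<omega>. interval_envelope \<delta> r k \<omega> \<partial>M)"
    by (rule nn_integral_suminf) (rule interval_envelope_measurable)
  also have "\<dots> \<le> (\<Sum>k. ennreal ((C * B + D) * exp (- \<delta>) ^ k))"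
    by (intro suminf_le summand) auto
  also have "\<dots> < \<infinity>"
  proof -
    have "summable (\<lambda>k. (C * B + D) * exp (- \<delta>) ^ k)"
      using \<delta> by (intro summable_mult summable_geometric) simp
    moreover have "0 \<le> C * B + D" using B(1) by (simp add: C_def D_def)
    ultimately have "(\<Sum>k. ennreal ((C * B + D) * exp (- \<delta>) ^ k)) \<noteq> top"
      by (intro ennreal_suminf_neq_top) auto
    then show ?thesis by (simp add: less_top)
  qed
  finally show ?thesis by blast
qed

text \<open>A stopping time falls into some unit interval, so the sum of all interval envelopes dominates
  the stopped payoffs simultaneously.\<close>

lemma stopped_N_uniformly_integrable:
  fixes T :: "'a \<Rightarrow> ennreal"
  assumes T[measurable]: "T \<in> borel_measurable M"
  shows "uniformly_integrable M (\<lambda>n \<omega>. let u = enn2real (min (of_nat n) (T \<omega>)) in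
    exp (- \<gamma> * u + \<alpha> * cum_rate r u \<omega>) * N_pw (\<rho> r u \<omega>) * indicator {\<omega>. T \<omega> < \<infinity>} \<omega>)"
  unfolding Let_def
proof -
  obtain \<delta> where fin: "(\<integral>\<^sup>+\<omega>. (\<Sum>k. interval_envelope \<delta> r k \<omega>) \<partial>M) < \<infinity>"
    using integrable_global_envelope by blast
  let ?K = "weighted_norm weight N_pw"
  let ?Y = "\<lambda>\<omega>. ennreal ?K * (\<Sum>k. interval_envelope \<delta> r k \<omega>)"
  have [measurable]: "interval_envelope \<delta> r k \<in> borel_measurable M" for k by (rule interval_envelope_measurable)
  let ?u = "\<lambda>n \<omega>. enn2real (min (of_nat n) (T \<omega>))"
  show "uniformly_integrable M (\<lambda>n \<omega>. exp (- \<gamma> * ?u n \<omega> + \<alpha> * cum_rate r (?u n \<omega>) \<omega>) * N_pw (\<rho> r (?u n \<omega>) \<omega>) * indicator {\<omega>. T \<omega> < \<infinity>} \<omega>)"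
  proof (rule uniformly_integrable_dominated[of _ _ ?Y])
    show "?Y \<in> borel_measurable M" by measurable
    show "(\<integral>\<^sup>+\<omega>. ?Y \<omega> \<partial>M) < \<infinity>"
      using fin by (subst nn_integral_cmult) (auto simp: ennreal_mult_less_top)
    fix n
    have um[measurable]: "?u n \<in> borel_measurable M" by measurable
    have [measurable]: "(\<lambda>\<omega>. \<rho> r (?u n \<omega>) \<omega>) \<in> borel_measurable M" "(\<lambda>\<omega>. cum_rate r (?u n \<omega>) \<omega>) \<in> borel_measurable M"
      by (rule random_time_measurable[OF um enn2real_nonneg])+
    have [measurable]: "N_pw \<in> borel_measurable borel" by (rule weighted_space_measurable[OF N_pow_in_space])
    show "(\<lambda>\<omega>. exp (- \<gamma> * ?u n \<omega> + \<alpha> * cum_rate r (?u n \<omega>) \<omega>) * N_pw (\<rho> r (?u n \<omega>) \<omega>) * indicator {\<omega>. T \<omega> < \<infinity>} \<omega>) \<in> borel_measurable M"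
      by measurable
    show "AE \<omega> in M. ennreal \<bar>exp (- \<gamma> * ?u n \<omega> + \<alpha> * cum_rate r (?u n \<omega>) \<omega>) * N_pw (\<rho> r (?u n \<omega>) \<omega>) * indicator {\<omega>. T \<omega> < \<infinity>} \<omega>\<bar> \<le> ?Y \<omega>"
      using interval_envelope_bound[of r \<delta>]
    proof eventually_elim
      case (elim \<omega>)
      let ?v = "?u n \<omega>"
      define k where "k = nat \<lfloor>?v\<rfloor>"
      define h where "h = ?v - real k"
      have v0: "0 \<le> ?v" by simp
      have h: "h \<in> {0..1}" and v: "?v = real k + h"
        using v0 by (auto simp: h_def k_def) linarith+
      let ?x = "exp (- \<gamma> * ?v + \<alpha> * cum_rate r ?v \<omega>) * N_pw (\<rho> r ?v \<omega>)"
      have x0: "0 \<le> ?x" using N_pow_nonneg by simp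
      have "\<bar>X * indicator A \<omega>\<bar> \<le> X" if "0 \<le> X" for X :: real and A :: "'a set"
        using that by (auto simp: indicator_def)
      from this[OF x0] have "\<bar>?x * indicator {\<omega>. T \<omega> < \<infinity>} \<omega>\<bar> \<le> ?x" .
      also have "?x \<le> exp (- \<gamma> * ?v + \<alpha> * cum_rate r ?v \<omega>) * (?K * exp (weight * \<bar>\<rho> r ?v \<omega>\<bar>))"
        by (intro mult_left_mono N_pow_growth) simp
      also have "\<dots> = ?K * exp (- \<gamma> * ?v + \<alpha> * cum_rate r ?v \<omega> + weight * \<bar>\<rho> r ?v \<omega>\<bar>)"
        by (simp only: exp_add mult_ac)
      finally have "ennreal \<bar>?x * indicator {\<omega>. T \<omega> < \<infinity>} \<omega>\<bar> \<le> ennreal ?K * ennreal (exp (- \<gamma> * ?v + \<alpha> * cum_rate r ?v \<omega> + weight * \<bar>\<rho> r ?v \<omega>\<bar>))"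
        using N_pow_norm_nonneg by (simp only: ennreal_mult[symmetric] exp_ge_zero ennreal_leI)
      also have "\<dots> \<le> ennreal ?K * interval_envelope \<delta> r k \<omega>"
        using elim h unfolding v by (intro mult_left_mono) auto
      also have "\<dots> \<le> ?Y \<omega>"
        using sum_le_suminf[of "\<lambda>k. interval_envelope \<delta> r k \<omega>" "{k}"] by (intro mult_left_mono) auto
      finally show ?case .
    qed
  qed
qed

end

theorem theorem5:
  fixes M :: "'a measure" and F :: "ennreal \<Rightarrow> 'a measure"
    and W :: "real \<Rightarrow> 'a \<Rightarrow> real" and \<rho> :: "real \<Rightarrow> real \<Rightarrow> 'a \<Rightarrow> real"
    and a b \<sigma> \<alpha> \<gamma> :: real
  assumes "filtered_prob_space M F"
    and "brownian_motion M F W"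
    and "a > 0" "b > 0" "\<sigma> > 0" "0 < \<alpha>" "\<alpha> < 1"
    and "\<And>r. vasicek_solution M F W a b \<sigma> r (\<rho> r)"
    and "\<gamma> > max (\<alpha> * a / b + \<alpha>\<^sup>2 * \<sigma>\<^sup>2 / ((1 - \<alpha>) * b\<^sup>2))
      (\<alpha> * a / b + 3 * \<alpha>\<^sup>2 * \<sigma>\<^sup>2 / (2 * sqrt (1 - \<alpha>) * b\<^sup>2) + \<alpha> * \<sigma> * ((b + 1) / b))"
  shows
    "(\<forall>t\<ge>0. \<forall>r. \<forall>\<phi>\<in>weighted_space (\<alpha> / b). \<forall>T :: nat \<Rightarrow> 'a \<Rightarrow> ennreal.
        (\<forall>n. stopping_time F (T n)) \<longrightarrow>
        uniformly_integrable M (\<lambda>n \<omega>. let u = enn2real (min (ennreal t) (T n \<omega>)) in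
          \<phi> (\<rho> r u \<omega>) * exp (\<alpha> * (LBINT s:{0..u}. \<rho> r s \<omega>))) \<and>
        uniformly_integrable M (\<lambda>n \<omega>. let u = enn2real (min (ennreal t) (T n \<omega>)) in
          LBINT s:{0..u}. \<phi> (\<rho> r s \<omega>) * exp (\<alpha> * (LBINT w:{0..s}. \<rho> r w \<omega>)))) \<and>
     (\<forall>f :: real \<Rightarrow> real. (\<forall>x\<ge>0. 0 \<le> f x) \<longrightarrow> (\<exists>L. L-lipschitz_on {0..} f) \<longrightarrow>
        bounded (f ` {0..}) \<longrightarrow>
        (\<forall>\<phi>\<in>weighted_space (\<alpha> / b). (\<forall>r. 0 \<le> \<phi> r) \<longrightarrow>
          (\<lambda>r. f (\<phi> r)) \<in> weighted_space (\<alpha> / b))) \<and>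
     C0_semigroup_on (weighted_space (\<alpha> / b)) (weighted_norm (\<alpha> / b)) (feynman_kac M \<alpha> \<rho>) \<and>
     (\<forall>r. ((\<lambda>t. \<integral>\<^sup>+\<omega>. ennreal (exp (- \<gamma> * t + \<alpha> * (LBINT s:{0..t}. \<rho> r s \<omega>)) *
          N_pow M \<alpha> \<gamma> \<rho> (\<rho> r t \<omega>)) \<partial>M) \<longlongrightarrow> 0) at_top) \<and>
     (\<forall>C\<in>consumption_plans M F. \<forall>r. \<forall>v>0. \<forall>V. wealth_process M F (\<rho> r) C v V \<longrightarrow>
        uniformly_integrable M (\<lambda>n \<omega>. let u = enn2real (min (of_nat n) (ruin_time V \<omega>)) in
          exp (- \<gamma> * u + \<alpha> * (LBINT s:{0..u}. \<rho> r s \<omega>)) *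
          N_pow M \<alpha> \<gamma> \<rho> (\<rho> r u \<omega>) * indicator {\<omega>. ruin_time V \<omega> < \<infinity>} \<omega>)) \<and>
     (\<forall>r. value_N M \<alpha> \<gamma> \<rho> r < \<infinity>) \<and>
     C2_fun (N_pow M \<alpha> \<gamma> \<rho>) \<and>
     N_pow M \<alpha> \<gamma> \<rho> \<in> weighted_space (\<alpha> / b) \<and>
     vasicek_generator a b \<sigma> \<alpha> (N_pow M \<alpha> \<gamma> \<rho>) \<in> weighted_space (\<alpha> / b)"
proof -
  interpret filtered_prob_space M F by (rule assms(1))
  interpret vasicek_discounted M F W \<rho> a b \<sigma> \<alpha> \<gamma>
    using assms by unfold_locales auto
  have T: "S \<in> borel_measurable M" if "stopping_time F S" for S :: "'a \<Rightarrow> ennreal"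
    using that sets_F_subset space_F by (rule measurable_stopping_time)
  have ruin: "ruin_time V \<in> borel_measurable M" if "wealth_process M F X C v V" for X C v V
    using that unfolding wealth_process_def adapted_def continuous_paths_def
    by (intro ruin_time_measurable) (auto intro: measurable_from_F)
  show ?thesis
  proof (intro conjI allI ballI impI)
    fix t r :: real and \<phi> :: "real \<Rightarrow> real" and T :: "nat \<Rightarrow> 'a \<Rightarrow> ennreal"
    assume h: "0 \<le> t" "\<phi> \<in> weighted_space (\<alpha> / b)" "\<forall>n. stopping_time F (T n)"
    then have Tm: "T n \<in> borel_measurable M" for n by (intro T) blast
    show "uniformly_integrable M (\<lambda>n \<omega>. let u = enn2real (min (ennreal t) (T n \<omega>)) in
          \<phi> (\<rho> r u \<omega>) * exp (\<alpha> * (LBINT s:{0..u}. \<rho> r s \<omega>)))"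
      by (rule stopped_payoff_uniformly_integrable[OF assms(6) h(2,1) Tm])
    show "uniformly_integrable M (\<lambda>n \<omega>. let u = enn2real (min (ennreal t) (T n \<omega>)) in
          LBINT s:{0..u}. \<phi> (\<rho> r s \<omega>) * exp (\<alpha> * (LBINT w:{0..s}. \<rho> r w \<omega>)))"
      by (rule stopped_integral_uniformly_integrable[OF assms(6) h(2,1) Tm])
  next
    fix f \<phi> :: "real \<Rightarrow> real"
    assume "\<exists>L. L-lipschitz_on {0..} f" "bounded (f ` {0..})" "\<phi> \<in> weighted_space (\<alpha> / b)" "\<forall>r. 0 \<le> \<phi> r"
    then show "(\<lambda>r. f (\<phi> r)) \<in> weighted_space (\<alpha> / b)"
      using lipschitz_image_in_weighted_space[OF weight_pos] by blast
  next
    show "C0_semigroup_on (weighted_space (\<alpha> / b)) (weighted_norm (\<alpha> / b)) (feynman_kac M \<alpha> \<rho>)"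
      by (rule feynman_kac_C0_semigroup[OF assms(6)])
  next
    fix r
    show "((\<lambda>t. \<integral>\<^sup>+\<omega>. ennreal (exp (- \<gamma> * t + \<alpha> * (LBINT s:{0..t}. \<rho> r s \<omega>)) *
          N_pow M \<alpha> \<gamma> \<rho> (\<rho> r t \<omega>)) \<partial>M) \<longlongrightarrow> 0) at_top"
      by (rule discounted_N_vanishes)
    show "value_N M \<alpha> \<gamma> \<rho> r < \<infinity>" by (simp add: value_N_eq)
  next
    fix C r v V
    assume wealth: "wealth_process M F (\<rho> r) C v V"
    show "uniformly_integrable M (\<lambda>n \<omega>. let u = enn2real (min (of_nat n) (ruin_time V \<omega>)) in
          exp (- \<gamma> * u + \<alpha> * (LBINT s:{0..u}. \<rho> r s \<omega>)) *
          N_pow M \<alpha> \<gamma> \<rho> (\<rho> r u \<omega>) * indicator {\<omega>. ruin_time V \<omega> < \<infinity>} \<omega>)"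
      by (rule stopped_N_uniformly_integrable[OF ruin[OF wealth]])
  qed (rule N_pow_C2 N_pow_in_space generator_in_space)+
qed

end
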